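(* For any element $w$ in a twisted finite Coxeter group and any integer $d\ge1$ there is an inclusion of sets of roots $\mathfrak R_{b_w^d}\subseteq\mathfrak R\setminus\mathfrak R^w_{\mathrm{st}}$. This implies that for any $i\ge1$: (i) For every $d\geq 1$ there is an inclusion $$\mathfrak R_{\mathrm{DG}_i(b_w^d)}\subseteq\mathfrak R_+\setminus\bigl(\mathrm{DG}_{i-1}(b_w^d)\cdots\mathrm{DG}_1(b_w^d)(\mathfrak R^w_{\mathrm{st}})\bigr),$$ so in particular $\mathfrak R_w\subseteq\mathfrak R_{\mathrm{DG}(b_w^d)}\subseteq\mathfrak R_+\setminus\mathfrak R^w_{\mathrm{st}}$ and $\ell\bigl(\mathrm{DG}_i(b_w^d)\bigr)\le|\mathfrak R_+\setminus\mathfrak R^w_{\mathrm{st}}|$. (ii) Moreover, set $d:=i\bigl(|\mathfrak R_+\setminus\mathfrak R^w_{\mathrm{st}}|-\ell(w)+1\bigr)$; then for any $d'\ge d$ we have $\mathrm{DG}_{i\ge}(b_w^{d'})=\mathrm{DG}_{i\ge}(b_w^d)$.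
   Context: Twisted finite Coxeter groups. $(\tilde W,\{s_1,\ldots,s_n\})$ is a finite Coxeter system and $W=\Omega\ltimes\tilde W$, where $\Omega$ is a group of automorphisms of $\tilde W$ each permuting the simple reflections. $W$ acts on the real reflection representation $V$ of $\tilde W$ (basis the simple roots $\alpha_i$, permuted by $\Omega$). $\mathfrak R$ is the set of roots, $\mathfrak R_\pm$ the positive/negative roots; $\mathfrak R_w=\{\beta\in\mathfrak R_+:w(\beta)\in\mathfrak R_-\}$, $\ell(w)=|\mathfrak R_w|$. $\mathfrak R^w_{\mathrm{st}}$ is the set of stable roots of $w$: those whose orbit under $\langle w\rangle$ consists solely of positive or solely of negative roots. Braids. $\mathrm{Br}^+_{\tilde W}$ is the Artin–Tits braid monoid of $\tilde W$ with generators $b_1,\ldots,b_n$, and $\mathrm{Br}^+=\Omega\ltimes\mathrm{Br}^+_{\tilde W}$. For $w=\delta\tilde w$ ($\delta\in\Omega$, $\tilde w\in\tilde W$), $b_w=\delta b_{\tilde w}$ with $b_{\tilde w}$ the positive lift of any reduced expression of $\tilde w$. For $b=\delta b_{i_l}\cdots b_{i_1}\in\mathrm{Br}^+$ the inversion set is $$\mathfrak R_b=\{\alpha_{i_1},\,s_{i_1}(\alpha_{i_2}),\ldots,\,s_{i_1}\cdots s_{i_{l-1}}(\alpha_{i_l})\},$$ which does not depend on the chosen decomposition (and may contain negative roots). Deligne–Garside normal form. Every $b\in\mathrm{Br}^+$ has a unique (right greedy) normal form $b=\delta\,\mathrm{DG}_m(b)\cdots\mathrm{DG}_1(b)$, where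 $\delta\in\Omega$ and each $\mathrm{DG}_i(b)$ is a nontrivial reduced braid $b_{w_i}$, $w_i\in\tilde W$, such that $\mathrm{DG}_1(b)$ is the greatest right divisor of $b$ of the form $b_v$ with $v\in\tilde W$, $\mathrm{DG}_2(b)$ that of the braid obtained by removing $\mathrm{DG}_1(b)$ on the right, etc. Put $\mathrm{DG}_i(b)=1$ for $i>m$, $\mathrm{DG}(b)=\mathrm{DG}_1(b)$ and $\mathrm{DG}_{i\ge}(b)=\mathrm{DG}_i(b)\cdots\mathrm{DG}_1(b)$. Reduced braids $\mathrm{DG}_i(b)$ are identified with the corresponding elements of $\tilde W$ (in particular they act on roots and have a length). *)

theory Defs
  imports Complex_Main "HOL-Algebra.Bij" "HOL-Algebra.Generated_Groups" "HOL-Algebra.Multiplicative_Group"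
begin

section \<open>Monoids given by generators and relations\<close>

inductive word_cong :: "'a set \<Rightarrow> ('a list \<times> 'a list) set \<Rightarrow> 'a list \<Rightarrow> 'a list \<Rightarrow> bool"
  for S :: "'a set" and R :: "('a list \<times> 'a list) set"
where
  refl: "xs \<in> lists S \<Longrightarrow> word_cong S R xs xs"
| rel: "\<lbrakk>(l, r) \<in> R; l \<in> lists S; r \<in> lists S; us \<in> lists S; vs \<in> lists S\<rbrakk>
    \<Longrightarrow> word_cong S R (us @ l @ vs) (us @ r @ vs)"
| sym: "word_cong S R xs ys \<Longrightarrow> word_cong S R ys xs"
| trans: "\<lbrakk>word_cong S R xs ys; word_cong S R ys zs\<rbrakk> \<Longrightarrow> word_cong S R xs zs"

definition word_class :: "'a set \<Rightarrow> ('a list \<times> 'a list) set \<Rightarrow> 'a list \<Rightarrow> 'a list set" where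
  "word_class S R xs = {ys. word_cong S R xs ys}"

definition presented_monoid :: "'a set \<Rightarrow> ('a list \<times> 'a list) set \<Rightarrow> 'a list set monoid" where
  "presented_monoid S R =
    \<lparr>carrier = word_class S R ` lists S,
     monoid.mult = (\<lambda>A B. \<Union>xs\<in>A. \<Union>ys\<in>B. word_class S R (xs @ ys)),
     one = word_class S R []\<rparr>"

section \<open>Twisted finite Coxeter groups\<close>

definition word_prod :: "('g, 'm) monoid_scheme \<Rightarrow> 'g list \<Rightarrow> 'g" where
  "word_prod G ss = foldr (monoid.mult G) ss \<one>\<^bsub>G\<^esub>"

definition coxeter_matrix :: "('g, 'm) monoid_scheme \<Rightarrow> 'g \<Rightarrow> 'g \<Rightarrow> nat" where
  "coxeter_matrix G s t = group.ord G (s \<otimes>\<^bsub>G\<^esub> t)"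

text \<open>The relations \<open>(s t)^m(s,t) = 1\<close>. The case \<open>s = t\<close> is \<open>s s = 1\<close>, so inverse letters are
  not needed, and the monoid with this presentation is the group with this presentation.\<close>

definition coxeter_relations ::
    "('g, 'm) monoid_scheme \<Rightarrow> 'g set \<Rightarrow> ('g list \<times> 'g list) set" where
  "coxeter_relations G S =
    {(concat (replicate (coxeter_matrix G s t) [s, t]), []) | s t. s \<in> S \<and> t \<in> S}"

locale finite_coxeter_system = group G for G :: "('g, 'm) monoid_scheme" (structure) +
  fixes S :: "'g set"
  assumes finite_carrier: "finite (carrier G)"
    and simple_reflections_subset: "S \<subseteq> carrier G"
    and simple_reflections_generate: "generate G S = carrier G"
    and simple_reflection_involution: "s \<in> S \<Longrightarrow> s \<noteq> \<one> \<and> s \<otimes> s = \<one>"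
    and presentation:
      "\<lbrakk>ss \<in> lists S; ts \<in> lists S; word_prod G ss = word_prod G ts\<rbrakk>
        \<Longrightarrow> word_cong S (coxeter_relations G S) ss ts"

locale twisted_finite_coxeter_group = finite_coxeter_system G S
  for G :: "('g, 'm) monoid_scheme" (structure) and S :: "'g set" +
  fixes \<Omega> :: "('g \<Rightarrow> 'g) set"
  assumes twists_subgroup: "subgroup \<Omega> (AutoGroup G)"
    and twists_permute: "\<delta> \<in> \<Omega> \<Longrightarrow> \<delta> ` S = S"

text \<open>The pair \<open>(d, u)\<close> stands for the product \<open>d u\<close> with the twist on the left, so that
  \<open>(d u) (e v) = (d e) (e\<^sup>-\<^sup>1(u) v)\<close>.\<close>

definition semidirect_product ::
    "('d, 'k) monoid_scheme \<Rightarrow> ('d \<Rightarrow> 'a \<Rightarrow> 'a) \<Rightarrow> ('a, 'm) monoid_scheme \<Rightarrow> ('d \<times> 'a) monoid"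
where
  "semidirect_product D act M =
    \<lparr>carrier = carrier D \<times> carrier M,
     monoid.mult = (\<lambda>(d, u) (e, v). (d \<otimes>\<^bsub>D\<^esub> e, act (inv\<^bsub>D\<^esub> e) u \<otimes>\<^bsub>M\<^esub> v)),
     one = (\<one>\<^bsub>D\<^esub>, \<one>\<^bsub>M\<^esub>)\<rparr>"

definition twist_group :: "('g, 'm) monoid_scheme \<Rightarrow> ('g \<Rightarrow> 'g) set \<Rightarrow> ('g \<Rightarrow> 'g) monoid" where
  "twist_group G \<Omega> = (AutoGroup G)\<lparr>carrier := \<Omega>\<rparr>"

definition twisted_group ::
    "('g, 'm) monoid_scheme \<Rightarrow> ('g \<Rightarrow> 'g) set \<Rightarrow> (('g \<Rightarrow> 'g) \<times> 'g) monoid" where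
  "twisted_group G \<Omega> = semidirect_product (twist_group G \<Omega>) (\<lambda>\<delta> u. \<delta> u) G"

definition untwisted :: "('g, 'm) monoid_scheme \<Rightarrow> (('g \<Rightarrow> 'g) \<times> 'g) set" where
  "untwisted G = {\<one>\<^bsub>AutoGroup G\<^esub>} \<times> carrier G"

section \<open>Reflection representation and roots\<close>

text \<open>A vector \<open>\<Sum>s\<in>S. v s \<cdot> \<alpha>\<^sub>s\<close> is represented by its coordinate function \<open>v\<close>, which
  vanishes outside \<open>S\<close>. Roots are normalized by \<open>B(\<alpha>\<^sub>s, \<alpha>\<^sub>s) = 1\<close>, so twists permute them.\<close>

definition simple_root :: "'g \<Rightarrow> 'g \<Rightarrow> real" where
  "simple_root s = (\<lambda>t. if t = s then 1 else 0)"

definition coxeter_form ::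
    "('g, 'm) monoid_scheme \<Rightarrow> 'g set \<Rightarrow> ('g \<Rightarrow> real) \<Rightarrow> ('g \<Rightarrow> real) \<Rightarrow> real" where
  "coxeter_form G S u v =
    (\<Sum>s\<in>S. \<Sum>t\<in>S. u s * v t * (- cos (pi / real (coxeter_matrix G s t))))"

definition reflect ::
    "('g, 'm) monoid_scheme \<Rightarrow> 'g set \<Rightarrow> 'g \<Rightarrow> ('g \<Rightarrow> real) \<Rightarrow> ('g \<Rightarrow> real)" where
  "reflect G S s v = (\<lambda>t. v t - 2 * coxeter_form G S (simple_root s) v * simple_root s t)"

text \<open>The reflections satisfy the Coxeter relations, so the choice of expression is immaterial.\<close>

definition coxeter_act ::
    "('g, 'm) monoid_scheme \<Rightarrow> 'g set \<Rightarrow> 'g \<Rightarrow> ('g \<Rightarrow> real) \<Rightarrow> ('g \<Rightarrow> real)" where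
  "coxeter_act G S w = foldr (reflect G S) (SOME ss. ss \<in> lists S \<and> word_prod G ss = w)"

definition twist_act :: "'g set \<Rightarrow> ('g \<Rightarrow> 'g) \<Rightarrow> ('g \<Rightarrow> real) \<Rightarrow> ('g \<Rightarrow> real)" where
  "twist_act S \<delta> v = (\<lambda>t. \<Sum>s\<in>S. v s * simple_root (\<delta> s) t)"

definition twisted_act ::
    "('g, 'm) monoid_scheme \<Rightarrow> 'g set \<Rightarrow> ('g \<Rightarrow> 'g) \<times> 'g \<Rightarrow> ('g \<Rightarrow> real) \<Rightarrow> ('g \<Rightarrow> real)" where
  "twisted_act G S w v = twist_act S (fst w) (coxeter_act G S (snd w) v)"

definition roots :: "('g, 'm) monoid_scheme \<Rightarrow> 'g set \<Rightarrow> ('g \<Rightarrow> real) set" where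
  "roots G S = {coxeter_act G S w (simple_root s) | w s. w \<in> carrier G \<and> s \<in> S}"

definition pos_roots :: "('g, 'm) monoid_scheme \<Rightarrow> 'g set \<Rightarrow> ('g \<Rightarrow> real) set" where
  "pos_roots G S = {\<beta> \<in> roots G S. \<forall>s\<in>S. 0 \<le> \<beta> s}"

definition neg_roots :: "('g, 'm) monoid_scheme \<Rightarrow> 'g set \<Rightarrow> ('g \<Rightarrow> real) set" where
  "neg_roots G S = {\<beta> \<in> roots G S. \<forall>s\<in>S. \<beta> s \<le> 0}"

definition inversions ::
    "('g, 'm) monoid_scheme \<Rightarrow> 'g set \<Rightarrow> ('g \<Rightarrow> 'g) \<times> 'g \<Rightarrow> ('g \<Rightarrow> real) set" where
  "inversions G S w = {\<beta> \<in> pos_roots G S. twisted_act G S w \<beta> \<in> neg_roots G S}"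

definition coxeter_length ::
    "('g, 'm) monoid_scheme \<Rightarrow> 'g set \<Rightarrow> ('g \<Rightarrow> 'g) \<times> 'g \<Rightarrow> nat" where
  "coxeter_length G S w = card (inversions G S w)"

definition stable_roots ::
    "('g, 'm) monoid_scheme \<Rightarrow> 'g set \<Rightarrow> ('g \<Rightarrow> 'g) set \<Rightarrow> ('g \<Rightarrow> 'g) \<times> 'g
      \<Rightarrow> ('g \<Rightarrow> real) set" where
  "stable_roots G S \<Omega> w =
    {\<beta> \<in> roots G S.
      (\<forall>x \<in> generate (twisted_group G \<Omega>) {w}. twisted_act G S x \<beta> \<in> pos_roots G S) \<or>
      (\<forall>x \<in> generate (twisted_group G \<Omega>) {w}. twisted_act G S x \<beta> \<in> neg_roots G S)}"

section \<open>Twisted braid monoids\<close>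

fun alternating_word :: "'a \<Rightarrow> 'a \<Rightarrow> nat \<Rightarrow> 'a list" where
  "alternating_word s t 0 = []"
| "alternating_word s t (Suc n) = s # alternating_word t s n"

definition braid_relations ::
    "('g, 'm) monoid_scheme \<Rightarrow> 'g set \<Rightarrow> ('g list \<times> 'g list) set" where
  "braid_relations G S =
    {(alternating_word s t (coxeter_matrix G s t), alternating_word t s (coxeter_matrix G s t))
      | s t. s \<in> S \<and> t \<in> S \<and> s \<noteq> t}"

definition braid_monoid :: "('g, 'm) monoid_scheme \<Rightarrow> 'g set \<Rightarrow> 'g list set monoid" where
  "braid_monoid G S = presented_monoid S (braid_relations G S)"

text \<open>A twist acts letterwise. As it preserves the braid relations and permutes \<open>S\<close>, the image of
  a class of words under \<open>map \<delta>\<close> is again a full class.\<close>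

definition twisted_braid_monoid ::
    "('g, 'm) monoid_scheme \<Rightarrow> 'g set \<Rightarrow> ('g \<Rightarrow> 'g) set
      \<Rightarrow> (('g \<Rightarrow> 'g) \<times> 'g list set) monoid" where
  "twisted_braid_monoid G S \<Omega> =
    semidirect_product (twist_group G \<Omega>) (\<lambda>\<delta> A. map \<delta> ` A) (braid_monoid G S)"

definition reduced_expression :: "('g, 'm) monoid_scheme \<Rightarrow> 'g set \<Rightarrow> 'g \<Rightarrow> 'g list \<Rightarrow> bool" where
  "reduced_expression G S w ss \<longleftrightarrow>
    ss \<in> lists S \<and> word_prod G ss = w \<and>
    (\<forall>ts \<in> lists S. word_prod G ts = w \<longrightarrow> length ss \<le> length ts)"

definition braid_lift ::
    "('g, 'm) monoid_scheme \<Rightarrow> 'g set \<Rightarrow> ('g \<Rightarrow> 'g) \<times> 'g \<Rightarrow> ('g \<Rightarrow> 'g) \<times> 'g list set" where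
  "braid_lift G S w =
    (fst w, word_class S (braid_relations G S) (SOME ss. reduced_expression G S (snd w) ss))"

text \<open>Words are read as products from left to right, so the word \<open>[s\<^sub>l, \<dots>, s\<^sub>1]\<close> is reversed
  before \<open>s\<^sub>1 \<cdots> s\<^sub>k\<close> is applied to the simple root of the next letter.\<close>

definition word_inversions ::
    "('g, 'm) monoid_scheme \<Rightarrow> 'g set \<Rightarrow> 'g list \<Rightarrow> ('g \<Rightarrow> real) set" where
  "word_inversions G S ss =
    {foldr (reflect G S) (take k (rev ss)) (simple_root (rev ss ! k)) | k. k < length ss}"

definition braid_inversions ::
    "('g, 'm) monoid_scheme \<Rightarrow> 'g set \<Rightarrow> ('g \<Rightarrow> 'g) \<times> 'g list set \<Rightarrow> ('g \<Rightarrow> real) set" where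
  "braid_inversions G S b = word_inversions G S (SOME ss. ss \<in> snd b)"

section \<open>Right greedy Deligne--Garside normal form\<close>

definition right_divides :: "('a, 'm) monoid_scheme \<Rightarrow> 'a \<Rightarrow> 'a \<Rightarrow> bool" where
  "right_divides M a b \<longleftrightarrow> (\<exists>c \<in> carrier M. b = c \<otimes>\<^bsub>M\<^esub> a)"

definition DG_head ::
    "('g, 'm) monoid_scheme \<Rightarrow> 'g set \<Rightarrow> ('g \<Rightarrow> 'g) set \<Rightarrow> ('g \<Rightarrow> 'g) \<times> 'g list set
      \<Rightarrow> ('g \<Rightarrow> 'g) \<times> 'g" where
  "DG_head G S \<Omega> b =
    (THE v. v \<in> untwisted G \<and>
      right_divides (twisted_braid_monoid G S \<Omega>) (braid_lift G S v) b \<and>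
      (\<forall>u \<in> untwisted G.
        right_divides (twisted_braid_monoid G S \<Omega>) (braid_lift G S u) b \<longrightarrow>
        right_divides (twisted_braid_monoid G S \<Omega>) (braid_lift G S u) (braid_lift G S v)))"

definition DG_rest ::
    "('g, 'm) monoid_scheme \<Rightarrow> 'g set \<Rightarrow> ('g \<Rightarrow> 'g) set \<Rightarrow> ('g \<Rightarrow> 'g) \<times> 'g list set
      \<Rightarrow> ('g \<Rightarrow> 'g) \<times> 'g list set" where
  "DG_rest G S \<Omega> b =
    (THE c. c \<in> carrier (twisted_braid_monoid G S \<Omega>) \<and>
      b = c \<otimes>\<^bsub>twisted_braid_monoid G S \<Omega>\<^esub> braid_lift G S (DG_head G S \<Omega> b))"

text \<open>The factors are indexed from \<open>1\<close>. \<open>DG_elt\<close> is the group element, \<open>DG\<close> the reduced braid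
  lifting it. Once all nontrivial factors have been split off, the remaining braid is a pure twist,
  whose head is trivial, so later factors are trivial. The twist never enters the factors.\<close>

definition DG_elt ::
    "('g, 'm) monoid_scheme \<Rightarrow> 'g set \<Rightarrow> ('g \<Rightarrow> 'g) set \<Rightarrow> nat \<Rightarrow> ('g \<Rightarrow> 'g) \<times> 'g list set
      \<Rightarrow> ('g \<Rightarrow> 'g) \<times> 'g" where
  "DG_elt G S \<Omega> i b = DG_head G S \<Omega> ((DG_rest G S \<Omega> ^^ (i - 1)) b)"

definition DG ::
    "('g, 'm) monoid_scheme \<Rightarrow> 'g set \<Rightarrow> ('g \<Rightarrow> 'g) set \<Rightarrow> nat \<Rightarrow> ('g \<Rightarrow> 'g) \<times> 'g list set
      \<Rightarrow> ('g \<Rightarrow> 'g) \<times> 'g list set" where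
  "DG G S \<Omega> i b = braid_lift G S (DG_elt G S \<Omega> i b)"

text \<open>\<open>DG_upto i b\<close> is the braid \<open>DG\<^sub>i(b) \<cdots> DG\<^sub>1(b)\<close>, and \<open>DG_elt_upto i b\<close> is the product of
  the same factors in the group.\<close>

primrec DG_upto ::
    "('g, 'm) monoid_scheme \<Rightarrow> 'g set \<Rightarrow> ('g \<Rightarrow> 'g) set \<Rightarrow> nat \<Rightarrow> ('g \<Rightarrow> 'g) \<times> 'g list set
      \<Rightarrow> ('g \<Rightarrow> 'g) \<times> 'g list set" where
  "DG_upto G S \<Omega> 0 b = \<one>\<^bsub>twisted_braid_monoid G S \<Omega>\<^esub>"
| "DG_upto G S \<Omega> (Suc i) b =
    DG G S \<Omega> (Suc i) b \<otimes>\<^bsub>twisted_braid_monoid G S \<Omega>\<^esub> DG_upto G S \<Omega> i b"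

primrec DG_elt_upto ::
    "('g, 'm) monoid_scheme \<Rightarrow> 'g set \<Rightarrow> ('g \<Rightarrow> 'g) set \<Rightarrow> nat \<Rightarrow> ('g \<Rightarrow> 'g) \<times> 'g list set
      \<Rightarrow> ('g \<Rightarrow> 'g) \<times> 'g" where
  "DG_elt_upto G S \<Omega> 0 b = \<one>\<^bsub>twisted_group G \<Omega>\<^esub>"
| "DG_elt_upto G S \<Omega> (Suc i) b =
    DG_elt G S \<Omega> (Suc i) b \<otimes>\<^bsub>twisted_group G \<Omega>\<^esub> DG_elt_upto G S \<Omega> i b"

definition braid_power ::
    "('g, 'm) monoid_scheme \<Rightarrow> 'g set \<Rightarrow> ('g \<Rightarrow> 'g) set \<Rightarrow> ('g \<Rightarrow> 'g) \<times> 'g \<Rightarrow> nat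
      \<Rightarrow> ('g \<Rightarrow> 'g) \<times> 'g list set" where
  "braid_power G S \<Omega> w d = braid_lift G S w [^]\<^bsub>twisted_braid_monoid G S \<Omega>\<^esub> d"

end

theory Submission
  imports Defs
begin

text \<open>Write \<open>b\<^sub>w\<close> for the positive lift of \<open>w\<close> and \<open>R\<^sub>b\<close> for the inversion set of a braid \<open>b\<close>.

  \<^emph>\<open>Inversions.\<close> For a product, \<open>R\<^sub>b\<^sub>c\<close> is the union of \<open>R\<^sub>c\<close> and of the roots that \<open>c\<close> sends
  into \<open>R\<^sub>b\<close> (\<open>binv_mult\<close>). Hence a root \<open>\<beta>\<close> in the inversion set of a power of \<open>b\<^sub>w\<close> has a
  translate \<open>x \<beta>\<close>, with \<open>x\<close> a power of \<open>w\<close>, lying in the inversion set of \<open>w\<close>. Then \<open>x \<beta>\<close> is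
  positive and \<open>w x \<beta>\<close> is negative, so \<open>\<beta>\<close> is not stable. The product of the first \<open>i\<close> Garside
  factors is a right divisor of the power, so an inversion of the factor number \<open>i\<close>, pulled
  back along the earlier factors, is an inversion of the power (\<open>factor_inversion\<close>). Stable
  roots are closed under negation, so exactly half of any translate of them is positive; this
  bounds the length of each factor by the number \<open>N\<close> of positive roots that are not stable
  (\<open>factor_length_le\<close>).

  \<^emph>\<open>Stabilization.\<close> The head, that is the greatest reduced right divisor, of a product \<open>b c\<close>
  depends only on the head of \<open>b\<close> and on \<open>c\<close> (\<open>DG_head_mult_cong\<close>). So the heads of \<open>Y b\<^sub>u\<^sup>j\<close>
  for \<open>j = 0, 1, \<dots>\<close> are constant from the first repetition on. If they also increase, then
  from \<open>j = 1\<close> on their lengths lie between the length of \<open>u\<close> and \<open>N\<close>, and the heads for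
  \<open>j = K\<close> and \<open>j = K + 1\<close> agree, where \<open>K\<close> is \<open>N\<close> minus the length of \<open>u\<close> plus \<open>1\<close>. Let \<open>z\<close> be
  the final head. Since \<open>z\<close> is also the head of \<open>z b\<^sub>u\<close>, that braid equals \<open>b\<^sub>u\<^sub>' z\<close> for some
  \<open>u'\<close> of the same length as \<open>u\<close> (\<open>slide_through_head\<close>). Removing \<open>z\<close> from \<open>Y b\<^sub>u\<^sup>K\<^sup>+\<^sup>j\<close>
  therefore leaves \<open>Y' b\<^sub>u\<^sub>'\<^sup>j\<close>, which has the shape of the original sequence, and the next
  factor becomes constant after \<open>K\<close> more steps (\<open>heads_of_powers_stabilize\<close>,
  \<open>factors_stabilize\<close>).

  \<^emph>\<open>Garside theory.\<close> Heads and right cancellation in the braid monoid are derived from the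
  finite group alone, in the way of Michel. Reading a word from the left, keep a pair \<open>(v, C)\<close>
  of a group element, the head, and a braid, the rest. A letter \<open>s\<close> turns \<open>v = (v u\<^sup>-\<^sup>1) u\<close>
  into \<open>u s\<close>, where \<open>u\<close> is the greatest suffix of \<open>v\<close> that \<open>s\<close> lengthens, and \<open>v u\<^sup>-\<^sup>1\<close> is
  moved to the rest. Along a reduced word this depends only on the element that the word
  represents (\<open>run_reduced\<close>), so it respects the braid relations. Every word is the product of
  its rest and its head, and the last letter of a word can be removed by a formula in the pair
  alone, which is right cancellation (\<open>braid_eq_cancel_letter\<close>). Greatest suffixes exist by a
  confluence argument in the weak order (\<open>common_upper_bound\<close>). The facts about lengths that
  this needs, and Matsumoto's theorem, follow from the root system: multiplying \<open>x\<close> by \<open>s\<close> on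
  the right increases the length exactly if \<open>x\<close> sends the simple root of \<open>s\<close> to a positive
  root (\<open>length_increase_nonneg\<close>).\<close>

section \<open>Presented monoids\<close>

text \<open>Membership of a word in \<open>lists S\<close> guards most rewrite rules below. It is kept folded,
  because those guards no longer match once it is expanded into a quantifier over letters.\<close>

declare in_listsD [rule del] in_listsI [rule del]

lemma rev_in_lists_iff [simp]: "rev xs \<in> lists A \<longleftrightarrow> xs \<in> lists A"
  by (simp add: in_lists_conv_set)

lemma map_in_lists: "\<lbrakk>xs \<in> lists A; \<And>x. x \<in> A \<Longrightarrow> f x \<in> B\<rbrakk> \<Longrightarrow> map f xs \<in> lists B"
  by (auto simp: in_lists_conv_set)

lemma word_cong_in_lists:
  assumes "word_cong S R xs ys"
  shows "xs \<in> lists S" and "ys \<in> lists S"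
  using assms by (induction rule: word_cong.induct) auto

lemma word_cong_context:
  assumes "word_cong S R xs ys" and "us \<in> lists S" and "vs \<in> lists S"
  shows "word_cong S R (us @ xs @ vs) (us @ ys @ vs)"
  using assms
proof (induction arbitrary: us vs rule: word_cong.induct)
  case (refl xs)
  then show ?case by (intro word_cong.refl) simp
next
  case (rel l r us' vs')
  then show ?case
    using word_cong.rel[of l r R S "us @ us'" "vs' @ vs"] by simp
next
  case (sym xs ys)
  then show ?case by (blast intro: word_cong.sym)
next
  case (trans xs ys zs)
  then show ?case by (blast intro: word_cong.trans)
qed

lemma word_cong_append:
  assumes "word_cong S R xs xs'" and "word_cong S R ys ys'"
  shows "word_cong S R (xs @ ys) (xs' @ ys')"
proof -
  have "word_cong S R (xs @ ys) (xs' @ ys)"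
    using word_cong_context[OF assms(1), of "[]" ys] word_cong_in_lists[OF assms(2)] by simp
  moreover have "word_cong S R (xs' @ ys) (xs' @ ys')"
    using word_cong_context[OF assms(2), of xs' "[]"] word_cong_in_lists[OF assms(1)] by simp
  ultimately show ?thesis by (rule word_cong.trans)
qed

lemma word_cong_relation:
  "\<lbrakk>(l, r) \<in> R; l \<in> lists S; r \<in> lists S\<rbrakk> \<Longrightarrow> word_cong S R l r"
  using word_cong.rel[of l r R S "[]" "[]"] by simp

lemma word_cong_map:
  assumes "word_cong S R xs ys"
    and S: "\<And>s. s \<in> S \<Longrightarrow> f s \<in> S'"
    and R: "\<And>l r. \<lbrakk>(l, r) \<in> R; l \<in> lists S; r \<in> lists S\<rbrakk> \<Longrightarrow> (map f l, map f r) \<in> R'"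
  shows "word_cong S' R' (map f xs) (map f ys)"
  using assms(1)
proof (induction rule: word_cong.induct)
  case (refl xs)
  then show ?case using S by (intro word_cong.refl map_in_lists)
next
  case (rel l r us vs)
  have "\<And>zs. zs \<in> lists S \<Longrightarrow> map f zs \<in> lists S'" by (rule map_in_lists[OF _ S])
  then show ?case
    unfolding map_append using rel R by (intro word_cong.rel) blast+
next
  case (sym xs ys)
  then show ?case by (blast intro: word_cong.sym)
next
  case (trans xs ys zs)
  then show ?case by (blast intro: word_cong.trans)
qed

lemma word_class_eq_iff:
  assumes "xs \<in> lists S"
  shows "word_class S R xs = word_class S R ys \<longleftrightarrow> word_cong S R xs ys"
proof
  assume "word_class S R xs = word_class S R ys"
  then have "xs \<in> word_class S R ys"
    using word_cong.refl[OF assms] by (auto simp: word_class_def)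
  then show "word_cong S R xs ys" by (auto simp: word_class_def intro: word_cong.sym)
next
  assume "word_cong S R xs ys"
  then show "word_class S R xs = word_class S R ys"
    unfolding word_class_def by (blast intro: word_cong.sym word_cong.trans)
qed

lemma self_in_word_class: "xs \<in> lists S \<Longrightarrow> xs \<in> word_class S R xs"
  by (simp add: word_class_def word_cong.refl)

lemma some_in_word_class:
  assumes "xs \<in> lists S"
  shows "word_cong S R xs (SOME ys. ys \<in> word_class S R xs)"
  using someI[of "\<lambda>ys. ys \<in> word_class S R xs", OF self_in_word_class[OF assms]]
  by (simp add: word_class_def)

lemma presented_mult:
  assumes "xs \<in> lists S" and "ys \<in> lists S"
  shows "word_class S R xs \<otimes>\<^bsub>presented_monoid S R\<^esub> word_class S R ys = word_class S R (xs @ ys)"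
proof -
  have *: "word_class S R (xs' @ ys') = word_class S R (xs @ ys)"
    if "xs' \<in> word_class S R xs" "ys' \<in> word_class S R ys" for xs' ys'
  proof -
    have "word_cong S R (xs' @ ys') (xs @ ys)"
      using that by (auto simp: word_class_def intro: word_cong_append word_cong.sym)
    then show ?thesis using word_class_eq_iff word_cong_in_lists by metis
  qed
  have "(\<Union>xs'\<in>word_class S R xs. \<Union>ys'\<in>word_class S R ys. word_class S R (xs' @ ys'))
      = (\<Union>xs'\<in>word_class S R xs. \<Union>ys'\<in>word_class S R ys. word_class S R (xs @ ys))"
    by (intro SUP_cong HOL.refl *)
  also have "\<dots> = word_class S R (xs @ ys)"
    using self_in_word_class[OF assms(1), of R] self_in_word_class[OF assms(2), of R] by auto
  finally show ?thesis by (simp add: presented_monoid_def)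
qed

lemma presented_carrier: "carrier (presented_monoid S R) = word_class S R ` lists S"
  by (simp add: presented_monoid_def)

lemma presented_one: "\<one>\<^bsub>presented_monoid S R\<^esub> = word_class S R []"
  by (simp add: presented_monoid_def)

lemma presented_monoid_is_monoid: "monoid (presented_monoid S R)"
proof (rule monoidI)
  fix x y z
  assume "x \<in> carrier (presented_monoid S R)" "y \<in> carrier (presented_monoid S R)"
    "z \<in> carrier (presented_monoid S R)"
  then obtain a b c where
    "a \<in> lists S" "b \<in> lists S" "c \<in> lists S"
    "x = word_class S R a" "y = word_class S R b" "z = word_class S R c"
    by (auto simp: presented_carrier)
  then show "x \<otimes>\<^bsub>presented_monoid S R\<^esub> y \<otimes>\<^bsub>presented_monoid S R\<^esub> z
      = x \<otimes>\<^bsub>presented_monoid S R\<^esub> (y \<otimes>\<^bsub>presented_monoid S R\<^esub> z)"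
    by (simp add: presented_mult)
qed (auto simp: presented_carrier presented_one presented_mult)

section \<open>Semidirect products of monoids\<close>

lemma semidirect_simps:
  "carrier (semidirect_product D act M) = carrier D \<times> carrier M"
  "\<one>\<^bsub>semidirect_product D act M\<^esub> = (\<one>\<^bsub>D\<^esub>, \<one>\<^bsub>M\<^esub>)"
  "(d, u) \<otimes>\<^bsub>semidirect_product D act M\<^esub> (e, v)
     = (d \<otimes>\<^bsub>D\<^esub> e, act (inv\<^bsub>D\<^esub> e) u \<otimes>\<^bsub>M\<^esub> v)"
  by (simp_all add: semidirect_product_def)

lemma semidirect_product_is_monoid:
  assumes D: "group D" and M: "monoid M"
    and hom: "\<And>d. d \<in> carrier D \<Longrightarrow> act d \<in> hom M M"
    and act_one: "\<And>d. d \<in> carrier D \<Longrightarrow> act d \<one>\<^bsub>M\<^esub> = \<one>\<^bsub>M\<^esub>"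
    and one_act: "\<And>x. x \<in> carrier M \<Longrightarrow> act \<one>\<^bsub>D\<^esub> x = x"
    and act_act: "\<And>d e x. \<lbrakk>d \<in> carrier D; e \<in> carrier D; x \<in> carrier M\<rbrakk>
      \<Longrightarrow> act d (act e x) = act (d \<otimes>\<^bsub>D\<^esub> e) x"
  shows "monoid (semidirect_product D act M)"
proof -
  interpret D: group D by fact
  interpret M: monoid M by fact
  have closed: "act d x \<in> carrier M" if "d \<in> carrier D" "x \<in> carrier M" for d x
    using hom[OF that(1)] that(2) by (auto simp: hom_def)
  have mult: "act d (x \<otimes>\<^bsub>M\<^esub> y) = act d x \<otimes>\<^bsub>M\<^esub> act d y"
    if "d \<in> carrier D" "x \<in> carrier M" "y \<in> carrier M" for d x y
    using hom[OF that(1)] that(2,3) by (auto simp: hom_def)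
  show ?thesis
  proof (rule monoidI)
    fix x y z
    assume "x \<in> carrier (semidirect_product D act M)" "y \<in> carrier (semidirect_product D act M)"
      "z \<in> carrier (semidirect_product D act M)"
    then show "x \<otimes>\<^bsub>semidirect_product D act M\<^esub> y \<otimes>\<^bsub>semidirect_product D act M\<^esub> z
        = x \<otimes>\<^bsub>semidirect_product D act M\<^esub> (y \<otimes>\<^bsub>semidirect_product D act M\<^esub> z)"
      by (auto simp: semidirect_simps D.m_assoc M.m_assoc mult closed act_act D.inv_mult_group)
  qed (auto simp: semidirect_simps closed act_one one_act)
qed

section \<open>Words and length in a Coxeter group\<close>

lemma length_alternating_word [simp]: "length (alternating_word s t n) = n"
  by (induction s t n rule: alternating_word.induct) auto

lemma alternating_word_in_lists:
  "\<lbrakk>s \<in> S; t \<in> S\<rbrakk> \<Longrightarrow> alternating_word s t n \<in> lists S"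
  by (induction s t n rule: alternating_word.induct) auto

lemma alternating_word_add:
  "alternating_word s t (m + n)
     = alternating_word s t m @ (if even m then alternating_word s t n else alternating_word t s n)"
  by (induction s t m rule: alternating_word.induct) auto

lemma alternating_word_snoc:
  "alternating_word s t (Suc n) = alternating_word s t n @ [if even n then s else t]"
  using alternating_word_add[of s t n 1] by simp

lemma rev_alternating_word:
  "rev (alternating_word s t n)
     = (if even n then alternating_word t s n else alternating_word s t n)"
proof (induction n)
  case (Suc n)
  have "rev (alternating_word s t (Suc n)) = (if even n then s else t) # rev (alternating_word s t n)"
    by (simp only: alternating_word_snoc rev_append rev.simps append.simps)
  then show ?case using Suc by simp
qed simp

lemma map_alternating_word:
  "map f (alternating_word s t n) = alternating_word (f s) (f t) n"
  by (induction s t n rule: alternating_word.induct) auto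

lemma concat_replicate_pair: "concat (replicate n [s, t]) = alternating_word s t (2 * n)"
  by (induction n) auto

context finite_coxeter_system
begin

lemma S_closed [simp, intro]: "s \<in> S \<Longrightarrow> s \<in> carrier G"
  using simple_reflections_subset by blast

lemma finite_S [simp]: "finite S"
  using finite_carrier simple_reflections_subset by (rule finite_subset[rotated])

lemma square_one: "s \<in> S \<Longrightarrow> s \<otimes> s = \<one>"
  using simple_reflection_involution by blast

lemma mult_twice [simp]: "\<lbrakk>x \<in> carrier G; s \<in> S\<rbrakk> \<Longrightarrow> x \<otimes> s \<otimes> s = x"
  by (simp add: m_assoc square_one)

lemma mult_twice_left [simp]: "\<lbrakk>x \<in> carrier G; s \<in> S\<rbrakk> \<Longrightarrow> s \<otimes> (s \<otimes> x) = x"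
  by (simp add: m_assoc[symmetric] square_one)

lemma inv_simple [simp]: "s \<in> S \<Longrightarrow> inv s = s"
  using square_one inv_equality by blast

lemma word_prod_Nil [simp]: "word_prod G [] = \<one>"
  by (simp add: word_prod_def)

lemma word_prod_Cons [simp]: "word_prod G (s # ss) = s \<otimes> word_prod G ss"
  by (simp add: word_prod_def)

lemma word_prod_closed [simp, intro]: "ss \<in> lists S \<Longrightarrow> word_prod G ss \<in> carrier G"
  by (induction ss) auto

lemma word_prod_append:
  "\<lbrakk>ss \<in> lists S; ts \<in> lists S\<rbrakk> \<Longrightarrow> word_prod G (ss @ ts) = word_prod G ss \<otimes> word_prod G ts"
  by (induction ss) (auto simp: m_assoc)

lemma word_prod_rev: "ss \<in> lists S \<Longrightarrow> word_prod G (rev ss) = inv (word_prod G ss)"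
  by (induction ss) (auto simp: word_prod_append inv_mult_group)

lemma ex_word:
  assumes "x \<in> carrier G"
  shows "\<exists>ss \<in> lists S. word_prod G ss = x"
proof -
  from assms have "x \<in> generate G S" by (simp add: simple_reflections_generate)
  then show ?thesis
  proof (induction rule: generate.induct)
    case one
    show ?case by (rule bexI[of _ "[]"]) auto
  next
    case (incl h)
    then show ?case by (intro bexI[of _ "[h]"]) auto
  next
    case (inv h)
    then show ?case by (intro bexI[of _ "[h]"]) auto
  next
    case (eng h1 h2)
    then obtain ss ts where "ss \<in> lists S" "ts \<in> lists S" "word_prod G ss = h1" "word_prod G ts = h2"
      by blast
    then show ?case by (intro bexI[of _ "ss @ ts"]) (auto simp: word_prod_append)
  qed
qed

abbreviation m :: "'g \<Rightarrow> 'g \<Rightarrow> nat" where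
  "m s t \<equiv> coxeter_matrix G s t"

lemma coxeter_matrix_sym: "\<lbrakk>s \<in> S; t \<in> S\<rbrakk> \<Longrightarrow> m s t = m t s"
  unfolding coxeter_matrix_def using ord_inv[of "t \<otimes> s"] by (simp add: inv_mult_group)

lemma coxeter_matrix_self: "s \<in> S \<Longrightarrow> m s s = 1"
  by (simp add: coxeter_matrix_def square_one)

lemma coxeter_matrix_ge_2:
  assumes "s \<in> S" "t \<in> S" "s \<noteq> t"
  shows "m s t \<ge> 2"
proof -
  have "s \<otimes> t \<noteq> \<one>"
    using assms inv_simple inv_equality[of s t] by force
  then show ?thesis
    using ord_ge_1[OF finite_carrier, of "s \<otimes> t"] ord_eq_1[of "s \<otimes> t"] assms
    unfolding coxeter_matrix_def by force
qed

lemma word_prod_alternating_double: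
  "\<lbrakk>s \<in> S; t \<in> S\<rbrakk> \<Longrightarrow> word_prod G (alternating_word s t (2 * n)) = (s \<otimes> t) [^] n"
proof (induction n)
  case (Suc n)
  then show ?case
    using nat_pow_Suc2[of "s \<otimes> t" n] by (simp add: m_assoc)
qed simp

text \<open>The longest element of the dihedral subgroup generated by \<open>s\<close> and \<open>t\<close>.\<close>

definition longest :: "'g \<Rightarrow> 'g \<Rightarrow> 'g" where
  "longest s t = word_prod G (alternating_word s t (m s t))"

lemma longest_closed [simp]: "\<lbrakk>s \<in> S; t \<in> S\<rbrakk> \<Longrightarrow> longest s t \<in> carrier G"
  by (simp add: longest_def alternating_word_in_lists)

text \<open>The word of \<open>(s t)\<^sup>m = 1\<close> is one alternating word of length \<open>m\<close> followed by the reverse,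
  hence the inverse, of the other.\<close>

lemma longest_sym:
  assumes "s \<in> S" "t \<in> S"
  shows "longest s t = longest t s"
proof -
  let ?a = "alternating_word s t (m s t)" and ?b = "alternating_word t s (m s t)"
  note [simp] = alternating_word_in_lists[OF assms] alternating_word_in_lists[OF assms(2,1)]
  have "alternating_word s t (2 * m s t) = ?a @ rev ?b"
    using alternating_word_add[of s t "m s t" "m s t"]
    by (simp add: mult_2 rev_alternating_word)
  then have "word_prod G ?a \<otimes> inv (word_prod G ?b) = (s \<otimes> t) [^] m s t"
    using word_prod_alternating_double[OF assms, of "m s t"]
    by (simp add: word_prod_append word_prod_rev)
  also have "\<dots> = \<one>" using assms by (simp add: coxeter_matrix_def)
  finally have "word_prod G ?a = word_prod G ?b"
    by (metis (no_types, lifting) \<open>?a \<in> lists S\<close> \<open>?b \<in> lists S\<close> word_prod_closed inv_closed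
        inv_equality inv_inv)
  then show ?thesis using coxeter_matrix_sym[OF assms] by (simp add: longest_def)
qed

lemma inv_longest:
  assumes "s \<in> S" "t \<in> S"
  shows "inv (longest s t) = longest s t"
proof -
  have "inv (longest s t) = word_prod G (rev (alternating_word s t (m s t)))"
    using assms by (simp only: longest_def word_prod_rev alternating_word_in_lists)
  also have "\<dots> = longest s t \<or> \<dots> = longest t s"
    unfolding rev_alternating_word longest_def
    by (simp only: coxeter_matrix_sym[OF assms(2,1)] split: if_split) blast
  finally show ?thesis by (auto simp only: longest_sym[OF assms(2,1)])
qed

definition len :: "'g \<Rightarrow> nat" where
  "len x = (LEAST n. \<exists>ss \<in> lists S. word_prod G ss = x \<and> length ss = n)"

lemma len_le_length: "ss \<in> lists S \<Longrightarrow> len (word_prod G ss) \<le> length ss"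
  unfolding len_def by (rule Least_le) blast

lemma ex_word_len:
  assumes "x \<in> carrier G"
  shows "\<exists>ss \<in> lists S. word_prod G ss = x \<and> length ss = len x"
proof -
  have "\<exists>n. \<exists>ss \<in> lists S. word_prod G ss = x \<and> length ss = n"
    using ex_word[OF assms] by blast
  then show ?thesis unfolding len_def by (rule LeastI_ex)
qed

lemma reduced_expression_iff:
  "reduced_expression G S x ss \<longleftrightarrow> ss \<in> lists S \<and> word_prod G ss = x \<and> length ss = len x"
proof
  assume "reduced_expression G S x ss"
  then have ss: "ss \<in> lists S" "word_prod G ss = x"
    and le: "\<And>ts. ts \<in> lists S \<Longrightarrow> word_prod G ts = x \<Longrightarrow> length ss \<le> length ts"
    by (auto simp: reduced_expression_def)
  obtain ts where "ts \<in> lists S" "word_prod G ts = x" "length ts = len x"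
    using ex_word_len ss by blast
  then show "ss \<in> lists S \<and> word_prod G ss = x \<and> length ss = len x"
    using ss le len_le_length le_antisym by metis
next
  assume "ss \<in> lists S \<and> word_prod G ss = x \<and> length ss = len x"
  then show "reduced_expression G S x ss"
    using len_le_length unfolding reduced_expression_def by metis
qed

lemma len_one [simp]: "len \<one> = 0"
  using len_le_length[of "[]"] by simp

lemma len_eq_0: "x \<in> carrier G \<Longrightarrow> len x = 0 \<longleftrightarrow> x = \<one>"
  using ex_word_len[of x] by auto

lemma len_mult_le:
  assumes "x \<in> carrier G" "y \<in> carrier G"
  shows "len (x \<otimes> y) \<le> len x + len y"
proof -
  obtain ss ts where "ss \<in> lists S" "word_prod G ss = x" "length ss = len x"
    "ts \<in> lists S" "word_prod G ts = y" "length ts = len y"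
    using ex_word_len assms by meson
  then show ?thesis
    using len_le_length[of "ss @ ts"] by (auto simp: word_prod_append)
qed

lemma len_inv [simp]:
  assumes "x \<in> carrier G"
  shows "len (inv x) = len x"
proof -
  have "len (inv y) \<le> len y" if "y \<in> carrier G" for y
  proof -
    obtain ss where "ss \<in> lists S" "word_prod G ss = y" "length ss = len y"
      using ex_word_len \<open>y \<in> carrier G\<close> by meson
    then show ?thesis using len_le_length[of "rev ss"] by (auto simp: word_prod_rev)
  qed
  from this[of x] this[of "inv x"] assms show ?thesis by simp
qed

text \<open>The Coxeter relations preserve the parity of the length of a word. This is why a simple
  reflection always changes the length of an element, in \<open>len_mult_simple\<close>.\<close>

lemma even_length_word_cong:
  "word_cong S (coxeter_relations G S) xs ys \<Longrightarrow> even (length xs) \<longleftrightarrow> even (length ys)"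
  by (induction rule: word_cong.induct)
    (auto simp: coxeter_relations_def concat_replicate_pair)

lemma even_length_iff:
  assumes "ss \<in> lists S"
  shows "even (length ss) \<longleftrightarrow> even (len (word_prod G ss))"
proof -
  obtain ts where "ts \<in> lists S" "word_prod G ts = word_prod G ss" "length ts = len (word_prod G ss)"
    using ex_word_len[of "word_prod G ss"] assms by blast
  then show ?thesis using presentation[of ss ts] even_length_word_cong assms by metis
qed

lemma len_simple [simp]: "s \<in> S \<Longrightarrow> len s = 1"
  using even_length_iff[of "[s]"] len_le_length[of "[s]"] by (cases "len s") auto

lemma len_mult_simple:
  assumes "x \<in> carrier G" "s \<in> S"
  shows "len (x \<otimes> s) = len x + 1 \<or> len x = len (x \<otimes> s) + 1"
proof -
  obtain ss where ss: "ss \<in> lists S" "word_prod G ss = x" "length ss = len x"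
    using ex_word_len assms by meson
  then have "even (len (x \<otimes> s)) \<longleftrightarrow> odd (len x)"
    using even_length_iff[of "ss @ [s]"] even_length_iff[of ss] assms
    by (simp add: word_prod_append)
  moreover have "len (x \<otimes> s) \<le> len x + 1" using len_mult_le[of x s] assms by simp
  moreover have "len x \<le> len (x \<otimes> s) + 1" using len_mult_le[of "x \<otimes> s" s] assms by simp
  ultimately show ?thesis by (cases "len (x \<otimes> s) = len x") auto
qed

lemma ex_right_descent:
  assumes "x \<in> carrier G" "x \<noteq> \<one>"
  shows "\<exists>s \<in> S. len x = len (x \<otimes> s) + 1"
proof -
  obtain ss where ss: "ss \<in> lists S" "word_prod G ss = x" "length ss = len x"
    using ex_word_len assms by meson
  with assms(2) obtain ts s where ts: "ss = ts @ [s]" by (cases ss rule: rev_cases) auto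
  with ss have s: "s \<in> S" "ts \<in> lists S" "x = word_prod G ts \<otimes> s"
    by (auto simp: word_prod_append)
  then have "x \<otimes> s = word_prod G ts" by simp
  then have "len (x \<otimes> s) < len x" using len_le_length[of ts] s ss ts by simp
  then show ?thesis using len_mult_simple[OF assms(1) s(1)] s(1) by auto
qed

section \<open>The reflection representation\<close>

abbreviation form :: "('g \<Rightarrow> real) \<Rightarrow> ('g \<Rightarrow> real) \<Rightarrow> real" where
  "form \<equiv> coxeter_form G S"

abbreviation \<alpha> :: "'g \<Rightarrow> 'g \<Rightarrow> real" where
  "\<alpha> \<equiv> simple_root"

abbreviation \<rho> :: "'g \<Rightarrow> ('g \<Rightarrow> real) \<Rightarrow> ('g \<Rightarrow> real)" where
  "\<rho> \<equiv> reflect G S"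

lemma form_linear_right: "form u (\<lambda>r. a * v r + b * w r) = a * form u v + b * form u w"
  unfolding coxeter_form_def sum_distrib_left sum.distrib[symmetric]
  by (intro sum.cong HOL.refl) (simp add: algebra_simps)

lemma form_sym: "form u v = form v u"
proof -
  have "form u v = (\<Sum>t\<in>S. \<Sum>s\<in>S. u s * v t * (- cos (pi / real (m s t))))"
    unfolding coxeter_form_def by (rule sum.swap)
  also have "\<dots> = form v u"
    unfolding coxeter_form_def
    by (intro sum.cong HOL.refl) (simp add: coxeter_matrix_sym)
  finally show ?thesis .
qed

lemma form_linear_left: "form (\<lambda>r. a * v r + b * w r) u = a * form v u + b * form w u"
  by (simp only: form_sym[of _ u] form_linear_right)

lemma form_simple: "\<lbrakk>s \<in> S; t \<in> S\<rbrakk> \<Longrightarrow> form (\<alpha> s) (\<alpha> t) = - cos (pi / real (m s t))"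
proof -
  assume st: "s \<in> S" "t \<in> S"
  have "form (\<alpha> s) (\<alpha> t)
      = (\<Sum>a\<in>S. \<Sum>b\<in>S. if b = t then (if a = s then - cos (pi / real (m a b)) else 0) else 0)"
    unfolding coxeter_form_def simple_root_def by (intro sum.cong HOL.refl) simp
  then show ?thesis using st by simp
qed

lemma form_self [simp]: "s \<in> S \<Longrightarrow> form (\<alpha> s) (\<alpha> s) = 1"
  by (simp add: form_simple coxeter_matrix_self)

lemma reflect_eq: "\<rho> s v = (\<lambda>r. 1 * v r + (- 2 * form (\<alpha> s) v) * \<alpha> s r)"
  by (simp add: reflect_def)

lemma reflect_linear: "\<rho> s (\<lambda>r. a * v r + b * w r) = (\<lambda>r. a * \<rho> s v r + b * \<rho> s w r)"
  by (simp add: reflect_def form_linear_right algebra_simps)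

lemma form_reflect: "s \<in> S \<Longrightarrow> form (\<rho> s u) (\<rho> s v) = form u v"
  unfolding reflect_eq form_linear_right form_linear_left
  by (simp add: form_sym[of u "\<alpha> s"] algebra_simps)

lemma reflect_simple_self: "s \<in> S \<Longrightarrow> \<rho> s (\<alpha> s) = (\<lambda>r. - \<alpha> s r)"
  by (simp add: reflect_def)

lemma reflect_reflect [simp]: "s \<in> S \<Longrightarrow> \<rho> s (\<rho> s v) = v"
  unfolding reflect_eq form_linear_right by (auto simp: algebra_simps)

abbreviation word_act :: "'g list \<Rightarrow> ('g \<Rightarrow> real) \<Rightarrow> ('g \<Rightarrow> real)" where
  "word_act \<equiv> foldr \<rho>"

lemma word_act_linear:
  "word_act ss (\<lambda>r. a * v r + b * w r) = (\<lambda>r. a * word_act ss v r + b * word_act ss w r)"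
  by (induction ss) (simp_all add: reflect_linear)

lemma form_word_act: "ss \<in> lists S \<Longrightarrow> form (word_act ss u) (word_act ss v) = form u v"
  by (induction ss) (auto simp: form_reflect)

definition span2 :: "'g \<Rightarrow> 'g \<Rightarrow> real \<Rightarrow> real \<Rightarrow> 'g \<Rightarrow> real" where
  "span2 s t x y = (\<lambda>r. x * \<alpha> s r + y * \<alpha> t r)"

lemma span2_swap: "span2 s t x y = span2 t s y x"
  by (simp add: span2_def add.commute)

lemma form_span2:
  assumes "s \<in> S" "t \<in> S"
  shows "form (\<alpha> s) (span2 s t x y) = x - cos (pi / m s t) * y"
    and "form (\<alpha> t) (span2 s t x y) = y - cos (pi / m s t) * x"
  using assms by (simp_all add: span2_def form_linear_right form_simple[of s t]
      form_simple[of t s] coxeter_matrix_sym[of t s])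

lemma reflect_span2:
  assumes "s \<in> S" "t \<in> S"
  shows "\<rho> s (span2 s t x y) = span2 s t (2 * cos (pi / m s t) * y - x) y"
    and "\<rho> t (span2 s t x y) = span2 s t x (2 * cos (pi / m s t) * x - y)"
  unfolding reflect_eq form_span2[OF assms] by (auto simp: span2_def algebra_simps)

text \<open>With \<open>h\<close> the angle \<open>\<pi> / m\<close>, this recursion is the effect of a single reflection on the
  coordinates of a vector in the plane of two simple roots, see \<open>reflect_span2\<close>.\<close>

lemma sin_step: "2 * cos h * sin (x + h) - sin x = sin (x + 2 * (h::real))"
proof -
  have "sin (x + 2 * h) = sin ((x + h) + h)" by (simp add: algebra_simps)
  also have "\<dots> = sin (x + h) * cos h + cos (x + h) * sin h" by (rule sin_add)
  finally have 1: "sin (x + 2 * h) = sin (x + h) * cos h + cos (x + h) * sin h" .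
  have "sin x = sin ((x + h) - h)" by simp
  also have "\<dots> = sin (x + h) * cos h - cos (x + h) * sin h" by (rule sin_diff)
  finally show ?thesis using 1 by simp
qed

lemma sin_pi_over_m_pos:
  assumes "s \<in> S" "t \<in> S" "s \<noteq> t"
  shows "sin (pi / m s t) > 0"
proof -
  have "real (m s t) > 1" using coxeter_matrix_ge_2[OF assms] by simp
  then have "pi / m s t < pi" by (simp add: divide_less_eq)
  then show ?thesis using \<open>real (m s t) > 1\<close> by (intro sin_gt_zero) auto
qed

text \<open>The roots met along an alternating word are unit vectors of a dihedral arrangement: with
  \<open>h = \<pi> / m\<close> the \<open>k\<close>-th one is \<open>(sin ((k+1) h) \<alpha>\<^sub>s + sin (k h) \<alpha>\<^sub>t) / sin h\<close>. Its coordinates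
  are nonnegative as long as \<open>k < m\<close>.\<close>

lemma word_act_alternating:
  assumes "s \<in> S" "t \<in> S" "s \<noteq> t"
  shows "word_act (alternating_word s t k) (\<alpha> (if even k then s else t))
    = span2 s t (sin (real (k + 1) * (pi / m s t)) / sin (pi / m s t))
        (sin (k * (pi / m s t)) / sin (pi / m s t))"
  using assms
proof (induction k arbitrary: s t)
  case 0
  then show ?case using sin_pi_over_m_pos[of s t] by (simp add: span2_def)
next
  case (Suc k)
  define h where "h = pi / m s t"
  define d where "d = sin h"
  have m: "m t s = m s t" using Suc.prems by (simp add: coxeter_matrix_sym)
  have "word_act (alternating_word s t (Suc k)) (\<alpha> (if even (Suc k) then s else t))
      = \<rho> s (word_act (alternating_word t s k) (\<alpha> (if even k then t else s)))"
    by auto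
  also have "\<dots> = \<rho> s (span2 s t (sin (k * h) / d) (sin ((k + 1) * h) / d))"
    using Suc.IH[of t s] Suc.prems by (simp add: m h_def d_def span2_swap add.commute)
  also have "\<dots> = span2 s t (2 * cos h * (sin ((k + 1) * h) / d) - sin (k * h) / d)
      (sin ((k + 1) * h) / d)"
    using reflect_span2(1)[OF Suc.prems(1,2)] by (simp add: h_def)
  also have "2 * cos h * (sin ((k + 1) * h) / d) - sin (k * h) / d
      = (2 * cos h * sin (k * h + h) - sin (k * h)) / d"
    by (simp add: diff_divide_distrib algebra_simps)
  also have "\<dots> = sin ((Suc k + 1) * h) / d"
    unfolding sin_step by (simp add: algebra_simps)
  finally show ?case by (simp add: h_def d_def add.commute)
qed

lemma word_act_alternating_nonneg:
  assumes "s \<in> S" "t \<in> S" "s \<noteq> t" "k < m s t"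
  shows "\<exists>x y. x \<ge> 0 \<and> y \<ge> 0 \<and>
    word_act (alternating_word s t k) (\<alpha> (if even k then s else t)) = span2 s t x y"
proof -
  have pos: "sin (n * (pi / m s t)) \<ge> 0" if "n \<le> m s t" for n :: nat
  proof (rule sin_ge_zero)
    have "real n / m s t \<le> 1" using that assms(4) by simp
    then show "n * (pi / m s t) \<le> pi"
      using mult_left_mono[of "real n / m s t" 1 pi] by (simp add: mult.commute)
  qed simp
  have "sin (real (k + 1) * (pi / m s t)) / sin (pi / m s t) \<ge> 0"
    "sin (k * (pi / m s t)) / sin (pi / m s t) \<ge> 0"
    by (rule divide_nonneg_pos[OF pos sin_pi_over_m_pos[OF assms(1-3)]], use assms(4) in simp)+
  with word_act_alternating[OF assms(1-3), of k] show ?thesis by (intro exI conjI)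
qed

text \<open>On the plane of the two simple roots the product of the two reflections is the rotation
  by twice the angle \<open>\<pi> / m\<close>.\<close>

lemma rotation_power:
  assumes "s \<in> S" "t \<in> S"
  shows "word_act (alternating_word s t (2 * n)) (span2 s t (sin (x + pi / m s t)) (sin x))
    = span2 s t (sin (x + 2 * n * (pi / m s t) + pi / m s t)) (sin (x + 2 * n * (pi / m s t)))"
proof (induction n)
  case (Suc n)
  define h where "h = pi / m s t"
  let ?y = "x + 2 * n * h"
  have "word_act (alternating_word s t (2 * Suc n)) (span2 s t (sin (x + h)) (sin x))
     = \<rho> s (\<rho> t (span2 s t (sin (?y + h)) (sin ?y)))"
    using Suc by (simp add: h_def)
  also have "\<dots> = \<rho> s (span2 s t (sin (?y + h)) (sin (?y + 2 * h)))"
    using sin_step[of h ?y] reflect_span2(2)[OF assms] by (simp add: h_def)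
  also have "\<dots> = span2 s t (sin (?y + h + 2 * h)) (sin (?y + 2 * h))"
    using sin_step[of h "?y + h"] reflect_span2(1)[OF assms] by (simp add: h_def add.assoc)
  finally show ?case by (simp add: h_def algebra_simps)
qed simp

text \<open>As \<open>sin (\<pi> / m)\<close> does not vanish, every vector is the sum of a vector in the plane of
  the two simple roots and one that both reflections fix. On the plane the product of the
  reflections is a rotation of order \<open>m\<close>. So the reflections satisfy the Coxeter relations,
  and the group acts.\<close>

lemma word_act_coxeter_relation:
  assumes "s \<in> S" "t \<in> S"
  shows "word_act (alternating_word s t (2 * m s t)) v = v"
proof (cases "s = t")
  case True
  then show ?thesis using assms by (simp add: coxeter_matrix_self numeral_2_eq_2)
next
  case False
  define h where "h = pi / m s t"
  have d: "sin h > 0" using sin_pi_over_m_pos[OF assms False] by (simp add: h_def)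
  let ?w = "alternating_word s t (2 * m s t)"
  have fix_rot: "word_act ?w (span2 s t (sin (x + h)) (sin x)) = span2 s t (sin (x + h)) (sin x)" for x
  proof -
    have "real (m s t) * h = pi"
      using coxeter_matrix_ge_2[OF assms False] by (simp add: h_def)
    then have "x + 2 * real (m s t) * h = x + 2 * pi" by simp
    moreover have "sin (x + 2 * pi + h) = sin (x + h)"
      using sin_periodic[of "x + h"] by (simp add: algebra_simps)
    ultimately show ?thesis
      using rotation_power[OF assms, of "m s t" x] by (simp only: h_def[symmetric] sin_periodic)
  qed
  (* The plane is spanned by its vectors at the angles 0 and - h. *)
  have fix_plane: "word_act ?w (span2 s t x y) = span2 s t x y" for x y
  proof -
    have eq: "span2 s t x y
        = (\<lambda>r. (x / sin h) * span2 s t (sin (0 + h)) (sin 0) r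
             + (- y / sin h) * span2 s t (sin (- h + h)) (sin (- h)) r)"
      using d by (auto simp: span2_def)
    show ?thesis by (subst (1 2) eq) (simp only: word_act_linear fix_rot)
  qed
  define p q where "p = form (\<alpha> s) v" and "q = form (\<alpha> t) v"
  (* The coordinates of the projection of v to the plane: the Gram matrix of the two simple roots
     has rows (1, - cos h) and (- cos h, 1) and determinant (sin h)^2. *)
  define x y where "x = (p + cos h * q) / (sin h)\<^sup>2" and "y = (q + cos h * p) / (sin h)\<^sup>2"
  define u where "u = (\<lambda>r. 1 * v r + (- 1) * span2 s t x y r)"
  have sc: "(sin h)\<^sup>2 = 1 - (cos h)\<^sup>2" by (simp add: sin_squared_eq)
  have xy: "x - cos h * y = p" "y - cos h * x = q"
  proof -
    have "x - cos h * y = (p + cos h * q - cos h * (q + cos h * p)) / (sin h)\<^sup>2"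
      unfolding x_def y_def by (simp add: diff_divide_distrib)
    also have "\<dots> = (p * (sin h)\<^sup>2) / (sin h)\<^sup>2" unfolding sc by (simp add: algebra_simps power2_eq_square)
    finally show "x - cos h * y = p" using d by simp
    have "y - cos h * x = (q + cos h * p - cos h * (p + cos h * q)) / (sin h)\<^sup>2"
      unfolding x_def y_def by (simp add: diff_divide_distrib)
    also have "\<dots> = (q * (sin h)\<^sup>2) / (sin h)\<^sup>2" unfolding sc by (simp add: algebra_simps power2_eq_square)
    finally show "y - cos h * x = q" using d by simp
  qed
  have "form (\<alpha> s) u = 0" "form (\<alpha> t) u = 0"
    unfolding u_def form_linear_right form_span2[OF assms] h_def[symmetric] xy
    by (simp_all add: p_def q_def)
  then have "\<rho> s u = u" "\<rho> t u = u" by (simp_all add: reflect_def)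
  then have fix_u: "word_act (alternating_word s t (2 * n)) u = u" for n
    by (induction n) simp_all
  have v: "v = (\<lambda>r. 1 * u r + 1 * span2 s t x y r)" by (simp add: u_def)
  show ?thesis by (subst (1 2) v) (simp only: word_act_linear fix_u fix_plane)
qed

lemma word_act_word_cong:
  "word_cong S (coxeter_relations G S) ss ts \<Longrightarrow> word_act ss v = word_act ts v"
  by (induction arbitrary: v rule: word_cong.induct)
    (auto simp: coxeter_relations_def concat_replicate_pair word_act_coxeter_relation)

abbreviation act :: "'g \<Rightarrow> ('g \<Rightarrow> real) \<Rightarrow> ('g \<Rightarrow> real)" where
  "act \<equiv> coxeter_act G S"

lemma act_word_prod:
  assumes "ss \<in> lists S"
  shows "act (word_prod G ss) = word_act ss"
proof -
  let ?ts = "SOME ts. ts \<in> lists S \<and> word_prod G ts = word_prod G ss"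
  have "?ts \<in> lists S \<and> word_prod G ?ts = word_prod G ss"
    using someI[of "\<lambda>ts. ts \<in> lists S \<and> word_prod G ts = word_prod G ss" ss] assms by blast
  then have "word_cong S (coxeter_relations G S) ?ts ss" using presentation assms by blast
  then show ?thesis unfolding coxeter_act_def using word_act_word_cong by blast
qed

lemma act_mult:
  assumes "x \<in> carrier G" "y \<in> carrier G"
  shows "act (x \<otimes> y) v = act x (act y v)"
proof -
  obtain ss ts where "ss \<in> lists S" "word_prod G ss = x" "ts \<in> lists S" "word_prod G ts = y"
    using ex_word assms by meson
  moreover from this have "x \<otimes> y = word_prod G (ss @ ts)" by (simp add: word_prod_append)
  ultimately show ?thesis using act_word_prod[of "ss @ ts"] act_word_prod by force
qed

lemma act_one [simp]: "act \<one> v = v"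
  using act_word_prod[of "[]"] by simp

lemma act_simple: "s \<in> S \<Longrightarrow> act s = \<rho> s"
  using act_word_prod[of "[s]"] by auto

lemma act_inv [simp]:
  assumes "x \<in> carrier G"
  shows "act x (act (inv x) v) = v" and "act (inv x) (act x v) = v"
  using act_mult[of x "inv x" v] act_mult[of "inv x" x v] assms by simp_all

lemma act_linear:
  "x \<in> carrier G \<Longrightarrow> act x (\<lambda>r. a * v r + b * w r) = (\<lambda>r. a * act x v r + b * act x w r)"
  using ex_word[of x] act_word_prod word_act_linear by metis

lemma act_uminus: "x \<in> carrier G \<Longrightarrow> act x (\<lambda>r. - v r) = (\<lambda>r. - act x v r)"
  using act_linear[of x "-1" v 0 v] by simp

lemma form_act: "x \<in> carrier G \<Longrightarrow> form (act x u) (act x v) = form u v"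
  using ex_word[of x] act_word_prod form_word_act by metis

section \<open>Length and positivity\<close>

definition nonneg :: "('g \<Rightarrow> real) \<Rightarrow> bool" where
  "nonneg v \<longleftrightarrow> (\<forall>r\<in>S. 0 \<le> v r)"

lemma nonneg_simple: "nonneg (\<alpha> s)"
  by (simp add: nonneg_def simple_root_def)

lemma nonneg_act_span2:
  "\<lbrakk>x \<in> carrier G; nonneg (act x (\<alpha> s)); nonneg (act x (\<alpha> t)); a \<ge> 0; b \<ge> 0\<rbrakk>
    \<Longrightarrow> nonneg (act x (span2 s t a b))"
  unfolding span2_def by (simp add: act_linear nonneg_def)

text \<open>The longest alternating tail in \<open>s\<close> and \<open>t\<close> that can be stripped from the right of
  \<open>w\<close> with the length dropping at each letter leaves an element \<open>v\<close> which neither \<open>s\<close> nor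
  \<open>t\<close> shortens.\<close>

lemma strip_alternating:
  assumes w: "w \<in> carrier G" and s: "s \<in> S" and t: "t \<in> S"
    and desc: "len w = len (w \<otimes> t) + 1"
  obtains k v where "k \<ge> 1" "v = w \<otimes> word_prod G (alternating_word t s k)" "len w = len v + k"
    "len (v \<otimes> s) = len v + 1" "len (v \<otimes> t) = len v + 1"
proof -
  let ?q = "\<lambda>k. w \<otimes> word_prod G (alternating_word t s k)"
  note alt [simp] = alternating_word_in_lists[OF t s]
  have closed [simp]: "?q k \<in> carrier G" for k using w by simp
  define P where "P k \<longleftrightarrow> len w = len (?q k) + k" for k
  have P1: "P 1" using desc w t by (simp add: P_def)
  have bound: "\<And>k. P k \<Longrightarrow> k \<le> len w" by (simp add: P_def)
  define k where "k = Greatest P"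
  have Pk: "P k" unfolding k_def by (rule GreatestI_nat[of P 1 "len w", OF P1 bound])
  have max: "\<And>j. P j \<Longrightarrow> j \<le> k" unfolding k_def by (rule Greatest_le_nat[of P _ "len w", OF _ bound])
  have len_w: "len w = len (?q k) + k" using Pk by (simp only: P_def)
  have k1: "k \<ge> 1" using max[OF P1] .
  have q_Suc: "?q (Suc j) = ?q j \<otimes> (if even j then t else s)" for j
    using w s t by (auto simp: alternating_word_snoc word_prod_append m_assoc
        simp del: alternating_word.simps)
  have up: "len (?q k \<otimes> (if even k then t else s)) = len (?q k) + 1"
  proof -
    have "len w \<noteq> len (?q (Suc k)) + Suc k" using max[of "Suc k"] unfolding P_def by linarith
    moreover have "(if even k then t else s) \<in> S" using s t by simp
    ultimately show ?thesis
      using len_mult_simple[OF closed, of "if even k then t else s" k] len_w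
      unfolding q_Suc by linarith
  qed
  obtain j where j: "k = Suc j" using k1 by (cases k) auto
  have "len w \<le> len (?q j) + j"
  proof -
    have "w = ?q j \<otimes> inv (word_prod G (alternating_word t s j))"
      using w by (simp add: m_assoc)
    then have "len w \<le> len (?q j) + len (word_prod G (alternating_word t s j))"
      using len_mult_le[of "?q j" "inv (word_prod G (alternating_word t s j))"] w by simp
    then show ?thesis using len_le_length[OF alt[of j]] by simp
  qed
  moreover have "len (?q k \<otimes> (if even k then s else t)) = len (?q j)"
    unfolding j q_Suc using s t by auto
  moreover have "(if even k then s else t) \<in> S" using s t by simp
  ultimately have "len (?q k \<otimes> (if even k then s else t)) = len (?q k) + 1"
    using len_w j len_mult_simple[OF closed[of k], of "if even k then s else t"] by linarith
  with up have "len (?q k \<otimes> s) = len (?q k) + 1" "len (?q k \<otimes> t) = len (?q k) + 1"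
    by (auto split: if_splits)
  then show thesis using k1 len_w by (intro that[of k "?q k"]) auto
qed

text \<open>Induction on the length. Choose a letter \<open>t\<close> that shortens \<open>w\<close> and write \<open>w = v p\<close>,
  where \<open>p\<close> is alternating in \<open>s\<close> and \<open>t\<close>, ends in \<open>t\<close> and is as long as possible with lengths
  adding up. Neither letter shortens \<open>v\<close>, so by induction \<open>v\<close> sends both simple roots to
  nonnegative vectors. If \<open>p\<close> had \<open>m\<close> letters or more, its last \<open>m\<close> letters could be exchanged
  for the alternating word ending in \<open>s\<close>, and \<open>s\<close> would shorten \<open>w\<close>. So \<open>p\<close> has fewer than \<open>m\<close>
  letters and sends the simple root of \<open>s\<close> to a nonnegative combination of the two simple
  roots.\<close>

theorem length_increase_nonneg:
  assumes "w \<in> carrier G" "s \<in> S" "len (w \<otimes> s) = len w + 1"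
  shows "nonneg (act w (\<alpha> s))"
  using assms
proof (induction "len w" arbitrary: w s rule: less_induct)
  case less
  note w = less.prems(1) and s = less.prems(2)
  show ?case
  proof (cases "w = \<one>")
    case True
    then show ?thesis by (simp add: nonneg_simple)
  next
    case False
    then obtain t where t: "t \<in> S" "len w = len (w \<otimes> t) + 1" using ex_right_descent w by blast
    then have st: "s \<noteq> t" using less.prems(3) by auto
    obtain k v where k: "k \<ge> 1" and v: "v = w \<otimes> word_prod G (alternating_word t s k)"
      and lv: "len w = len v + k" "len (v \<otimes> s) = len v + 1" "len (v \<otimes> t) = len v + 1"
      using strip_alternating[OF w s t] by blast
    note alt [simp] = alternating_word_in_lists[OF t(1) s] alternating_word_in_lists[OF s t(1)]
    have vc [simp]: "v \<in> carrier G" using v w by simp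
    have pos: "nonneg (act v (\<alpha> s))" "nonneg (act v (\<alpha> t))"
      using less.hyps[of v] lv k s t(1) by auto
    have wv: "w = v \<otimes> word_prod G (rev (alternating_word t s k))"
      using v w by (simp add: word_prod_rev m_assoc)
    have "k < m s t"
    proof (rule ccontr)
      assume "\<not> k < m s t"
      then obtain l where l: "k = m s t + l" using le_iff_add by (auto simp: not_less)
      define q where "q = (if even (m s t) then alternating_word t s l else alternating_word s t l)"
      have q [simp]: "q \<in> lists S" "length q = l" by (auto simp: q_def)
      have mpos: "m s t \<ge> 1" using coxeter_matrix_ge_2[OF s t(1) st] by simp
      have "word_prod G (alternating_word t s k) = longest t s \<otimes> word_prod G q"
        unfolding l alternating_word_add q_def[symmetric]
        using coxeter_matrix_sym[OF s t(1)] by (simp add: word_prod_append longest_def)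
      also have "longest t s = s \<otimes> word_prod G (alternating_word t s (m s t - 1))"
        using longest_sym[OF t(1) s] mpos unfolding longest_def
        by (cases "m s t") auto
      finally have "v = (w \<otimes> s) \<otimes> word_prod G (alternating_word t s (m s t - 1) @ q)"
        using v w s by (simp add: word_prod_append m_assoc)
      then have "w \<otimes> s = v \<otimes> word_prod G (rev (alternating_word t s (m s t - 1) @ q))"
        using w s
        by (subst word_prod_rev) (simp_all add: m_assoc)
      then have "len (w \<otimes> s) \<le> len v + (m s t - 1 + l)"
        using len_mult_le[of v "word_prod G (rev (alternating_word t s (m s t - 1) @ q))"]
          len_le_length[of "rev (alternating_word t s (m s t - 1) @ q)"] by simp
      then show False using lv l mpos less.prems(3) by simp
    qed
    moreover have "\<exists>x y. x \<ge> 0 \<and> y \<ge> 0 \<and>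
        word_act (rev (alternating_word t s k)) (\<alpha> s) = span2 s t x y"
    proof (cases "even k")
      case True
      then show ?thesis
        using word_act_alternating_nonneg[OF s t(1) st \<open>k < m s t\<close>]
        by (simp add: rev_alternating_word)
    next
      case odd: False
      have "k < m t s" using \<open>k < m s t\<close> coxeter_matrix_sym[OF s t(1)] by simp
      then show ?thesis
        using word_act_alternating_nonneg[OF t(1) s st[symmetric], of k] odd
        by (auto simp: rev_alternating_word span2_swap[of t s])
    qed
    then obtain x y where xy: "x \<ge> 0" "y \<ge> 0"
      "act (word_prod G (rev (alternating_word t s k))) (\<alpha> s) = span2 s t x y"
      using act_word_prod[of "rev (alternating_word t s k)"] by auto
    then have "act w (\<alpha> s) = act v (span2 s t x y)"
      by (subst wv) (simp add: act_mult)
    then show ?thesis using nonneg_act_span2[OF vc pos xy(1,2)] by simp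
  qed
qed

section \<open>Roots\<close>

abbreviation R :: "('g \<Rightarrow> real) set" where "R \<equiv> roots G S"
abbreviation Rpos :: "('g \<Rightarrow> real) set" where "Rpos \<equiv> pos_roots G S"
abbreviation Rneg :: "('g \<Rightarrow> real) set" where "Rneg \<equiv> neg_roots G S"

lemma roots_cases:
  assumes "\<beta> \<in> R"
  obtains x s where "x \<in> carrier G" "s \<in> S" "\<beta> = act x (\<alpha> s)"
  using assms by (auto simp: roots_def)

lemma act_simple_in_roots [intro]: "\<lbrakk>x \<in> carrier G; s \<in> S\<rbrakk> \<Longrightarrow> act x (\<alpha> s) \<in> R"
  by (auto simp: roots_def)

lemma simple_in_roots [simp]: "s \<in> S \<Longrightarrow> \<alpha> s \<in> R"
  using act_simple_in_roots[of \<one> s] by simp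

lemma act_in_roots [simp]: "\<lbrakk>x \<in> carrier G; \<beta> \<in> R\<rbrakk> \<Longrightarrow> act x \<beta> \<in> R"
  by (elim roots_cases) (auto simp: act_mult[symmetric])

lemma finite_roots [simp]: "finite R"
proof -
  have "R = (\<lambda>(x, s). act x (\<alpha> s)) ` (carrier G \<times> S)" by (auto simp: roots_def)
  then show ?thesis using finite_carrier by simp
qed

lemma finite_pos_roots [simp]: "finite Rpos"
  by (rule finite_subset[OF _ finite_roots]) (auto simp: pos_roots_def)

lemma act_mult_simple_uminus:
  "\<lbrakk>x \<in> carrier G; s \<in> S\<rbrakk> \<Longrightarrow> act (x \<otimes> s) (\<alpha> s) = (\<lambda>r. - act x (\<alpha> s) r)"
  by (simp add: act_mult act_simple reflect_simple_self act_uminus)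

lemma uminus_in_roots: "\<beta> \<in> R \<Longrightarrow> (\<lambda>r. - \<beta> r) \<in> R"
proof (elim roots_cases)
  fix x s
  assume "x \<in> carrier G" "s \<in> S" "\<beta> = act x (\<alpha> s)"
  then show "(\<lambda>r. - \<beta> r) \<in> R"
    using act_simple_in_roots[of "x \<otimes> s" s] by (simp add: act_mult_simple_uminus)
qed

lemma form_root: "\<beta> \<in> R \<Longrightarrow> form \<beta> \<beta> = 1"
  by (elim roots_cases) (simp add: form_act)

lemma root_nonzero:
  assumes "\<beta> \<in> R"
  shows "\<exists>r\<in>S. \<beta> r \<noteq> 0"
proof (rule ccontr)
  assume "\<not> (\<exists>r\<in>S. \<beta> r \<noteq> 0)"
  then have "form \<beta> \<beta> = 0" by (simp add: coxeter_form_def)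
  then show False using form_root[OF assms] by simp
qed

lemma root_vanishes:
  assumes "\<beta> \<in> R" "r \<notin> S"
  shows "\<beta> r = 0"
proof -
  obtain x t where x: "x \<in> carrier G" "t \<in> S" "\<beta> = act x (\<alpha> t)" using assms(1) by (rule roots_cases)
  obtain ss where ss: "ss \<in> lists S" "word_prod G ss = x" using ex_word x(1) by blast
  have "word_act ss (\<alpha> t) r = 0"
    using ss(1) x(2) assms(2) by (induction ss) (auto simp: simple_root_def reflect_def)
  then show ?thesis using x ss act_word_prod by force
qed

lemma pos_root_iff: "\<beta> \<in> R \<Longrightarrow> \<beta> \<in> Rpos \<longleftrightarrow> nonneg \<beta>"
  by (simp add: pos_roots_def nonneg_def)

lemma neg_root_iff: "\<beta> \<in> R \<Longrightarrow> \<beta> \<in> Rneg \<longleftrightarrow> nonneg (\<lambda>r. - \<beta> r)"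
  by (simp add: neg_roots_def nonneg_def)

lemma pos_neg_disjoint: "\<beta> \<in> Rpos \<Longrightarrow> \<beta> \<in> Rneg \<Longrightarrow> False"
  using root_nonzero[of \<beta>] by (force simp: pos_roots_def neg_roots_def)

lemma pos_roots_subset: "\<beta> \<in> Rpos \<Longrightarrow> \<beta> \<in> R" and neg_roots_subset: "\<beta> \<in> Rneg \<Longrightarrow> \<beta> \<in> R"
  by (simp_all add: pos_roots_def neg_roots_def)

lemma uminus_pos_iff: "(\<lambda>r. - \<beta> r) \<in> Rpos \<longleftrightarrow> \<beta> \<in> Rneg"
  and uminus_neg_iff: "(\<lambda>r. - \<beta> r) \<in> Rneg \<longleftrightarrow> \<beta> \<in> Rpos"
  using uminus_in_roots[of \<beta>] uminus_in_roots[of "\<lambda>r. - \<beta> r"]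
  by (auto simp: pos_roots_def neg_roots_def)

lemma length_up_root:
  assumes "x \<in> carrier G" "s \<in> S" "len (x \<otimes> s) = len x + 1"
  shows "act x (\<alpha> s) \<in> Rpos"
  using assms length_increase_nonneg pos_root_iff by blast

lemma length_down_root:
  assumes "x \<in> carrier G" "s \<in> S" "len x = len (x \<otimes> s) + 1"
  shows "act x (\<alpha> s) \<in> Rneg"
proof -
  have "act (x \<otimes> s) (\<alpha> s) \<in> Rpos" using length_up_root[of "x \<otimes> s" s] assms by simp
  then show ?thesis using assms by (simp add: act_mult_simple_uminus uminus_pos_iff)
qed

lemma pos_root_length_up:
  "\<lbrakk>x \<in> carrier G; s \<in> S; act x (\<alpha> s) \<in> Rpos\<rbrakk> \<Longrightarrow> len (x \<otimes> s) = len x + 1"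
  using len_mult_simple[of x s] length_down_root[of x s] pos_neg_disjoint by blast

lemma neg_root_length_down:
  "\<lbrakk>x \<in> carrier G; s \<in> S; act x (\<alpha> s) \<in> Rneg\<rbrakk> \<Longrightarrow> len x = len (x \<otimes> s) + 1"
  using len_mult_simple[of x s] length_up_root[of x s] pos_neg_disjoint by blast

lemma roots_pos_or_neg: "\<beta> \<in> R \<Longrightarrow> \<beta> \<in> Rpos \<or> \<beta> \<in> Rneg"
  by (elim roots_cases) (use len_mult_simple length_up_root length_down_root in blast)

lemma simple_pos [simp]: "s \<in> S \<Longrightarrow> \<alpha> s \<in> Rpos"
  by (simp add: pos_root_iff nonneg_simple)

section \<open>Dihedral factors\<close>

text \<open>Each further letter of the alternating word meets the image under \<open>x\<close> of a nonnegative
  combination of the two simple roots. If \<open>x\<close> makes both simple roots positive, or both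
  negative, then this image has the same sign for all \<open>m\<close> letters, so the length moves in one
  direction.\<close>

lemma
  assumes x: "x \<in> carrier G" and st: "s \<in> S" "t \<in> S" "s \<noteq> t" and "k \<le> m s t"
  shows len_mult_alternating_up: "\<lbrakk>len (x \<otimes> s) = len x + 1; len (x \<otimes> t) = len x + 1\<rbrakk>
      \<Longrightarrow> len (x \<otimes> word_prod G (alternating_word s t k)) = len x + k" (is "?u1 \<Longrightarrow> ?u2 \<Longrightarrow> ?up k")
    and len_mult_alternating_down: "\<lbrakk>len x = len (x \<otimes> s) + 1; len x = len (x \<otimes> t) + 1\<rbrakk>
      \<Longrightarrow> len x = len (x \<otimes> word_prod G (alternating_word s t k)) + k"
      (is "?d1 \<Longrightarrow> ?d2 \<Longrightarrow> ?down k")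
proof -
  note alt [simp] = alternating_word_in_lists[OF st(1,2)]
  let ?p = "\<lambda>k. word_prod G (alternating_word s t k)"
  let ?r = "\<lambda>k. if even k then s else t"
  have step: "x \<otimes> ?p (Suc k) = x \<otimes> ?p k \<otimes> ?r k" for k
    using x st by (auto simp: alternating_word_snoc word_prod_append m_assoc
        simp del: alternating_word.simps)
  have root: "\<exists>a b. a \<ge> 0 \<and> b \<ge> 0 \<and> act (x \<otimes> ?p k) (\<alpha> (?r k))
      = (\<lambda>r. a * act x (\<alpha> s) r + b * act x (\<alpha> t) r)" if "Suc k \<le> m s t" for k
  proof -
    obtain a b where ab: "a \<ge> 0" "b \<ge> 0" "word_act (alternating_word s t k) (\<alpha> (?r k)) = span2 s t a b"
      using word_act_alternating_nonneg[OF st, of k] \<open>Suc k \<le> m s t\<close> by auto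
    then have "act (x \<otimes> ?p k) (\<alpha> (?r k)) = (\<lambda>r. a * act x (\<alpha> s) r + b * act x (\<alpha> t) r)"
      using x by (simp only: act_mult act_word_prod span2_def act_linear alt word_prod_closed)
    with ab show ?thesis by blast
  qed
  have rS: "?r k \<in> S" and closed: "x \<otimes> ?p k \<in> carrier G" for k using st x by auto
  show "?up k" if u: "?u1" "?u2"
    using \<open>k \<le> m s t\<close>
  proof (induction k)
    case (Suc k)
    obtain a b where ab: "a \<ge> 0" "b \<ge> 0"
      "act (x \<otimes> ?p k) (\<alpha> (?r k)) = (\<lambda>r. a * act x (\<alpha> s) r + b * act x (\<alpha> t) r)"
      using root[OF Suc.prems] by blast
    have "nonneg (act x (\<alpha> s))" "nonneg (act x (\<alpha> t))"
      using length_increase_nonneg x st u by auto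
    with ab have "nonneg (act (x \<otimes> ?p k) (\<alpha> (?r k)))" by (simp add: nonneg_def)
    then have "act (x \<otimes> ?p k) (\<alpha> (?r k)) \<in> Rpos"
      using act_simple_in_roots[OF closed rS, of k k] by (simp only: pos_root_iff)
    from pos_root_length_up[OF closed rS this] show ?case
      using Suc unfolding step by simp
  qed (use x in simp)
  show "?down k" if d: "?d1" "?d2"
    using \<open>k \<le> m s t\<close>
  proof (induction k)
    case (Suc k)
    obtain a b where ab: "a \<ge> 0" "b \<ge> 0"
      "act (x \<otimes> ?p k) (\<alpha> (?r k)) = (\<lambda>r. a * act x (\<alpha> s) r + b * act x (\<alpha> t) r)"
      using root[OF Suc.prems] by blast
    have "act x (\<alpha> s) \<in> Rneg" "act x (\<alpha> t) \<in> Rneg"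
      using length_down_root x st d by auto
    with ab have "nonneg (\<lambda>r. - act (x \<otimes> ?p k) (\<alpha> (?r k)) r)"
      by (simp add: nonneg_def neg_roots_def) (smt (verit) mult_nonneg_nonpos)
    then have "act (x \<otimes> ?p k) (\<alpha> (?r k)) \<in> Rneg"
      using act_simple_in_roots[OF closed rS, of k k] by (simp only: neg_root_iff)
    from neg_root_length_down[OF closed rS this] show ?case
      using Suc unfolding step by simp
  qed (use x in simp)
qed

lemma len_mult_longest_up:
  assumes "x \<in> carrier G" "s \<in> S" "t \<in> S" "s \<noteq> t"
    and "len (x \<otimes> s) = len x + 1" "len (x \<otimes> t) = len x + 1"
  shows "len (x \<otimes> longest s t) = len x + m s t"
  using len_mult_alternating_up[of x s t "m s t"] assms by (simp add: longest_def)

lemma len_mult_longest_down: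
  assumes "x \<in> carrier G" "s \<in> S" "t \<in> S" "s \<noteq> t"
    and "len x = len (x \<otimes> s) + 1" "len x = len (x \<otimes> t) + 1"
  shows "len x = len (x \<otimes> longest s t) + m s t"
  using len_mult_alternating_down[of x s t "m s t"] assms by (simp add: longest_def)

lemma len_longest: "\<lbrakk>s \<in> S; t \<in> S; s \<noteq> t\<rbrakk> \<Longrightarrow> len (longest s t) = m s t"
  using len_mult_longest_up[of \<one> s t] by simp

lemma len_longest_mult_up:
  assumes "x \<in> carrier G" "s \<in> S" "t \<in> S" "s \<noteq> t"
    and "len (s \<otimes> x) = len x + 1" "len (t \<otimes> x) = len x + 1"
  shows "len (longest s t \<otimes> x) = len x + m s t"
  using len_mult_longest_up[of "inv x" s t] assms len_inv[of "s \<otimes> x"] len_inv[of "t \<otimes> x"]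
    len_inv[of "longest s t \<otimes> x"]
  by (simp add: inv_mult_group inv_longest)

section \<open>Inversion sets\<close>

text \<open>Twists permute the negative roots, so this is also the inversion set of every twisted
  element \<open>(\<delta>, x)\<close>, see \<open>inversions_eq\<close>.\<close>

definition Inv :: "'g \<Rightarrow> ('g \<Rightarrow> real) set" where
  "Inv x = {\<beta> \<in> Rpos. act x \<beta> \<in> Rneg}"

lemma finite_Inv [simp]: "finite (Inv x)"
  by (rule finite_subset[OF _ finite_pos_roots]) (auto simp: Inv_def)

lemma Inv_one [simp]: "Inv \<one> = {}"
  using pos_neg_disjoint by (auto simp: Inv_def)

text \<open>A reflection changes a single coordinate. A positive root other than \<open>\<alpha>\<^sub>s\<close> has a
  positive coordinate away from \<open>s\<close>, since all roots have norm \<open>1\<close>, and that coordinate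
  survives.\<close>

lemma reflect_pos_root:
  assumes s: "s \<in> S" and \<beta>: "\<beta> \<in> Rpos" and ne: "\<beta> \<noteq> \<alpha> s"
  shows "\<rho> s \<beta> \<in> Rpos"
proof -
  have \<beta>R: "\<beta> \<in> R" using \<beta> by (rule pos_roots_subset)
  have "\<exists>r\<in>S. r \<noteq> s \<and> \<beta> r \<noteq> 0"
  proof (rule ccontr)
    assume "\<not> (\<exists>r\<in>S. r \<noteq> s \<and> \<beta> r \<noteq> 0)"
    then have zero: "\<And>r. r \<in> S \<Longrightarrow> r \<noteq> s \<Longrightarrow> \<beta> r = 0" by blast
    have eq: "\<beta> = (\<lambda>r. \<beta> s * \<alpha> s r + 0 * \<alpha> s r)"
      using zero root_vanishes[OF \<beta>R] by (fastforce simp: simple_root_def)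
    have "form \<beta> \<beta> = \<beta> s * \<beta> s"
      by (subst (1 2) eq) (simp only: form_linear_left form_linear_right form_self[OF s], simp)
    then have "\<beta> s * \<beta> s = 1" using form_root[OF \<beta>R] by simp
    moreover have "\<beta> s \<ge> 0" using \<beta> s by (simp add: pos_roots_def)
    ultimately have "\<beta> s = 1" by (simp add: square_eq_1_iff)
    then show False using eq ne by simp
  qed
  then obtain r where r: "r \<in> S" "r \<noteq> s" "\<beta> r > 0"
    using \<beta> by (force simp: pos_roots_def)
  then have "\<rho> s \<beta> r > 0" by (simp add: reflect_def simple_root_def)
  moreover have "\<rho> s \<beta> \<in> R" using act_in_roots[of s \<beta>] s \<beta>R by (simp add: act_simple)
  ultimately show ?thesis
    using roots_pos_or_neg r(1) by (force simp: neg_roots_def)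
qed

lemma Inv_mult_simple:
  assumes x: "x \<in> carrier G" and s: "s \<in> S" and up: "len (x \<otimes> s) = len x + 1"
  shows "Inv (x \<otimes> s) = insert (\<alpha> s) (\<rho> s ` Inv x)" and "\<alpha> s \<notin> \<rho> s ` Inv x"
proof -
  have xs: "act (x \<otimes> s) \<beta> = act x (\<rho> s \<beta>)" for \<beta>
    using x s by (simp add: act_mult act_simple)
  have simple: "\<alpha> s \<notin> Inv x" "\<alpha> s \<in> Inv (x \<otimes> s)"
    using length_up_root[OF assms] length_down_root[of "x \<otimes> s" s] pos_neg_disjoint x s up
    by (auto simp: Inv_def)
  show "\<alpha> s \<notin> \<rho> s ` Inv x"
  proof
    assume "\<alpha> s \<in> \<rho> s ` Inv x"
    then obtain \<gamma> where \<gamma>: "\<gamma> \<in> Inv x" "\<alpha> s = \<rho> s \<gamma>" by blast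
    then have "\<gamma> = (\<lambda>r. - \<alpha> s r)" using reflect_reflect[OF s, of \<gamma>] reflect_simple_self[OF s] by simp
    then have "\<gamma> \<in> Rneg" using s by (simp add: uminus_neg_iff)
    then show False using \<gamma> pos_neg_disjoint by (auto simp: Inv_def)
  qed
  show "Inv (x \<otimes> s) = insert (\<alpha> s) (\<rho> s ` Inv x)"
  proof (intro Set.set_eqI iffI)
    fix \<beta>
    assume \<beta>: "\<beta> \<in> Inv (x \<otimes> s)"
    show "\<beta> \<in> insert (\<alpha> s) (\<rho> s ` Inv x)"
    proof (cases "\<beta> = \<alpha> s")
      case False
      then have "\<rho> s \<beta> \<in> Inv x" using \<beta> reflect_pos_root[OF s] by (auto simp: Inv_def xs)
      then show ?thesis using reflect_reflect[OF s, of \<beta>] by (metis image_eqI insertCI)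
    qed simp
  next
    fix \<beta>
    assume "\<beta> \<in> insert (\<alpha> s) (\<rho> s ` Inv x)"
    then consider "\<beta> = \<alpha> s" | \<gamma> where "\<gamma> \<in> Inv x" "\<beta> = \<rho> s \<gamma>" by blast
    then show "\<beta> \<in> Inv (x \<otimes> s)"
    proof cases
      case 2
      then have "\<gamma> \<noteq> \<alpha> s" using simple by blast
      then show ?thesis using 2 reflect_pos_root[OF s, of \<gamma>] s by (simp add: Inv_def xs)
    qed (use simple in simp)
  qed
qed

lemma word_inversions_Nil [simp]: "word_inversions G S [] = {}"
  by (simp add: word_inversions_def)

lemma word_inversions_snoc:
  "word_inversions G S (ss @ [s]) = insert (\<alpha> s) (\<rho> s ` word_inversions G S ss)"
proof -
  let ?f = "\<lambda>ts k. word_act (take k (rev ts)) (\<alpha> (rev ts ! k))"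
  have wi: "word_inversions G S ts = ?f ts ` {..<length ts}" for ts
    by (auto simp: word_inversions_def)
  have "word_inversions G S (ss @ [s]) = ?f (ss @ [s]) ` insert 0 (Suc ` {..<length ss})"
    unfolding wi by (simp add: lessThan_Suc_eq_insert_0)
  then show ?thesis by (simp add: wi image_image)
qed

lemma word_inversions_append:
  "word_inversions G S (xs @ ys) = word_inversions G S ys \<union> word_act (rev ys) ` word_inversions G S xs"
proof (induction ys rule: rev_induct)
  case (snoc s ys)
  then show ?case
    using word_inversions_snoc[of "xs @ ys" s] by (auto simp: word_inversions_snoc image_Un image_image)
qed simp

definition reduced :: "'g list \<Rightarrow> bool" where
  "reduced ss \<longleftrightarrow> ss \<in> lists S \<and> length ss = len (word_prod G ss)"

lemma ex_reduced: "x \<in> carrier G \<Longrightarrow> \<exists>ss. reduced ss \<and> word_prod G ss = x"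
  using ex_word_len[of x] by (auto simp: reduced_def)

lemma reduced_snoc:
  assumes "reduced (ss @ [s])"
  shows "reduced ss" "s \<in> S" "len (word_prod G ss \<otimes> s) = len (word_prod G ss) + 1"
proof -
  have ss: "ss \<in> lists S" "s \<in> S" and l: "length ss + 1 = len (word_prod G ss \<otimes> s)"
    using assms by (auto simp: reduced_def word_prod_append)
  have "len (word_prod G ss) \<le> length ss" using ss by (simp add: len_le_length)
  moreover have "len (word_prod G ss \<otimes> s) \<le> len (word_prod G ss) + 1"
    using len_mult_le[of "word_prod G ss" s] ss by simp
  ultimately show "reduced ss" "s \<in> S" "len (word_prod G ss \<otimes> s) = len (word_prod G ss) + 1"
    using ss l by (auto simp: reduced_def)
qed

lemma word_inversions_reduced:
  "reduced ss \<Longrightarrow> word_inversions G S ss = Inv (word_prod G ss) \<and> card (Inv (word_prod G ss)) = length ss"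
proof (induction ss rule: rev_induct)
  case (snoc s ss)
  note red = reduced_snoc[OF snoc.prems]
  have ss: "ss \<in> lists S" using red(1) by (simp add: reduced_def)
  have eq: "word_prod G (ss @ [s]) = word_prod G ss \<otimes> s" using ss red(2) by (simp add: word_prod_append)
  note I = Inv_mult_simple[OF word_prod_closed[OF ss] red(2,3)]
  have "inj_on (\<rho> s) (Inv (word_prod G ss))"
    using reflect_reflect[OF red(2)] by (metis inj_onI)
  then show ?case
    using snoc.IH[OF red(1)] I by (simp add: eq word_inversions_snoc card_image)
qed simp

lemma card_Inv: "x \<in> carrier G \<Longrightarrow> card (Inv x) = len x"
  using ex_reduced[of x] word_inversions_reduced by (auto simp: reduced_def)

section \<open>Reduced words\<close>

abbreviation braid_eq :: "'g list \<Rightarrow> 'g list \<Rightarrow> bool" (infix \<open>\<approx>\<close> 50) where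
  "xs \<approx> ys \<equiv> word_cong S (braid_relations G S) xs ys"

lemma alternating_braid_eq:
  assumes "s \<in> S" "t \<in> S" "s \<noteq> t"
  shows "alternating_word s t (m s t) \<approx> alternating_word t s (m s t)"
  using assms by (intro word_cong_relation) (auto simp: braid_relations_def alternating_word_in_lists)

lemma reduced_alternating:
  assumes "s \<in> S" "t \<in> S" "s \<noteq> t"
  shows "reduced (alternating_word s t (m s t))"
  using assms len_longest[OF assms] by (simp add: reduced_def longest_def alternating_word_in_lists)

text \<open>If the last letters \<open>s\<close> and \<open>t\<close> of the two words differ, both shorten the element, which
  is therefore \<open>z\<close> times the longest element of the dihedral subgroup, with lengths adding up.
  By induction each word is equivalent to a reduced word of \<open>z\<close> followed by the alternating
  word with the same last letter, and a single braid relation joins those two.\<close>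

theorem matsumoto:
  assumes "reduced ss" "reduced ts" "word_prod G ss = word_prod G ts"
  shows "ss \<approx> ts"
  using assms
proof (induction "length ss" arbitrary: ss ts rule: less_induct)
  case less
  have len_eq: "length ss = length ts" using less.prems by (simp add: reduced_def)
  have same_last: "us @ [r] \<approx> vs @ [r]"
    if "length (us @ [r]) = length ss" "reduced (us @ [r])" "reduced (vs @ [r])"
      "word_prod G (us @ [r]) = word_prod G (vs @ [r])" for us vs r
  proof -
    note u = reduced_snoc[OF that(2)] and v = reduced_snoc[OF that(3)]
    have "us \<in> lists S" "vs \<in> lists S" using u(1) v(1) by (simp_all add: reduced_def)
    moreover from this have "word_prod G us = word_prod G vs"
      using that(4) u(2) by (simp add: word_prod_append right_cancel)
    ultimately have "us \<approx> vs" using less.hyps[of us vs] that(1) u(1) v(1) by simp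
    then show ?thesis by (rule word_cong_append) (use u(2) in \<open>simp add: word_cong.refl\<close>)
  qed
  show ?case
  proof (cases ss rule: rev_cases)
    case Nil
    then show ?thesis using len_eq by (simp add: word_cong.refl)
  next
    case ss: (snoc us s)
    obtain vs t where ts: "ts = vs @ [t]" using len_eq ss by (cases ts rule: rev_cases) auto
    note u = reduced_snoc[OF less.prems(1)[unfolded ss]]
      and v = reduced_snoc[OF less.prems(2)[unfolded ts]]
    have usS: "us \<in> lists S" and vsS: "vs \<in> lists S" using u(1) v(1) by (simp_all add: reduced_def)
    show ?thesis
    proof (cases "s = t")
      case True
      then show ?thesis using same_last[of us s vs] less.prems ss ts by simp
    next
      case False
      define x where "x = word_prod G ss"
      have x: "x = word_prod G us \<otimes> s" "x = word_prod G vs \<otimes> t"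
        using less.prems(3) u v usS vsS unfolding x_def by (simp_all add: ss ts word_prod_append)
      have xc [simp]: "x \<in> carrier G" using x u usS by simp
      have xs: "x \<otimes> s = word_prod G us" using x(1) u(2) usS by simp
      have xt: "x \<otimes> t = word_prod G vs" using x(2) v(2) vsS by simp
      define z where "z = x \<otimes> longest s t"
      have zc [simp]: "z \<in> carrier G" using u(2) v(2) by (simp add: z_def)
      have lz: "len x = len z + m s t"
        unfolding z_def
        using len_mult_longest_down[OF xc u(2) v(2) False] xs xt u(3) v(3) x by simp
      obtain zs where zs: "reduced zs" "word_prod G zs = z" using ex_reduced[OF zc] by blast
      then have zsS: "zs \<in> lists S" by (simp add: reduced_def)
      have zD: "z \<otimes> longest s t = x"
        using u(2) v(2) inv_longest[of s t] r_inv[of "longest s t"]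
        by (simp add: z_def m_assoc)
      (* Used for (a, b) = (s, t) and for (a, b) = (t, s). *)
      have tail: "zs @ rev (alternating_word a b (m s t)) \<approx> cs @ [a] \<and> cs @ [a] \<in> lists S"
        if "a \<in> S" "b \<in> S" "{a, b} = {s, t}" "reduced (cs @ [a])" "word_prod G (cs @ [a]) = x" for a b cs
      proof -
        let ?w = "alternating_word a b (m s t)"
        have mab: "m a b = m s t" "longest a b = longest s t"
          using that(3) coxeter_matrix_sym[OF u(2) v(2)] longest_sym[OF u(2) v(2)]
          by (auto simp: doubleton_eq_iff)
        have w [simp]: "?w \<in> lists S" using that by (simp add: alternating_word_in_lists)
        have "word_prod G (zs @ rev ?w) = z \<otimes> inv (longest a b)"
          using zs(2) zsS by (simp add: word_prod_append word_prod_rev longest_def mab(1))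
        also have "\<dots> = x" using zD mab(2) inv_longest[OF u(2) v(2)] by simp
        finally have p: "word_prod G (zs @ rev ?w) = x" .
        have "m s t \<ge> 1" using coxeter_matrix_ge_2[OF u(2) v(2) False] by simp
        then obtain n where n: "m s t = Suc n" by (cases "m s t") auto
        have eq: "zs @ rev ?w = (zs @ rev (alternating_word b a n)) @ [a]" by (simp add: n)
        have red: "reduced (zs @ rev ?w)"
          using zs zsS p lz by (simp add: reduced_def)
        have "length (zs @ rev ?w) = length ss"
          using red p less.prems(1) by (simp add: reduced_def x_def)
        then show ?thesis
          using same_last[of "zs @ rev (alternating_word b a n)" a cs] red that(4,5) p
          unfolding eq by (simp add: reduced_def)
      qed
      have "ss \<approx> zs @ rev (alternating_word s t (m s t))"
        using tail[of s t us] u(2) v(2) less.prems(1) by (simp add: ss x_def word_cong.sym)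
      also have "zs @ rev (alternating_word s t (m s t)) \<approx> zs @ rev (alternating_word t s (m s t))"
      proof (rule word_cong_append)
        show "rev (alternating_word s t (m s t)) \<approx> rev (alternating_word t s (m s t))"
          using alternating_braid_eq[OF u(2) v(2) False]
          by (auto simp: rev_alternating_word intro: word_cong.sym)
      qed (use zsS in \<open>rule word_cong.refl\<close>)
      also (word_cong.trans) have "\<dots> \<approx> ts"
        using tail[of t s vs] u(2) v(2) less.prems(2,3) by (auto simp: ts x_def)
      finally (word_cong.trans) show ?thesis .
    qed
  qed
qed

lemma word_prod_braid_eq: "xs \<approx> ys \<Longrightarrow> word_prod G xs = word_prod G ys"
proof (induction rule: word_cong.induct)
  case (rel l r us vs)
  then obtain s t where st: "s \<in> S" "t \<in> S" "l = alternating_word s t (m s t)"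
    "r = alternating_word t s (m s t)"
    by (auto simp: braid_relations_def)
  then have "word_prod G l = word_prod G r"
    using longest_sym[of s t] coxeter_matrix_sym[of s t] by (simp add: longest_def)
  then show ?case using rel by (simp add: word_prod_append)
qed simp_all

lemma word_inversions_braid_eq:
  "xs \<approx> ys \<Longrightarrow> word_inversions G S xs = word_inversions G S ys"
proof (induction rule: word_cong.induct)
  case (rel l r us vs)
  then obtain s t where st: "s \<in> S" "t \<in> S" "s \<noteq> t" "l = alternating_word s t (m s t)"
    "r = alternating_word t s (m s t)"
    by (auto simp: braid_relations_def)
  have red: "reduced l" "reduced r"
    using reduced_alternating[OF st(1-3)] reduced_alternating[OF st(2,1) st(3)[symmetric]]
      coxeter_matrix_sym[OF st(1,2)] by (simp_all add: st)
  have lr: "word_prod G l = word_prod G r" using rel by (intro word_prod_braid_eq word_cong_relation)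
  have inv_lr: "word_inversions G S l = word_inversions G S r"
    using red lr word_inversions_reduced by simp
  have "word_act (rev l) v = word_act (rev r) v" for v
    using act_word_prod[of "rev l"] act_word_prod[of "rev r"] rel lr by (simp add: word_prod_rev)
  then show ?case by (simp add: word_inversions_append inv_lr)
qed simp_all

section \<open>The weak order\<close>

lemma cancel_inv_left:
  "\<lbrakk>x \<in> carrier G; y \<in> carrier G\<rbrakk> \<Longrightarrow> x \<otimes> (inv x \<otimes> y) = y"
  "\<lbrakk>x \<in> carrier G; y \<in> carrier G\<rbrakk> \<Longrightarrow> inv x \<otimes> (x \<otimes> y) = y"
  using m_assoc[of x "inv x" y] m_assoc[of "inv x" x y] by simp_all

definition additive :: "'g \<Rightarrow> 'g \<Rightarrow> bool" where
  "additive x y \<longleftrightarrow> len (x \<otimes> y) = len x + len y"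

text \<open>The weak order: some reduced word of \<open>v\<close> ends in a reduced word of \<open>u\<close>.\<close>

definition suffix :: "'g \<Rightarrow> 'g \<Rightarrow> bool" where
  "suffix u v \<longleftrightarrow> u \<in> carrier G \<and> v \<in> carrier G \<and> additive (v \<otimes> inv u) u"

lemma suffix_closed: "suffix u v \<Longrightarrow> u \<in> carrier G" "suffix u v \<Longrightarrow> v \<in> carrier G"
  by (simp_all add: suffix_def)

lemma suffixI: "\<lbrakk>x \<in> carrier G; u \<in> carrier G; additive x u\<rbrakk> \<Longrightarrow> suffix u (x \<otimes> u)"
  by (simp add: suffix_def m_assoc)

lemma suffixE:
  assumes "suffix u v"
  obtains x where "x \<in> carrier G" "v = x \<otimes> u" "additive x u"
  using assms that[of "v \<otimes> inv u"] by (simp add: suffix_def m_assoc)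

lemma additive_one [simp]: "x \<in> carrier G \<Longrightarrow> additive x \<one>" "x \<in> carrier G \<Longrightarrow> additive \<one> x"
  by (simp_all add: additive_def)

lemma additive_assoc:
  assumes "x \<in> carrier G" "y \<in> carrier G" "z \<in> carrier G"
  shows "additive x y \<and> additive (x \<otimes> y) z \<longleftrightarrow> additive y z \<and> additive x (y \<otimes> z)"
  using len_mult_le[of x y] len_mult_le[of "x \<otimes> y" z] len_mult_le[of y z]
    len_mult_le[of x "y \<otimes> z"] assms
  unfolding additive_def by (auto simp: m_assoc)

lemma suffix_refl: "x \<in> carrier G \<Longrightarrow> suffix x x"
  using suffixI[of \<one> x] by simp

lemma one_suffix: "x \<in> carrier G \<Longrightarrow> suffix \<one> x"
  using suffixI[of x \<one>] by simp

lemma suffix_trans: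
  assumes "suffix u v" "suffix v w"
  shows "suffix u w"
proof -
  obtain x y where "x \<in> carrier G" "v = x \<otimes> u" "additive x u"
    "y \<in> carrier G" "w = y \<otimes> v" "additive y v"
    using suffixE[OF assms(1)] suffixE[OF assms(2)] by metis
  then show ?thesis
    using additive_assoc[of y x u] suffixI[of "y \<otimes> x" u] suffix_closed[OF assms(1)]
    by (simp add: m_assoc)
qed

lemma suffix_len_le: "suffix u v \<Longrightarrow> len u \<le> len v"
  by (elim suffixE) (simp add: additive_def)

lemma suffix_len_eq:
  assumes "suffix u v" "len v \<le> len u"
  shows "u = v"
proof -
  obtain x where "x \<in> carrier G" "v = x \<otimes> u" "additive x u" using assms(1) by (rule suffixE)
  with assms suffix_closed[OF assms(1)] show ?thesis using len_eq_0[of x] by (simp add: additive_def)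
qed

lemma suffix_antisym: "\<lbrakk>suffix u v; suffix v u\<rbrakk> \<Longrightarrow> u = v"
  using suffix_len_eq suffix_len_le by blast

lemma suffix_additive:
  assumes "suffix u v" "additive v w" "w \<in> carrier G"
  shows "additive u w" and "suffix (u \<otimes> w) (v \<otimes> w)"
proof -
  obtain x where x: "x \<in> carrier G" "v = x \<otimes> u" "additive x u" using assms(1) by (rule suffixE)
  then have "additive u w \<and> additive x (u \<otimes> w)"
    using additive_assoc[of x u w] assms suffix_closed[OF assms(1)] by simp
  then show "additive u w" "suffix (u \<otimes> w) (v \<otimes> w)"
    using suffixI[of x "u \<otimes> w"] x suffix_closed[OF assms(1)] assms(3) by (simp_all add: m_assoc)
qed

lemma suffix_mult_cancel:
  assumes "u \<in> carrier G" "v \<in> carrier G" "w \<in> carrier G" "additive u w" "suffix (u \<otimes> w) (v \<otimes> w)"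
  shows "suffix u v"
proof -
  obtain x where x: "x \<in> carrier G" "v \<otimes> w = x \<otimes> (u \<otimes> w)" "additive x (u \<otimes> w)"
    using assms(5) by (rule suffixE)
  then have "v \<otimes> w = (x \<otimes> u) \<otimes> w" using assms by (simp add: m_assoc)
  then have "v = x \<otimes> u" using assms x(1) right_cancel[of w v "x \<otimes> u"] by simp
  then show ?thesis using additive_assoc[of x u w] x assms suffixI[of x u] by simp
qed

lemma suffix_step:
  assumes "suffix x a" "x \<noteq> a"
  shows "\<exists>s\<in>S. additive s x \<and> suffix (s \<otimes> x) a"
proof -
  note [simp] = suffix_closed[OF assms(1)]
  obtain y where y: "y \<in> carrier G" "a = y \<otimes> x" "additive y x" using assms(1) by (rule suffixE)
  with assms have "y \<noteq> \<one>" by auto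
  then obtain s where s: "s \<in> S" "len y = len (y \<otimes> s) + 1" using ex_right_descent y by blast
  then have "additive (y \<otimes> s) s" using y by (simp add: additive_def)
  then have "additive s x \<and> additive (y \<otimes> s) (s \<otimes> x)"
    using additive_assoc[of "y \<otimes> s" s x] s y by simp
  then show ?thesis
    using suffixI[of "y \<otimes> s" "s \<otimes> x"] s y by (auto simp: m_assoc intro!: bexI[of _ s])
qed

lemma longest_mult_twice:
  assumes "s \<in> S" "t \<in> S" "x \<in> carrier G"
  shows "longest s t \<otimes> (longest s t \<otimes> x) = x"
proof -
  have "longest s t \<otimes> longest s t = \<one>"
    using l_inv[of "longest s t"] inv_longest assms(1,2) by simp
  then show ?thesis using m_assoc[of "longest s t" "longest s t" x] assms by simp
qed

lemma len_longest_mult_simple: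
  assumes "s \<in> S" "t \<in> S" "s \<noteq> t"
  shows "len (longest s t \<otimes> s) + 1 = m s t"
proof -
  obtain n where n: "m s t = Suc n" using coxeter_matrix_ge_2[OF assms] by (cases "m s t") auto
  have "s \<otimes> longest s t = word_prod G (alternating_word t s n)"
    using assms by (simp add: longest_def n alternating_word_in_lists)
  then have "len (s \<otimes> longest s t) \<le> n"
    using len_le_length[of "alternating_word t s n"] assms by (simp add: alternating_word_in_lists)
  moreover have "len (longest s t \<otimes> s) = len (s \<otimes> longest s t)"
    using len_inv[of "longest s t \<otimes> s"] assms by (simp add: inv_mult_group inv_longest)
  ultimately show ?thesis
    using len_mult_simple[of "longest s t" s] len_longest[OF assms] assms n by auto
qed

lemma simple_mult_suffix_longest_mult:
  assumes "x \<in> carrier G" "s \<in> S" "t \<in> S" "s \<noteq> t" "additive s x" "additive t x"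
  shows "suffix (s \<otimes> x) (longest s t \<otimes> x)"
proof -
  have l: "len (longest s t \<otimes> x) = len x + m s t"
    using len_longest_mult_up[of x s t] assms by (simp add: additive_def)
  have eq: "longest s t \<otimes> x = (longest s t \<otimes> s) \<otimes> (s \<otimes> x)"
    using assms by (simp add: m_assoc)
  have "additive (longest s t \<otimes> s) (s \<otimes> x)"
    using l len_longest_mult_simple[OF assms(2-4)] assms
    unfolding additive_def by (subst eq[symmetric]) simp
  then show ?thesis unfolding eq using assms by (intro suffixI) auto
qed

text \<open>Local confluence in the weak order: two covers \<open>s x\<close> and \<open>t x\<close> of \<open>x\<close> below \<open>v\<close> have a
  common upper bound below \<open>v\<close>.\<close>

lemma longest_mult_suffix:
  assumes "x \<in> carrier G" "s \<in> S" "t \<in> S" "s \<noteq> t" "additive s x" "additive t x"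
    and v: "suffix (s \<otimes> x) v" "suffix (t \<otimes> x) v"
  shows "suffix (longest s t \<otimes> x) v"
proof -
  define y where "y = v \<otimes> inv x"
  have vc: "v \<in> carrier G" using v suffix_closed by blast
  then have y: "y \<in> carrier G" "v = y \<otimes> x" using assms(1) by (simp_all add: y_def m_assoc)
  have down: "len y = len (y \<otimes> r) + 1 \<and> additive y x"
    if r: "r \<in> S" "additive r x" "suffix (r \<otimes> x) v" for r
  proof -
    obtain z where z: "z \<in> carrier G" "v = z \<otimes> (r \<otimes> x)" "additive z (r \<otimes> x)"
      using r(3) by (rule suffixE)
    then have "y = z \<otimes> r" using r(1) assms(1) unfolding y_def by (simp add: m_assoc)
    then show ?thesis
      using additive_assoc[of z r x] z r assms(1) by (auto simp: additive_def)
  qed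
  have "len y = len (y \<otimes> longest s t) + m s t"
    using len_mult_longest_down[OF y(1) assms(2-4)] down assms by blast
  moreover have "additive y x" using down[of s] assms by blast
  moreover have "len (longest s t \<otimes> x) = len x + m s t"
    using len_longest_mult_up[of x s t] assms by (simp add: additive_def)
  moreover have eq: "v = (y \<otimes> longest s t) \<otimes> (longest s t \<otimes> x)"
    using y assms longest_mult_twice[OF assms(2,3,1)] by (simp add: m_assoc)
  ultimately have "additive (y \<otimes> longest s t) (longest s t \<otimes> x)"
    using y(2) unfolding additive_def by (subst eq[symmetric]) simp
  then show ?thesis unfolding eq using assms y by (intro suffixI) auto
qed

text \<open>The upper bound that joins \<open>s x\<close> and \<open>t x\<close> does not leave the set of elements whose
  length adds up with that of \<open>w\<close>.\<close>

lemma additive_longest_mult: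
  assumes "x \<in> carrier G" "w \<in> carrier G" "s \<in> S" "t \<in> S" "s \<noteq> t" "additive s x" "additive t x"
    and "additive (s \<otimes> x) w" "additive (t \<otimes> x) w"
  shows "additive (longest s t \<otimes> x) w"
proof -
  have xw: "additive s (x \<otimes> w)" "additive t (x \<otimes> w)" "additive x w"
    using additive_assoc[of s x w] additive_assoc[of t x w] assms by auto
  show ?thesis
    using len_longest_mult_up[of x s t] len_longest_mult_up[of "x \<otimes> w" s t] assms xw
    by (simp add: additive_def m_assoc)
qed

text \<open>The suffixes of \<open>v\<close> whose length adds up with that of \<open>w\<close> form a finite set that is
  closed under the local confluence above. As for terminating rewriting, local confluence
  gives confluence: induct from the top on the common lower bound \<open>x\<close> and close the diamond
  over a first step from \<open>x\<close> towards \<open>a\<close> and one towards \<open>b\<close>.\<close>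

lemma common_upper_bound:
  assumes "v \<in> carrier G" "w \<in> carrier G"
    and "suffix x a" "suffix a v" "additive a w"
    and "suffix x b" "suffix b v" "additive b w"
  shows "\<exists>c. suffix c v \<and> additive c w \<and> suffix a c \<and> suffix b c"
  using assms(3-)
proof (induction "len v - len x" arbitrary: x a b rule: less_induct)
  case less
  note suff = less.prems(1,2,4,5) and add = less.prems(3,6)
  have xc: "x \<in> carrier G" using suff suffix_closed by blast
  show ?case
  proof (cases "x = a \<or> x = b")
    case True
    then show ?thesis using less.prems suffix_refl suffix_closed by blast
  next
    case False
    obtain s where s: "s \<in> S" "additive s x" "suffix (s \<otimes> x) a"
      using suffix_step[OF suff(1)] False by blast
    obtain t where t: "t \<in> S" "additive t x" "suffix (t \<otimes> x) b"
      using suffix_step[OF suff(3)] False by blast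
    have sv: "suffix (s \<otimes> x) v" and tv: "suffix (t \<otimes> x) v"
      using suffix_trans s(3) t(3) suff by blast+
    have shorter: "len v - len z < len v - len x" if "suffix (r \<otimes> x) z" "suffix z v" "r \<in> S"
      "additive r x" for r z
      using suffix_len_le[OF that(1)] suffix_len_le[OF that(2)] that(3,4) by (simp add: additive_def)
    show ?thesis
    proof (cases "s = t")
      case True
      then show ?thesis
        using less.hyps[OF shorter[OF suffix_refl sv s(1,2)] s(3) suff(2) add(1) _ suff(4) add(2)]
          s t xc by simp
    next
      case False
      define z where "z = longest s t \<otimes> x"
      have zv: "suffix z v"
        unfolding z_def using longest_mult_suffix[OF xc s(1) t(1) False s(2) t(2) sv tv] .
      have zw: "additive z w"
        unfolding z_def
        using suffix_additive(1)[OF s(3) add(1) assms(2)] suffix_additive(1)[OF t(3) add(2) assms(2)]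
        by (intro additive_longest_mult[OF xc assms(2) s(1) t(1) False s(2) t(2)])
      have sz: "suffix (s \<otimes> x) z"
        unfolding z_def by (rule simple_mult_suffix_longest_mult[OF xc s(1) t(1) False s(2) t(2)])
      have tz: "suffix (t \<otimes> x) z"
        unfolding z_def longest_sym[OF s(1) t(1)]
        by (rule simple_mult_suffix_longest_mult[OF xc t(1) s(1) False[symmetric] t(2) s(2)])
      have sx: "s \<otimes> x \<in> carrier G" and tx: "t \<otimes> x \<in> carrier G" using s t xc by auto
      obtain c1 where c1: "suffix c1 v" "additive c1 w" "suffix a c1" "suffix z c1"
        using less.hyps[OF shorter[OF suffix_refl[OF sx] sv s(1,2)] s(3) suff(2) add(1) sz zv zw] by blast
      obtain c2 where c2: "suffix c2 v" "additive c2 w" "suffix b c2" "suffix z c2"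
        using less.hyps[OF shorter[OF suffix_refl[OF tx] tv t(1,2)] t(3) suff(4) add(2) tz zv zw] by blast
      obtain c where "suffix c v" "additive c w" "suffix c1 c" "suffix c2 c"
        using less.hyps[OF shorter[OF sz zv s(1,2)] c1(4,1,2) c2(4,1,2)] by blast
      then show ?thesis using suffix_trans c1(3) c2(3) by blast
    qed
  qed
qed

text \<open>The greatest suffix of \<open>v\<close> that can be multiplied by \<open>w\<close> without cancellation. The
  product of this suffix and \<open>w\<close> is the head of the braid product of the lifts of \<open>v\<close> and \<open>w\<close>.\<close>

definition is_cut :: "'g \<Rightarrow> 'g \<Rightarrow> 'g \<Rightarrow> bool" where
  "is_cut v w u \<longleftrightarrow> suffix u v \<and> additive u w \<and> (\<forall>a. suffix a v \<and> additive a w \<longrightarrow> suffix a u)"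

definition cut :: "'g \<Rightarrow> 'g \<Rightarrow> 'g" where
  "cut v w = (SOME u. is_cut v w u)"

lemma is_cut_cut:
  assumes "v \<in> carrier G" "w \<in> carrier G"
  shows "is_cut v w (cut v w)"
proof -
  (* A candidate of maximal length is greatest, as any other candidate shares an upper bound with it. *)
  define P where "P u \<longleftrightarrow> suffix u v \<and> additive u w" for u
  have P1: "P \<one>" using assms one_suffix by (simp add: P_def)
  have bound: "\<And>u. P u \<Longrightarrow> len u \<le> len v" using suffix_len_le by (simp add: P_def)
  define n where "n = (GREATEST n. \<exists>u. P u \<and> len u = n)"
  have "\<exists>u. P u \<and> len u = n"
    unfolding n_def by (rule GreatestI_nat[where P = "\<lambda>n. \<exists>u. P u \<and> len u = n" and b = "len v"])
      (use P1 bound in auto)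
  then obtain u where u: "P u" "len u = n" by blast
  have max: "len c \<le> n" if "P c" for c
    unfolding n_def by (rule Greatest_le_nat[where P = "\<lambda>n. \<exists>u. P u \<and> len u = n" and b = "len v"])
      (use that bound in auto)
  have "suffix a u" if a: "P a" for a
  proof -
    obtain c where "P c" "suffix u c" "suffix a c"
      using common_upper_bound[OF assms, of \<one> u a] a u one_suffix suffix_closed
      unfolding P_def by blast
    then show ?thesis using suffix_len_eq[of u c] max[of c] u(2) by simp
  qed
  then have "is_cut v w u" using u(1) by (simp add: is_cut_def P_def)
  then show ?thesis unfolding cut_def by (rule someI)
qed

lemma cut_unique: "\<lbrakk>v \<in> carrier G; w \<in> carrier G; is_cut v w u\<rbrakk> \<Longrightarrow> cut v w = u"
  using is_cut_cut suffix_antisym unfolding is_cut_def by blast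

lemma cut_facts:
  assumes "v \<in> carrier G" "w \<in> carrier G"
  shows "suffix (cut v w) v" "additive (cut v w) w" "cut v w \<in> carrier G"
    and "\<lbrakk>suffix a v; additive a w\<rbrakk> \<Longrightarrow> suffix a (cut v w)"
  using is_cut_cut[OF assms] suffix_closed unfolding is_cut_def by blast+

lemma cut_one_right [simp]: "v \<in> carrier G \<Longrightarrow> cut v \<one> = v"
  by (rule cut_unique) (auto simp: is_cut_def suffix_refl suffix_closed)

text \<open>Absorbing a reduced product into \<open>v\<close> at once or in two steps gives the same suffix. This
  is what makes the recursion for the normal form independent of the chosen reduced word.\<close>

lemma cut_mult:
  assumes v: "v \<in> carrier G" and w: "w \<in> carrier G" and w': "w' \<in> carrier G" and add: "additive w w'"
  shows "cut (cut v w \<otimes> w) w' = cut v (w \<otimes> w') \<otimes> w" and "suffix (cut v (w \<otimes> w')) (cut v w)"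
proof -
  define u u' where "u = cut v w" and "u' = cut v (w \<otimes> w')"
  have ww': "w \<otimes> w' \<in> carrier G" using w w' by simp
  note u = cut_facts[OF v w, folded u_def] and u' = cut_facts[OF v ww', folded u'_def]
  have uw: "u \<otimes> w \<in> carrier G" using u w by simp
  note x = cut_facts[OF uw w']
  have u'w: "additive u' w" "additive (u' \<otimes> w) w'"
    using additive_assoc[OF u'(3) w w'] u'(2) add by blast+
  show u'u: "suffix u' u" using u(4)[OF u'(1) u'w(1)] .
  have "suffix (u' \<otimes> w) (cut (u \<otimes> w) w')"
    using x(4) suffix_additive(2)[OF u'u u(2) w] u'w(2) by blast
  moreover have "suffix (cut (u \<otimes> w) w') (u' \<otimes> w)"
  proof -
    have "suffix w (cut (u \<otimes> w) w')" using x(4) suffixI[OF u(3) w u(2)] add by blast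
    then obtain u'' where u'': "u'' \<in> carrier G" "cut (u \<otimes> w) w' = u'' \<otimes> w" "additive u'' w"
      by (rule suffixE)
    have "suffix u'' u" using suffix_mult_cancel[OF u''(1) u(3) w u''(3)] x(1) u''(2) by simp
    then have "suffix u'' v" using u(1) suffix_trans by blast
    moreover have "additive u'' (w \<otimes> w')"
      using additive_assoc[OF u''(1) w w'] u''(2,3) x(2) by simp
    ultimately have "suffix u'' u'" by (rule u'(4))
    then show ?thesis unfolding u''(2) by (rule suffix_additive(2)[OF _ u'w(1) w])
  qed
  ultimately show "cut (u \<otimes> w) w' = u' \<otimes> w" using suffix_antisym by blast
qed

section \<open>Garside normal form in the braid monoid\<close>

abbreviation BM :: "'g list set monoid" where "BM \<equiv> braid_monoid G S"

abbreviation cl :: "'g list \<Rightarrow> 'g list set" where "cl \<equiv> word_class S (braid_relations G S)"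

lemma BM_monoid: "monoid BM"
  unfolding braid_monoid_def by (rule presented_monoid_is_monoid)

lemma BM_simps:
  "carrier BM = cl ` lists S" "\<one>\<^bsub>BM\<^esub> = cl []"
  "\<lbrakk>xs \<in> lists S; ys \<in> lists S\<rbrakk> \<Longrightarrow> cl xs \<otimes>\<^bsub>BM\<^esub> cl ys = cl (xs @ ys)"
  by (simp_all add: braid_monoid_def presented_carrier presented_one presented_mult)

lemma cl_eq_iff: "xs \<in> lists S \<Longrightarrow> cl xs = cl ys \<longleftrightarrow> xs \<approx> ys"
  by (rule word_class_eq_iff)

sublocale BM: monoid BM by (rule BM_monoid)

definition lift :: "'g \<Rightarrow> 'g list set" where
  "lift x = cl (SOME ss. reduced_expression G S x ss)"

lemma lift_word_prod:
  assumes "reduced ss"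
  shows "lift (word_prod G ss) = cl ss"
proof -
  let ?ts = "SOME ts. reduced_expression G S (word_prod G ss) ts"
  have "reduced_expression G S (word_prod G ss) ss"
    using assms by (simp add: reduced_expression_iff reduced_def)
  then have "reduced_expression G S (word_prod G ss) ?ts" by (rule someI)
  then have ts: "reduced ?ts" "word_prod G ?ts = word_prod G ss"
    by (auto simp: reduced_expression_iff reduced_def)
  then show ?thesis
    unfolding lift_def using matsumoto[OF ts(1) assms] cl_eq_iff[of ?ts] by (simp add: reduced_def)
qed

lemma lift_closed [simp]: "x \<in> carrier G \<Longrightarrow> lift x \<in> carrier BM"
  using ex_reduced[of x] lift_word_prod by (auto simp: BM_simps reduced_def)

lemma lift_one [simp]: "lift \<one> = \<one>\<^bsub>BM\<^esub>"
  using lift_word_prod[of "[]"] by (simp add: reduced_def BM_simps)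

lemma lift_simple: "s \<in> S \<Longrightarrow> lift s = cl [s]"
  using lift_word_prod[of "[s]"] by (simp add: reduced_def)

lemma lift_mult:
  assumes "x \<in> carrier G" "y \<in> carrier G" "additive x y"
  shows "lift (x \<otimes> y) = lift x \<otimes>\<^bsub>BM\<^esub> lift y"
proof -
  obtain xs ys where xy: "reduced xs" "word_prod G xs = x" "reduced ys" "word_prod G ys = y"
    using ex_reduced assms by meson
  then have "reduced (xs @ ys)" "word_prod G (xs @ ys) = x \<otimes> y"
    using assms(3) by (auto simp: reduced_def additive_def word_prod_append)
  then show ?thesis
    using lift_word_prod[of "xs @ ys"] lift_word_prod[of xs] lift_word_prod[of ys] xy
    by (auto simp: BM_simps reduced_def)
qed

lemma lift_suffix:
  assumes "suffix u v"
  shows "lift v = lift (v \<otimes> inv u) \<otimes>\<^bsub>BM\<^esub> lift u"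
  using lift_mult[of "v \<otimes> inv u" u] assms by (simp add: suffix_def m_assoc)

text \<open>The effect of appending the letter \<open>s\<close> to a word with head \<open>v\<close> and rest \<open>C\<close>. The
  recursion is over words; that it only depends on the braid is \<open>run_braid_eq\<close>.\<close>

definition garside_step :: "'g \<times> 'g list set \<Rightarrow> 'g \<Rightarrow> 'g \<times> 'g list set" where
  "garside_step st s = (case st of (v, C) \<Rightarrow>
     (cut v s \<otimes> s, C \<otimes>\<^bsub>BM\<^esub> lift (v \<otimes> inv (cut v s))))"

lemma garside_step_closed:
  "\<lbrakk>st \<in> carrier G \<times> carrier BM; s \<in> S\<rbrakk> \<Longrightarrow> garside_step st s \<in> carrier G \<times> carrier BM"
  by (auto simp: garside_step_def cut_facts)

lemma run_closed:
  "\<lbrakk>st \<in> carrier G \<times> carrier BM; ss \<in> lists S\<rbrakk> \<Longrightarrow> foldl garside_step st ss \<in> carrier G \<times> carrier BM"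
  by (induction ss arbitrary: st) (use garside_step_closed in \<open>auto simp del: mem_Sigma_iff\<close>)

lemma run_reduced:
  assumes "v \<in> carrier G" "C \<in> carrier BM" "reduced ss"
  shows "foldl garside_step (v, C) ss
    = (cut v (word_prod G ss) \<otimes> word_prod G ss,
       C \<otimes>\<^bsub>BM\<^esub> lift (v \<otimes> inv (cut v (word_prod G ss))))"
  using assms(3)
proof (induction ss rule: rev_induct)
  case Nil
  then show ?case using assms by simp
next
  case (snoc s ss)
  note red = reduced_snoc[OF snoc.prems]
  define w where "w = word_prod G ss"
  have ss: "ss \<in> lists S" using red(1) by (simp add: reduced_def)
  have w: "w \<in> carrier G" and s: "s \<in> carrier G" using ss red(2) by (auto simp: w_def)
  have add: "additive w s" using red by (simp add: additive_def w_def)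
  have ws: "word_prod G (ss @ [s]) = w \<otimes> s" using ss red(2) by (simp add: word_prod_append w_def)
  define u u' where "u = cut v w" and "u' = cut v (w \<otimes> s)"
  have c: "u \<in> carrier G" "u' \<in> carrier G" and uv: "suffix u v"
    using cut_facts assms(1) w s by (simp_all add: u_def u'_def)
  note cm = cut_mult[OF assms(1) w s add, folded u_def u'_def]
  have diff: "u \<otimes> w \<otimes> inv (u' \<otimes> w) = u \<otimes> inv u'"
    using c w by (simp add: inv_mult_group m_assoc cancel_inv_left)
  have "additive (v \<otimes> inv u) (u \<otimes> inv u')"
    using additive_assoc[of "v \<otimes> inv u" "u \<otimes> inv u'" u'] uv cm(2) c assms(1)
    by (simp add: suffix_def m_assoc)
  then have "lift (v \<otimes> inv u) \<otimes>\<^bsub>BM\<^esub> lift (u \<otimes> inv u') = lift (v \<otimes> inv u')"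
    using lift_mult[of "v \<otimes> inv u" "u \<otimes> inv u'"] c assms(1)
    by (simp add: m_assoc cancel_inv_left)
  then show ?case
    using snoc.IH[OF red(1), folded w_def, folded u_def] cm(1) c w s assms diff
    by (simp add: garside_step_def ws u'_def[symmetric] m_assoc BM.m_assoc)
qed

text \<open>Both sides of a braid relation are reduced words of the same element, so by
  \<open>run_reduced\<close> they transform a pair in the same way.\<close>

lemma run_braid_eq:
  "\<lbrakk>xs \<approx> ys; st \<in> carrier G \<times> carrier BM\<rbrakk> \<Longrightarrow> foldl garside_step st xs = foldl garside_step st ys"
proof (induction arbitrary: st rule: word_cong.induct)
  case (rel l r us vs)
  then obtain s t where st: "s \<in> S" "t \<in> S" "s \<noteq> t" "l = alternating_word s t (m s t)"
    "r = alternating_word t s (m s t)"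
    by (auto simp: braid_relations_def)
  have red: "reduced l" "reduced r"
    using reduced_alternating[OF st(1-3)] reduced_alternating[OF st(2,1) st(3)[symmetric]]
      coxeter_matrix_sym[OF st(1,2)] by (simp_all add: st)
  have lr: "word_prod G l = word_prod G r"
    using rel.hyps by (intro word_prod_braid_eq word_cong_relation)
  obtain v C where vC: "foldl garside_step st us = (v, C)" "v \<in> carrier G" "C \<in> carrier BM"
    using run_closed[OF rel.prems, of us] rel.hyps by auto
  show ?case using run_reduced[OF vC(2,3)] red lr by (simp add: vC(1))
qed simp_all

definition garside :: "'g list \<Rightarrow> 'g \<times> 'g list set" where
  "garside xs = foldl garside_step (\<one>, \<one>\<^bsub>BM\<^esub>) xs"

abbreviation head :: "'g list \<Rightarrow> 'g" where "head xs \<equiv> fst (garside xs)"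

lemma garside_closed:
  assumes "xs \<in> lists S"
  shows "head xs \<in> carrier G" "snd (garside xs) \<in> carrier BM"
  using run_closed[OF _ assms, of "(\<one>, \<one>\<^bsub>BM\<^esub>)"] by (auto simp: garside_def mem_Times_iff)

lemma garside_cong: "xs \<approx> ys \<Longrightarrow> garside xs = garside ys"
  unfolding garside_def by (rule run_braid_eq) auto

lemma garside_append: "garside (xs @ ys) = foldl garside_step (garside xs) ys"
  by (simp add: garside_def)

lemma garside_factorization:
  "xs \<in> lists S \<Longrightarrow> snd (garside xs) \<otimes>\<^bsub>BM\<^esub> lift (head xs) = cl xs"
proof (induction xs rule: rev_induct)
  case Nil
  then show ?case by (simp add: garside_def BM_simps)
next
  case (snoc s xs)
  then have xs: "xs \<in> lists S" and s: "s \<in> S" by auto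
  define v C where "v = head xs" and "C = snd (garside xs)"
  have vC: "v \<in> carrier G" "C \<in> carrier BM" using garside_closed[OF xs] by (simp_all add: v_def C_def)
  define u where "u = cut v s"
  note u = cut_facts[OF vC(1) S_closed[OF s], folded u_def]
  have g: "garside (xs @ [s]) = (u \<otimes> s, C \<otimes>\<^bsub>BM\<^esub> lift (v \<otimes> inv u))"
    by (simp add: garside_append garside_step_def v_def C_def u_def split: prod.split)
  have "C \<otimes>\<^bsub>BM\<^esub> lift (v \<otimes> inv u) \<otimes>\<^bsub>BM\<^esub> lift (u \<otimes> s)
      = C \<otimes>\<^bsub>BM\<^esub> (lift (v \<otimes> inv u) \<otimes>\<^bsub>BM\<^esub> lift u) \<otimes>\<^bsub>BM\<^esub> lift s"
    using lift_mult[of u s] u vC s by (simp add: BM.m_assoc)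
  also have "\<dots> = cl xs \<otimes>\<^bsub>BM\<^esub> cl [s]"
    using lift_suffix[OF u(1)] snoc.IH[OF xs] s by (simp add: v_def C_def lift_simple)
  also have "\<dots> = cl (xs @ [s])" using xs s by (intro BM_simps(3)) simp_all
  finally show ?case by (simp only: g fst_conv snd_conv)
qed

lemma fst_run_cong: "fst st = fst st' \<Longrightarrow> fst (foldl garside_step st ys) = fst (foldl garside_step st' ys)"
proof (induction ys arbitrary: st st')
  case (Cons y ys)
  have "fst (garside_step st y) = fst (garside_step st' y)"
    using Cons.prems by (simp add: garside_step_def case_prod_beta)
  then show ?case unfolding foldl_Cons by (rule Cons.IH)
qed simp

lemma head_append_cong: "head xs = head xs' \<Longrightarrow> head (xs @ ys) = head (xs' @ ys)"
  unfolding garside_append by (rule fst_run_cong)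

lemma head_append_reduced:
  assumes "xs \<in> lists S" "reduced us"
  shows "head (xs @ us) = cut (head xs) (word_prod G us) \<otimes> word_prod G us"
  using run_reduced[OF garside_closed[OF assms(1)] assms(2)] by (simp add: garside_append)

lemma garside_reduced: "reduced us \<Longrightarrow> garside us = (word_prod G us, \<one>\<^bsub>BM\<^esub>)"
proof -
  assume us: "reduced us"
  then have w: "word_prod G us \<in> carrier G" by (auto simp: reduced_def)
  have "suffix (cut \<one> (word_prod G us)) \<one>" using cut_facts w by simp
  then have "cut \<one> (word_prod G us) = \<one>" using one_suffix suffix_antisym suffix_closed by metis
  then show ?thesis using run_reduced[of \<one> "\<one>\<^bsub>BM\<^esub>" us] us w by (simp add: garside_def)
qed

text \<open>Together with \<open>garside_factorization\<close> this says that the head is the greatest reduced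
  right divisor.\<close>

lemma suffix_head:
  assumes "xs \<in> lists S" "C \<in> carrier BM" "u \<in> carrier G" "cl xs = C \<otimes>\<^bsub>BM\<^esub> lift u"
  shows "suffix u (head xs)"
proof -
  obtain cs where cs: "cs \<in> lists S" "C = cl cs" using assms(2) by (auto simp: BM_simps)
  obtain us where us: "reduced us" "word_prod G us = u" using ex_reduced assms(3) by blast
  then have usS: "us \<in> lists S" by (simp add: reduced_def)
  have "xs \<approx> cs @ us"
    using assms cs us usS lift_word_prod[OF us(1)] cl_eq_iff by (simp add: BM_simps)
  then have "head xs = cut (head cs) u \<otimes> u"
    using garside_cong head_append_reduced[OF cs(1) us(1)] us(2) by metis
  then show ?thesis
    using cut_facts[OF garside_closed(1)[OF cs(1)] assms(3)] suffixI assms(3) by simp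
qed

text \<open>Appending \<open>s\<close> to a word with head \<open>v\<close> and rest \<open>C\<close> gives the head \<open>u s\<close> and the rest
  \<open>C (v u\<^sup>-\<^sup>1)\<close>. So \<open>u\<close> can be read off from the new head, and the new rest times \<open>u\<close> is the
  braid before \<open>s\<close> was appended.\<close>

lemma braid_eq_cancel_letter:
  assumes "xs @ [s] \<approx> ys @ [s]"
  shows "xs \<approx> ys"
proof -
  have recover: "cl zs = snd (garside (zs @ [s])) \<otimes>\<^bsub>BM\<^esub> lift (head (zs @ [s]) \<otimes> s)"
    if zs: "zs \<in> lists S" and s: "s \<in> S" for zs
  proof -
    define v C where "v = head zs" and "C = snd (garside zs)"
    have vC: "v \<in> carrier G" "C \<in> carrier BM" using garside_closed[OF zs] by (simp_all add: v_def C_def)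
    define u where "u = cut v s"
    note u = cut_facts[OF vC(1) S_closed[OF s], folded u_def]
    have g: "garside (zs @ [s]) = (u \<otimes> s, C \<otimes>\<^bsub>BM\<^esub> lift (v \<otimes> inv u))"
      by (simp add: garside_append garside_step_def v_def C_def u_def split: prod.split)
    have "cl zs = C \<otimes>\<^bsub>BM\<^esub> (lift (v \<otimes> inv u) \<otimes>\<^bsub>BM\<^esub> lift u)"
      using garside_factorization[OF zs] lift_suffix[OF u(1)] by (simp add: v_def C_def)
    then show ?thesis using u vC s by (simp add: g BM.m_assoc)
  qed
  have "xs \<in> lists S" "ys \<in> lists S" "s \<in> S" using word_cong_in_lists[OF assms] by auto
  with recover[of xs] recover[of ys] garside_cong[OF assms] have "cl xs = cl ys" by simp
  then show ?thesis using cl_eq_iff \<open>xs \<in> lists S\<close> by blast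
qed

lemma braid_eq_cancel: "xs @ us \<approx> ys @ us \<Longrightarrow> xs \<approx> ys"
proof (induction us rule: rev_induct)
  case (snoc s us)
  then show ?case using braid_eq_cancel_letter[of "xs @ us" s "ys @ us"] by simp
qed simp

lemma BM_right_cancel:
  assumes "A \<in> carrier BM" "B \<in> carrier BM" "C \<in> carrier BM" "A \<otimes>\<^bsub>BM\<^esub> C = B \<otimes>\<^bsub>BM\<^esub> C"
  shows "A = B"
proof -
  obtain as bs cs where w: "as \<in> lists S" "bs \<in> lists S" "cs \<in> lists S"
    and "A = cl as" "B = cl bs" "C = cl cs"
    using assms(1-3) by (auto simp: BM_simps)
  with assms(4) show ?thesis using cl_eq_iff braid_eq_cancel[of as cs bs] by (simp add: BM_simps)
qed

end

section \<open>Twists\<close>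

context twisted_finite_coxeter_group
begin

abbreviation D :: "('g \<Rightarrow> 'g) monoid" where "D \<equiv> twist_group G \<Omega>"
abbreviation W :: "(('g \<Rightarrow> 'g) \<times> 'g) monoid" where "W \<equiv> twisted_group G \<Omega>"
abbreviation T :: "(('g \<Rightarrow> 'g) \<times> 'g list set) monoid" where "T \<equiv> twisted_braid_monoid G S \<Omega>"

lemma D_group: "group D"
  unfolding twist_group_def by (rule subgroup.subgroup_is_group[OF twists_subgroup AutoGroup])

sublocale D: group D by (rule D_group)

lemma D_carrier [simp]: "carrier D = \<Omega>"
  by (simp add: twist_group_def)

lemma D_one: "\<one>\<^bsub>D\<^esub> = \<one>\<^bsub>AutoGroup G\<^esub>"
  by (simp add: twist_group_def)

lemma twist_in_auto: "\<delta> \<in> \<Omega> \<Longrightarrow> \<delta> \<in> auto G"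
  using subgroup.subset[OF twists_subgroup] by (auto simp: AutoGroup_def)

lemma twist_closed [simp]: "\<lbrakk>\<delta> \<in> \<Omega>; x \<in> carrier G\<rbrakk> \<Longrightarrow> \<delta> x \<in> carrier G"
  using twist_in_auto[of \<delta>] by (auto simp: auto_def hom_def)

lemma twist_mult: "\<lbrakk>\<delta> \<in> \<Omega>; x \<in> carrier G; y \<in> carrier G\<rbrakk> \<Longrightarrow> \<delta> (x \<otimes> y) = \<delta> x \<otimes> \<delta> y"
  using twist_in_auto[of \<delta>] by (auto simp: auto_def hom_def)

lemma twist_S [simp]: "\<lbrakk>\<delta> \<in> \<Omega>; s \<in> S\<rbrakk> \<Longrightarrow> \<delta> s \<in> S"
  using twists_permute by blast

lemma D_one_apply [simp]: "x \<in> carrier G \<Longrightarrow> \<one>\<^bsub>D\<^esub> x = x"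
  by (simp add: twist_group_def AutoGroup_def BijGroup_def)

lemma D_mult_apply:
  assumes "\<delta> \<in> \<Omega>" "\<epsilon> \<in> \<Omega>" "x \<in> carrier G"
  shows "(\<delta> \<otimes>\<^bsub>D\<^esub> \<epsilon>) x = \<delta> (\<epsilon> x)"
  using assms twist_in_auto[of \<delta>] twist_in_auto[of \<epsilon>]
  by (simp add: twist_group_def AutoGroup_def BijGroup_def auto_def compose_def)

lemma D_inv_closed [simp]: "\<delta> \<in> \<Omega> \<Longrightarrow> inv\<^bsub>D\<^esub> \<delta> \<in> \<Omega>"
  using D.inv_closed by simp

lemma D_mult_closed [simp]: "\<lbrakk>\<delta> \<in> \<Omega>; \<epsilon> \<in> \<Omega>\<rbrakk> \<Longrightarrow> \<delta> \<otimes>\<^bsub>D\<^esub> \<epsilon> \<in> \<Omega>"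
  using D.m_closed by simp

lemma D_one_closed [simp]: "\<one>\<^bsub>D\<^esub> \<in> \<Omega>"
  using D.one_closed by simp

lemma D_inv_apply [simp]:
  assumes "\<delta> \<in> \<Omega>" "x \<in> carrier G"
  shows "(inv\<^bsub>D\<^esub> \<delta>) (\<delta> x) = x" and "\<delta> ((inv\<^bsub>D\<^esub> \<delta>) x) = x"
  using D_mult_apply[of "inv\<^bsub>D\<^esub> \<delta>" \<delta> x] D_mult_apply[of \<delta> "inv\<^bsub>D\<^esub> \<delta>" x] assms by simp_all

lemma twist_hom: "\<delta> \<in> \<Omega> \<Longrightarrow> group_hom G G \<delta>"
  using twist_in_auto[of \<delta>] by (simp add: group_hom_def group_hom_axioms_def auto_def)

lemma twist_one [simp]: "\<delta> \<in> \<Omega> \<Longrightarrow> \<delta> \<one> = \<one>"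
  using group_hom.hom_one[OF twist_hom] .

lemma twist_inj: "\<lbrakk>\<delta> \<in> \<Omega>; x \<in> carrier G; y \<in> carrier G\<rbrakk> \<Longrightarrow> \<delta> x = \<delta> y \<longleftrightarrow> x = y"
  using D_inv_apply(1) by metis

lemma twist_coxeter_matrix:
  assumes "\<delta> \<in> \<Omega>" "s \<in> S" "t \<in> S"
  shows "m (\<delta> s) (\<delta> t) = m s t"
proof -
  let ?x = "s \<otimes> t"
  have x: "?x \<in> carrier G" "\<delta> ?x \<in> carrier G" using assms by auto
  have "\<delta> ?x [^] n = \<one> \<longleftrightarrow> ord ?x dvd n" for n :: nat
  proof -
    have "\<delta> ?x [^] n = \<delta> (?x [^] n)"
      using group_hom.hom_nat_pow[OF twist_hom[OF assms(1)] x(1)] by simp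
    also have "\<dots> = \<one> \<longleftrightarrow> ?x [^] n = \<one>"
      using twist_inj[OF assms(1), of "?x [^] n" \<one>] assms x by simp
    finally show ?thesis using pow_eq_id[OF x(1)] by simp
  qed
  then have "ord (\<delta> ?x) = ord ?x" using ord_unique[OF x(2)] by blast
  then show ?thesis using assms by (simp add: coxeter_matrix_def twist_mult)
qed

lemma map_twist_in_lists [simp]: "\<lbrakk>\<delta> \<in> \<Omega>; xs \<in> lists S\<rbrakk> \<Longrightarrow> map \<delta> xs \<in> lists S"
  by (auto intro: map_in_lists)

lemma map_D_inv [simp]:
  assumes "\<delta> \<in> \<Omega>" "xs \<in> lists S"
  shows "map (inv\<^bsub>D\<^esub> \<delta>) (map \<delta> xs) = xs" and "map \<delta> (map (inv\<^bsub>D\<^esub> \<delta>) xs) = xs"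
  using assms(2) by (induction xs) (simp_all add: assms(1))

lemma map_D_one [simp]: "xs \<in> lists S \<Longrightarrow> map \<one>\<^bsub>D\<^esub> xs = xs"
  by (induction xs) simp_all

lemma map_D_mult:
  "\<lbrakk>\<delta> \<in> \<Omega>; \<epsilon> \<in> \<Omega>; xs \<in> lists S\<rbrakk> \<Longrightarrow> map (\<delta> \<otimes>\<^bsub>D\<^esub> \<epsilon>) xs = map \<delta> (map \<epsilon> xs)"
  by (induction xs) (simp_all add: D_mult_apply)

lemma twist_word_prod: "\<lbrakk>\<delta> \<in> \<Omega>; xs \<in> lists S\<rbrakk> \<Longrightarrow> word_prod G (map \<delta> xs) = \<delta> (word_prod G xs)"
  by (induction xs) (simp_all add: twist_mult word_prod_closed)

lemma twist_len [simp]: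
  assumes "\<delta> \<in> \<Omega>" "x \<in> carrier G"
  shows "len (\<delta> x) = len x"
proof -
  have le: "len (\<epsilon> y) \<le> len y" if \<epsilon>: "\<epsilon> \<in> \<Omega>" and y: "y \<in> carrier G" for \<epsilon> y
  proof -
    obtain ss where "ss \<in> lists S" "word_prod G ss = y" "length ss = len y"
      using ex_word_len[OF y] by blast
    then show ?thesis using len_le_length[of "map \<epsilon> ss"] \<epsilon> by (simp add: twist_word_prod)
  qed
  show ?thesis using le[OF assms] le[of "inv\<^bsub>D\<^esub> \<delta>" "\<delta> x"] assms by simp
qed

lemma map_twist_braid_eq:
  assumes "\<delta> \<in> \<Omega>" "xs \<approx> ys"
  shows "map \<delta> xs \<approx> map \<delta> ys"
proof (rule word_cong_map[OF assms(2)])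
  show "\<delta> s \<in> S" if "s \<in> S" for s using assms(1) that by simp
  fix l r
  assume "(l, r) \<in> braid_relations G S"
  then obtain s t where st: "s \<in> S" "t \<in> S" "s \<noteq> t" "l = alternating_word s t (m s t)"
    "r = alternating_word t s (m s t)"
    by (auto simp: braid_relations_def)
  then have "\<delta> s \<noteq> \<delta> t" "\<delta> s \<in> S" "\<delta> t \<in> S" using assms(1) twist_inj by auto
  moreover have "map \<delta> l = alternating_word (\<delta> s) (\<delta> t) (m (\<delta> s) (\<delta> t))"
    "map \<delta> r = alternating_word (\<delta> t) (\<delta> s) (m (\<delta> s) (\<delta> t))"
    using st assms(1) by (simp_all add: map_alternating_word twist_coxeter_matrix)
  ultimately show "(map \<delta> l, map \<delta> r) \<in> braid_relations G S"
    unfolding braid_relations_def by blast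
qed

lemma map_twist_cl:
  assumes "\<delta> \<in> \<Omega>" "xs \<in> lists S"
  shows "map \<delta> ` cl xs = cl (map \<delta> xs)"
proof (intro equalityI subsetI)
  fix ys
  assume "ys \<in> map \<delta> ` cl xs"
  then show "ys \<in> cl (map \<delta> xs)"
    using map_twist_braid_eq[OF assms(1)] by (auto simp: word_class_def)
next
  fix ys
  assume "ys \<in> cl (map \<delta> xs)"
  then have ys: "map \<delta> xs \<approx> ys" by (simp add: word_class_def)
  then have "ys \<in> lists S" using word_cong_in_lists by blast
  moreover have "map (inv\<^bsub>D\<^esub> \<delta>) ys \<in> cl xs"
    using map_twist_braid_eq[OF D_inv_closed[OF assms(1)] ys] map_D_inv(1)[OF assms]
    by (simp add: word_class_def)
  ultimately show "ys \<in> map \<delta> ` cl xs"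
    using map_D_inv(2)[OF assms(1), of ys] by (metis image_eqI)
qed

lemma map_twist_mult:
  assumes "\<delta> \<in> \<Omega>" "A \<in> carrier BM" "B \<in> carrier BM"
  shows "map \<delta> ` (A \<otimes>\<^bsub>BM\<^esub> B) = (map \<delta> ` A) \<otimes>\<^bsub>BM\<^esub> (map \<delta> ` B)"
proof -
  obtain as bs where "as \<in> lists S" "bs \<in> lists S" "A = cl as" "B = cl bs"
    using assms(2,3) by (auto simp: BM_simps)
  then show ?thesis using assms(1)
    by (simp add: BM_simps(3) map_twist_cl)
qed

lemma map_twist_closed [simp]:
  assumes "\<delta> \<in> \<Omega>" "A \<in> carrier BM"
  shows "map \<delta> ` A \<in> carrier BM"
proof -
  obtain as where "as \<in> lists S" "A = cl as" using assms(2) by (auto simp: BM_simps(1))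
  then show ?thesis using assms(1) by (simp add: map_twist_cl BM_simps(1))
qed

lemma T_monoid: "monoid T"
  unfolding twisted_braid_monoid_def
proof (rule semidirect_product_is_monoid[OF D_group BM_monoid])
  fix d
  assume d: "d \<in> carrier D"
  then show "image (map d) \<in> hom BM BM"
    by (intro homI) (simp_all add: map_twist_mult)
  show "map d ` \<one>\<^bsub>BM\<^esub> = \<one>\<^bsub>BM\<^esub>" using d by (simp add: BM_simps(2) map_twist_cl)
next
  fix A
  assume "A \<in> carrier BM"
  then obtain as where "as \<in> lists S" "A = cl as" by (auto simp: BM_simps(1))
  then show "map \<one>\<^bsub>D\<^esub> ` A = A" by (simp add: map_twist_cl)
next
  fix d e A
  assume de: "d \<in> carrier D" "e \<in> carrier D" and "A \<in> carrier BM"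
  then obtain as where "as \<in> lists S" "A = cl as" by (auto simp: BM_simps(1))
  then show "map d ` map e ` A = map (d \<otimes>\<^bsub>D\<^esub> e) ` A" 
    using de by (simp only: map_twist_cl map_D_mult D_carrier map_twist_in_lists D_mult_closed)
qed

sublocale T: monoid T by (rule T_monoid)

lemma T_carrier: "carrier T = \<Omega> \<times> carrier BM"
  by (simp add: twisted_braid_monoid_def semidirect_simps)

lemma T_one: "\<one>\<^bsub>T\<^esub> = (\<one>\<^bsub>D\<^esub>, \<one>\<^bsub>BM\<^esub>)"
  by (simp add: twisted_braid_monoid_def semidirect_simps)

lemma T_mult: "(\<delta>, A) \<otimes>\<^bsub>T\<^esub> (\<epsilon>, B) = (\<delta> \<otimes>\<^bsub>D\<^esub> \<epsilon>, (map (inv\<^bsub>D\<^esub> \<epsilon>) ` A) \<otimes>\<^bsub>BM\<^esub> B)"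
  by (simp add: twisted_braid_monoid_def semidirect_simps)

lemma T_cases:
  assumes "b \<in> carrier T"
  obtains \<delta> xs where "\<delta> \<in> \<Omega>" "xs \<in> lists S" "b = (\<delta>, cl xs)"
  using assms by (auto simp: T_carrier BM_simps(1))

lemma T_mult_cl:
  "\<lbrakk>\<epsilon> \<in> \<Omega>; xs \<in> lists S; ys \<in> lists S\<rbrakk>
    \<Longrightarrow> (\<delta>, cl xs) \<otimes>\<^bsub>T\<^esub> (\<epsilon>, cl ys) = (\<delta> \<otimes>\<^bsub>D\<^esub> \<epsilon>, cl (map (inv\<^bsub>D\<^esub> \<epsilon>) xs @ ys))"
  by (simp add: T_mult map_twist_cl BM_simps(3))

lemma T_mult_untwisted:
  assumes "\<delta> \<in> \<Omega>" "A \<in> carrier BM"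
  shows "(\<delta>, A) \<otimes>\<^bsub>T\<^esub> (\<one>\<^bsub>D\<^esub>, B) = (\<delta>, A \<otimes>\<^bsub>BM\<^esub> B)"
proof -
  obtain as where "as \<in> lists S" "A = cl as" using assms(2) by (auto simp: BM_simps(1))
  then show ?thesis using assms(1) by (simp add: T_mult map_twist_cl)
qed

lemma W_carrier: "carrier W = \<Omega> \<times> carrier G"
  by (simp add: twisted_group_def semidirect_simps)

lemma W_one: "\<one>\<^bsub>W\<^esub> = (\<one>\<^bsub>D\<^esub>, \<one>)"
  by (simp add: twisted_group_def semidirect_simps)

lemma W_mult: "(\<delta>, x) \<otimes>\<^bsub>W\<^esub> (\<epsilon>, y) = (\<delta> \<otimes>\<^bsub>D\<^esub> \<epsilon>, (inv\<^bsub>D\<^esub> \<epsilon>) x \<otimes> y)"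
  by (simp add: twisted_group_def semidirect_simps)

lemma untwisted_eq: "untwisted G = {\<one>\<^bsub>D\<^esub>} \<times> carrier G"
  by (simp add: untwisted_def D_one)

lemma W_mult_closed: "\<lbrakk>x \<in> carrier W; y \<in> carrier W\<rbrakk> \<Longrightarrow> x \<otimes>\<^bsub>W\<^esub> y \<in> carrier W"
  by (auto simp: W_carrier W_mult)

lemma braid_lift_eq: "braid_lift G S w = (fst w, lift (snd w))"
  by (simp add: braid_lift_def lift_def)

lemma braid_lift_closed [simp]: "w \<in> carrier W \<Longrightarrow> braid_lift G S w \<in> carrier T"
  by (auto simp: braid_lift_eq W_carrier T_carrier)

lemma untwisted_in_W: "v \<in> untwisted G \<Longrightarrow> v \<in> carrier W"
  by (auto simp: untwisted_eq W_carrier)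

lemma map_twist_lift:
  assumes "\<delta> \<in> \<Omega>" "x \<in> carrier G"
  shows "map \<delta> ` lift x = lift (\<delta> x)"
proof -
  obtain xs where xs: "reduced xs" "word_prod G xs = x" using ex_reduced[OF assms(2)] by blast
  then have "reduced (map \<delta> xs)" "word_prod G (map \<delta> xs) = \<delta> x"
    using assms by (simp_all add: reduced_def twist_word_prod)
  then show ?thesis
    using lift_word_prod[of "map \<delta> xs"] lift_word_prod[OF xs(1)] xs map_twist_cl[OF assms(1), of xs]
    by (simp add: reduced_def)
qed

section \<open>Twists acting on roots\<close>

lemma twist_act_linear:
  "twist_act S \<delta> (\<lambda>r. a * v r + b * w r) = (\<lambda>r. a * twist_act S \<delta> v r + b * twist_act S \<delta> w r)"
  unfolding twist_act_def
  by (rule ext) (simp add: sum_distrib_left sum.distrib[symmetric] algebra_simps)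

lemma twist_act_apply:
  assumes "\<delta> \<in> \<Omega>" "s \<in> S"
  shows "twist_act S \<delta> v (\<delta> s) = v s"
proof -
  have "twist_act S \<delta> v (\<delta> s) = (\<Sum>r\<in>S. if r = s then v r else 0)"
    unfolding twist_act_def simple_root_def using assms twist_inj[OF assms(1)]
    by (intro sum.cong HOL.refl) auto
  then show ?thesis using assms by simp
qed

lemma twist_act_outside: "\<lbrakk>\<delta> \<in> \<Omega>; t \<notin> S\<rbrakk> \<Longrightarrow> twist_act S \<delta> v t = 0"
  unfolding twist_act_def simple_root_def by (intro sum.neutral) auto

lemma twist_act_eqI:
  assumes "\<delta> \<in> \<Omega>" "\<And>s. s \<in> S \<Longrightarrow> f (\<delta> s) = v s" "\<And>t. t \<notin> S \<Longrightarrow> f t = 0"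
  shows "twist_act S \<delta> v = f"
proof
  fix t
  show "twist_act S \<delta> v t = f t"
  proof (cases "t \<in> S")
    case True
    then obtain s where "s \<in> S" "t = \<delta> s" using twists_permute[OF assms(1)] by blast
    then show ?thesis using twist_act_apply assms by simp
  next
    case False
    then show ?thesis using twist_act_outside assms by simp
  qed
qed

lemma twist_act_simple: "\<lbrakk>\<delta> \<in> \<Omega>; s \<in> S\<rbrakk> \<Longrightarrow> twist_act S \<delta> (\<alpha> s) = \<alpha> (\<delta> s)"
  by (rule twist_act_eqI) (auto simp: simple_root_def twist_inj)

lemma twist_act_mult:
  assumes "\<delta> \<in> \<Omega>" "\<epsilon> \<in> \<Omega>"
  shows "twist_act S (\<delta> \<otimes>\<^bsub>D\<^esub> \<epsilon>) v = twist_act S \<delta> (twist_act S \<epsilon> v)"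
  using assms by (intro twist_act_eqI) (simp_all add: D_mult_apply twist_act_apply twist_act_outside)

lemma twist_act_one: "\<beta> \<in> R \<Longrightarrow> twist_act S \<one>\<^bsub>D\<^esub> \<beta> = \<beta>"
  by (intro twist_act_eqI) (simp_all add: root_vanishes)

lemma form_twist_act:
  assumes "\<delta> \<in> \<Omega>"
  shows "form (twist_act S \<delta> u) (twist_act S \<delta> v) = form u v"
proof -
  have bij: "bij_betw \<delta> S S"
    using twists_permute[OF assms] twist_inj[OF assms] by (auto simp: bij_betw_def inj_on_def)
  have "form (twist_act S \<delta> u) (twist_act S \<delta> v)
      = (\<Sum>s\<in>S. \<Sum>t\<in>S. twist_act S \<delta> u (\<delta> s) * twist_act S \<delta> v (\<delta> t) * - cos (pi / m (\<delta> s) (\<delta> t)))"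
    unfolding coxeter_form_def
    by (subst sum.reindex_bij_betw[OF bij, symmetric], subst sum.reindex_bij_betw[OF bij, symmetric]) simp
  also have "\<dots> = form u v"
    unfolding coxeter_form_def using assms
    by (intro sum.cong HOL.refl) (simp add: twist_act_apply twist_coxeter_matrix)
  finally show ?thesis .
qed

lemma twist_act_reflect:
  "\<lbrakk>\<delta> \<in> \<Omega>; s \<in> S\<rbrakk> \<Longrightarrow> twist_act S \<delta> (\<rho> s v) = \<rho> (\<delta> s) (twist_act S \<delta> v)"
  unfolding reflect_eq twist_act_linear
  using form_twist_act[of \<delta> "\<alpha> s" v] by (simp add: twist_act_simple)

lemma twist_act_word_act:
  "\<lbrakk>\<delta> \<in> \<Omega>; ss \<in> lists S\<rbrakk> \<Longrightarrow> twist_act S \<delta> (word_act ss v) = word_act (map \<delta> ss) (twist_act S \<delta> v)"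
  by (induction ss) (simp_all add: twist_act_reflect)

lemma twist_act_act:
  assumes "\<delta> \<in> \<Omega>" "x \<in> carrier G"
  shows "twist_act S \<delta> (act x v) = act (\<delta> x) (twist_act S \<delta> v)"
proof -
  obtain ss where ss: "ss \<in> lists S" "word_prod G ss = x" using ex_word[OF assms(2)] by blast
  then have "\<delta> x = word_prod G (map \<delta> ss)" using assms(1) twist_word_prod by simp
  then show ?thesis
    using act_word_prod[OF ss(1)] act_word_prod[of "map \<delta> ss"] ss assms(1) twist_act_word_act by simp
qed

lemma twist_act_roots [simp]: "\<lbrakk>\<delta> \<in> \<Omega>; \<beta> \<in> R\<rbrakk> \<Longrightarrow> twist_act S \<delta> \<beta> \<in> R"
  by (elim roots_cases) (auto simp: twist_act_act twist_act_simple)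

lemma twist_act_neg_iff:
  assumes "\<delta> \<in> \<Omega>" "\<beta> \<in> R"
  shows "twist_act S \<delta> \<beta> \<in> Rneg \<longleftrightarrow> \<beta> \<in> Rneg"
proof -
  have "(\<forall>r\<in>\<delta> ` S. twist_act S \<delta> \<beta> r \<le> 0) \<longleftrightarrow> (\<forall>s\<in>S. \<beta> s \<le> 0)"
    by (simp add: twist_act_apply[OF assms(1)])
  then show ?thesis using assms by (simp add: neg_roots_def twists_permute)
qed

abbreviation ta :: "('g \<Rightarrow> 'g) \<times> 'g \<Rightarrow> ('g \<Rightarrow> real) \<Rightarrow> ('g \<Rightarrow> real)" where
  "ta \<equiv> twisted_act G S"

lemma ta_roots [simp]: "\<lbrakk>x \<in> carrier W; \<beta> \<in> R\<rbrakk> \<Longrightarrow> ta x \<beta> \<in> R"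
  by (auto simp: twisted_act_def W_carrier)

lemma ta_mult:
  assumes "x \<in> carrier W" "y \<in> carrier W" "\<beta> \<in> R"
  shows "ta (x \<otimes>\<^bsub>W\<^esub> y) \<beta> = ta x (ta y \<beta>)"
proof -
  obtain d u e v where "x = (d, u)" "y = (e, v)" "d \<in> \<Omega>" "e \<in> \<Omega>" "u \<in> carrier G" "v \<in> carrier G"
    using assms by (auto simp: W_carrier)
  then show ?thesis
    by (simp add: twisted_act_def W_mult act_mult twist_act_mult twist_act_act D_mult_apply)
qed

lemma ta_one: "\<beta> \<in> R \<Longrightarrow> ta \<one>\<^bsub>W\<^esub> \<beta> = \<beta>"
  by (simp add: twisted_act_def W_one twist_act_one)

lemma ta_uminus: "x \<in> carrier W \<Longrightarrow> ta x (\<lambda>r. - \<beta> r) = (\<lambda>r. - ta x \<beta> r)"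
  using twist_act_linear[of "fst x" "-1" "act (snd x) \<beta>" 0 "\<lambda>_. 0"]
  by (auto simp: twisted_act_def W_carrier act_uminus)

lemma inversions_eq: "w \<in> carrier W \<Longrightarrow> inversions G S w = Inv (snd w)"
  using pos_roots_subset by (auto simp: inversions_def Inv_def twisted_act_def W_carrier twist_act_neg_iff)

lemma coxeter_length_eq: "w \<in> carrier W \<Longrightarrow> coxeter_length G S w = len (snd w)"
  by (auto simp: coxeter_length_def inversions_eq W_carrier card_Inv)

section \<open>Deligne--Garside factors of twisted braids\<close>

lemma lift_suffix_iff:
  assumes "u \<in> carrier G" "v \<in> carrier G"
  shows "(\<exists>C\<in>carrier BM. lift v = C \<otimes>\<^bsub>BM\<^esub> lift u) \<longleftrightarrow> suffix u v"
proof
  assume "\<exists>C\<in>carrier BM. lift v = C \<otimes>\<^bsub>BM\<^esub> lift u"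
  then obtain C where C: "C \<in> carrier BM" "lift v = C \<otimes>\<^bsub>BM\<^esub> lift u" by blast
  obtain vs where vs: "reduced vs" "word_prod G vs = v" using ex_reduced[OF assms(2)] by blast
  then show "suffix u v"
    using suffix_head[OF _ C(1) assms(1), of vs] C(2) lift_word_prod[OF vs(1)] garside_reduced[OF vs(1)]
    by (simp add: reduced_def)
next
  assume "suffix u v"
  then show "\<exists>C\<in>carrier BM. lift v = C \<otimes>\<^bsub>BM\<^esub> lift u"
    using lift_suffix assms by (intro bexI[of _ "lift (v \<otimes> inv u)"]) auto
qed

lemma right_divides_iff:
  assumes "\<delta> \<in> \<Omega>" "u \<in> untwisted G"
  shows "right_divides T (braid_lift G S u) (\<delta>, B) \<longleftrightarrow> (\<exists>C\<in>carrier BM. B = C \<otimes>\<^bsub>BM\<^esub> lift (snd u))"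
proof -
  have u: "braid_lift G S u = (\<one>\<^bsub>D\<^esub>, lift (snd u))" using assms(2) by (auto simp: untwisted_eq braid_lift_eq)
  show ?thesis
    unfolding right_divides_def u using assms(1)
    by (fastforce simp: T_carrier T_mult_untwisted)
qed

lemma DG_head_eq:
  assumes "\<delta> \<in> \<Omega>" "xs \<in> lists S"
  shows "DG_head G S \<Omega> (\<delta>, cl xs) = (\<one>\<^bsub>D\<^esub>, head xs)"
  unfolding DG_head_def
proof (rule the_equality)
  have h: "head xs \<in> carrier G" "snd (garside xs) \<in> carrier BM" using garside_closed assms(2) by auto
  have div_lift: "right_divides T (braid_lift G S u) (braid_lift G S v) \<longleftrightarrow> suffix (snd u) (snd v)"
    if u: "u \<in> untwisted G" and v: "v \<in> untwisted G" for u v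
  proof -
    have "braid_lift G S v = (\<one>\<^bsub>D\<^esub>, lift (snd v))" "snd u \<in> carrier G" "snd v \<in> carrier G"
      using u v by (auto simp: untwisted_eq braid_lift_eq)
    then show ?thesis
      using right_divides_iff[OF D_one_closed u, of "lift (snd v)"] lift_suffix_iff[of "snd u" "snd v"]
      by simp
  qed
  have div: "right_divides T (braid_lift G S u) (\<delta>, cl xs) \<longleftrightarrow> suffix (snd u) (head xs)"
    if "u \<in> untwisted G" for u
  proof -
    have u: "snd u \<in> carrier G" using that by (auto simp: untwisted_eq)
    have "(\<exists>C\<in>carrier BM. cl xs = C \<otimes>\<^bsub>BM\<^esub> lift (snd u)) \<longleftrightarrow> suffix (snd u) (head xs)"
    proof
      assume "\<exists>C\<in>carrier BM. cl xs = C \<otimes>\<^bsub>BM\<^esub> lift (snd u)"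
      then show "suffix (snd u) (head xs)" using suffix_head[OF assms(2) _ u] by blast
    next
      assume "suffix (snd u) (head xs)"
      then obtain C where C: "C \<in> carrier BM" "lift (head xs) = C \<otimes>\<^bsub>BM\<^esub> lift (snd u)"
        using lift_suffix_iff[OF u h(1)] by blast
      have "cl xs = snd (garside xs) \<otimes>\<^bsub>BM\<^esub> (C \<otimes>\<^bsub>BM\<^esub> lift (snd u))"
        using garside_factorization[OF assms(2)] unfolding C(2) by (rule HOL.sym)
      also have "\<dots> = (snd (garside xs) \<otimes>\<^bsub>BM\<^esub> C) \<otimes>\<^bsub>BM\<^esub> lift (snd u)"
        using h(2) C(1) u by (simp add: BM.m_assoc)
      finally show "\<exists>C\<in>carrier BM. cl xs = C \<otimes>\<^bsub>BM\<^esub> lift (snd u)"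
        using h(2) C(1) by (intro bexI[of _ "snd (garside xs) \<otimes>\<^bsub>BM\<^esub> C"]) auto
    qed
    then show ?thesis using right_divides_iff[OF assms(1) that] by simp
  qed
  let ?v = "(\<one>\<^bsub>D\<^esub>, head xs)"
  have v: "?v \<in> untwisted G" using h by (simp add: untwisted_eq)
  show "?v \<in> untwisted G \<and> right_divides T (braid_lift G S ?v) (\<delta>, cl xs) \<and>
      (\<forall>u\<in>untwisted G. right_divides T (braid_lift G S u) (\<delta>, cl xs) \<longrightarrow>
        right_divides T (braid_lift G S u) (braid_lift G S ?v))"
    using v div div_lift suffix_refl[OF h(1)] by simp
  fix v
  assume *: "v \<in> untwisted G \<and> right_divides T (braid_lift G S v) (\<delta>, cl xs) \<and>
      (\<forall>u\<in>untwisted G. right_divides T (braid_lift G S u) (\<delta>, cl xs) \<longrightarrow>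
        right_divides T (braid_lift G S u) (braid_lift G S v))"
  then have "suffix (snd v) (head xs)" using div by blast
  moreover have "suffix (head xs) (snd v)"
    using * v div[OF v] div_lift[OF v, of v] suffix_refl[OF h(1)] by force
  ultimately have "snd v = head xs" by (rule suffix_antisym)
  then show "v = ?v" using * by (auto simp: untwisted_eq)
qed

lemma T_right_cancel:
  assumes "c \<in> carrier T" "c' \<in> carrier T" "v \<in> untwisted G"
    and "c \<otimes>\<^bsub>T\<^esub> braid_lift G S v = c' \<otimes>\<^bsub>T\<^esub> braid_lift G S v"
  shows "c = c'"
proof -
  obtain d C d' C' where c: "c = (d, C)" "c' = (d', C')" "d \<in> \<Omega>" "d' \<in> \<Omega>" "C \<in> carrier BM" "C' \<in> carrier BM"
    using assms(1,2) by (auto simp: T_carrier)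
  moreover obtain x where x: "v = (\<one>\<^bsub>D\<^esub>, x)" "x \<in> carrier G" using assms(3) by (auto simp: untwisted_eq)
  ultimately show ?thesis
    using assms(4) BM_right_cancel[of C C' "lift x"] by (simp add: braid_lift_eq T_mult_untwisted)
qed

lemma DG_head_untwisted: "b \<in> carrier T \<Longrightarrow> DG_head G S \<Omega> b \<in> untwisted G"
  by (elim T_cases) (simp add: DG_head_eq untwisted_eq garside_closed)

lemma DG_rest_props:
  assumes "b \<in> carrier T"
  shows "DG_rest G S \<Omega> b \<in> carrier T" (is ?A)
    and "DG_rest G S \<Omega> b \<otimes>\<^bsub>T\<^esub> braid_lift G S (DG_head G S \<Omega> b) = b" (is ?B)
proof -
  obtain \<delta> xs where b: "\<delta> \<in> \<Omega>" "xs \<in> lists S" "b = (\<delta>, cl xs)" using assms by (rule T_cases)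
  let ?P = "\<lambda>c. c \<in> carrier T \<and> b = c \<otimes>\<^bsub>T\<^esub> braid_lift G S (DG_head G S \<Omega> b)"
  have "?P (\<delta>, snd (garside xs))"
    using b garside_closed[OF b(2)] garside_factorization[OF b(2)]
    by (simp add: DG_head_eq braid_lift_eq T_mult_untwisted T_carrier)
  moreover have "c = c'" if "?P c" "?P c'" for c c'
    using that T_right_cancel[OF _ _ DG_head_untwisted[OF assms], of c c'] by simp
  ultimately have "\<exists>!c. ?P c" by blast
  then have "?P (DG_rest G S \<Omega> b)" unfolding DG_rest_def by (rule theI')
  then show ?A ?B by simp_all
qed

lemma DG_rest_unique:
  assumes "b \<in> carrier T" "c \<in> carrier T" "c \<otimes>\<^bsub>T\<^esub> braid_lift G S (DG_head G S \<Omega> b) = b"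
  shows "DG_rest G S \<Omega> b = c"
  using T_right_cancel[OF DG_rest_props(1)[OF assms(1)] assms(2) DG_head_untwisted[OF assms(1)]]
    DG_rest_props(2)[OF assms(1)] assms(3) by simp

lemma divisor_suffix_DG_head:
  assumes "c \<in> carrier T" "v \<in> carrier G" "b = c \<otimes>\<^bsub>T\<^esub> (\<one>\<^bsub>D\<^esub>, lift v)"
  shows "suffix v (snd (DG_head G S \<Omega> b))"
proof -
  obtain \<delta> cs where c: "\<delta> \<in> \<Omega>" "cs \<in> lists S" "c = (\<delta>, cl cs)" using assms(1) by (rule T_cases)
  have C: "cl cs \<in> carrier BM" using c by (simp add: BM_simps(1))
  then have "cl cs \<otimes>\<^bsub>BM\<^esub> lift v \<in> carrier BM" using assms(2) by simp
  then obtain xs where xs: "xs \<in> lists S" "cl xs = cl cs \<otimes>\<^bsub>BM\<^esub> lift v" by (auto simp: BM_simps(1))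
  then have "b = (\<delta>, cl xs)" using assms c C by (simp add: T_mult_untwisted)
  then show ?thesis
    using suffix_head[OF xs(1) C assms(2) xs(2)] DG_head_eq[OF c(1) xs(1)] by (simp only: snd_conv)
qed

text \<open>A twist carries divisors to divisors, so the twisted head is a suffix of the head of the
  twisted word. The same holds for the inverse twist, and twists preserve lengths.\<close>

lemma head_map_twist:
  assumes "\<delta> \<in> \<Omega>" "xs \<in> lists S"
  shows "head (map \<delta> xs) = \<delta> (head xs)"
proof -
  have suff: "suffix (\<epsilon> (head ys)) (head (map \<epsilon> ys))" if \<epsilon>: "\<epsilon> \<in> \<Omega>" and ys: "ys \<in> lists S" for \<epsilon> ys
  proof -
    note h = garside_closed[OF ys]
    have "cl (map \<epsilon> ys) = map \<epsilon> ` (snd (garside ys) \<otimes>\<^bsub>BM\<^esub> lift (head ys))"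
      using garside_factorization[OF ys] \<epsilon> ys by (simp add: map_twist_cl)
    also have "\<dots> = (map \<epsilon> ` snd (garside ys)) \<otimes>\<^bsub>BM\<^esub> lift (\<epsilon> (head ys))"
      using h \<epsilon> by (simp add: map_twist_mult map_twist_lift)
    finally show ?thesis
      by (rule suffix_head[rotated 3]) (use \<epsilon> ys h in auto)
  qed
  note h = garside_closed(1)[OF assms(2)] garside_closed(1)[OF map_twist_in_lists[OF assms]]
  have "len (head (map \<delta> xs)) \<le> len (head xs)"
    using suffix_len_le[OF suff[of "inv\<^bsub>D\<^esub> \<delta>" "map \<delta> xs"]] map_D_inv(1)[OF assms] assms h by simp
  then show ?thesis using suffix_len_eq[OF suff[OF assms]] assms h by simp
qed

lemma DG_head_mult_cong:
  assumes "x \<in> carrier T" "x' \<in> carrier T" "y \<in> carrier T"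
    and eq: "DG_head G S \<Omega> x = DG_head G S \<Omega> x'"
  shows "DG_head G S \<Omega> (x \<otimes>\<^bsub>T\<^esub> y) = DG_head G S \<Omega> (x' \<otimes>\<^bsub>T\<^esub> y)"
proof -
  obtain d xs where x: "d \<in> \<Omega>" "xs \<in> lists S" "x = (d, cl xs)" using assms(1) by (rule T_cases)
  obtain d' xs' where x': "d' \<in> \<Omega>" "xs' \<in> lists S" "x' = (d', cl xs')" using assms(2) by (rule T_cases)
  obtain e ys where y: "e \<in> \<Omega>" "ys \<in> lists S" "y = (e, cl ys)" using assms(3) by (rule T_cases)
  have "head xs = head xs'" using eq x x' by (simp add: DG_head_eq)
  then have "head (map (inv\<^bsub>D\<^esub> e) xs) = head (map (inv\<^bsub>D\<^esub> e) xs')"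
    using x(2) x'(2) y(1) by (simp add: head_map_twist)
  from head_append_cong[OF this, of ys] show ?thesis
    using x x' y by (simp add: T_mult_cl DG_head_eq)
qed

lemma DG_head_braid_lift: "v \<in> untwisted G \<Longrightarrow> DG_head G S \<Omega> (braid_lift G S v) = v"
proof -
  assume v: "v \<in> untwisted G"
  then have "snd v \<in> carrier G" by (auto simp: untwisted_eq)
  then obtain vs where vs: "reduced vs" "word_prod G vs = snd v" using ex_reduced by blast
  then have "DG_head G S \<Omega> (\<one>\<^bsub>D\<^esub>, cl vs) = (\<one>\<^bsub>D\<^esub>, snd v)"
    using DG_head_eq[OF D_one_closed, of vs] garside_reduced[OF vs(1)] by (simp add: reduced_def)
  then show ?thesis
    using lift_word_prod[OF vs(1)] vs(2) v by (auto simp: braid_lift_eq untwisted_eq)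
qed

text \<open>Move the twist of \<open>w\<close> to the left, so that \<open>z\<close> becomes \<open>y\<close> and \<open>w\<close> becomes \<open>x\<close> in the
  untwisted group. The head of \<open>y x\<close> is \<open>u x\<close> for a suffix \<open>u\<close> of \<open>y\<close>, so what remains on the
  left is the reduced braid of \<open>y u\<^sup>-\<^sup>1\<close>. If \<open>u x = z\<close>, comparing lengths shows that \<open>y u\<^sup>-\<^sup>1\<close>
  is as long as \<open>x\<close>.\<close>

lemma slide_through_head:
  assumes z: "z \<in> untwisted G" and w: "w \<in> carrier W"
    and head: "DG_head G S \<Omega> (braid_lift G S z \<otimes>\<^bsub>T\<^esub> braid_lift G S w) = z"
  shows "\<exists>w'\<in>carrier W. braid_lift G S z \<otimes>\<^bsub>T\<^esub> braid_lift G S w = braid_lift G S w' \<otimes>\<^bsub>T\<^esub> braid_lift G S z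
    \<and> coxeter_length G S w' = coxeter_length G S w"
proof -
  obtain zz where zz: "z = (\<one>\<^bsub>D\<^esub>, zz)" "zz \<in> carrier G" using z by (auto simp: untwisted_eq)
  obtain \<delta> x where wx: "w = (\<delta>, x)" "\<delta> \<in> \<Omega>" "x \<in> carrier G" using w by (auto simp: W_carrier)
  define y where "y = (inv\<^bsub>D\<^esub> \<delta>) zz"
  have y: "y \<in> carrier G" "len y = len zz" using zz wx by (simp_all add: y_def)
  obtain ys xs where ys: "reduced ys" "word_prod G ys = y" and xs: "reduced xs" "word_prod G xs = x"
    using ex_reduced y(1) wx(3) by meson
  have yx: "ys \<in> lists S" "xs \<in> lists S" using ys xs by (simp_all add: reduced_def)
  have prod: "braid_lift G S z \<otimes>\<^bsub>T\<^esub> braid_lift G S w = (\<delta>, lift y \<otimes>\<^bsub>BM\<^esub> lift x)"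
    using zz wx by (simp add: braid_lift_eq T_mult map_twist_lift y_def)
  also have "lift y \<otimes>\<^bsub>BM\<^esub> lift x = cl (ys @ xs)"
    using lift_word_prod[OF ys(1)] lift_word_prod[OF xs(1)] ys xs yx by (simp add: BM_simps(3))
  finally have "(\<one>\<^bsub>D\<^esub>, head (ys @ xs)) = z"
    using head DG_head_eq[OF wx(2), of "ys @ xs"] yx by simp
  moreover define u where "u = cut y x"
  ultimately have ux: "u \<otimes> x = zz"
    using head_append_reduced[OF yx(1) xs(1)] garside_reduced[OF ys(1)] ys(2) xs(2) zz by simp
  note u = cut_facts[OF y(1) wx(3), folded u_def]
  let ?w' = "(\<delta>, y \<otimes> inv u)"
  have c: "y \<otimes> inv u \<in> carrier G" using y u by simp
  have "lift y \<otimes>\<^bsub>BM\<^esub> lift x = lift (y \<otimes> inv u) \<otimes>\<^bsub>BM\<^esub> lift zz"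
    using lift_suffix[OF u(1)] lift_mult[OF u(3) wx(3) u(2)] ux c u(3) wx(3) by (simp add: BM.m_assoc)
  then have "braid_lift G S z \<otimes>\<^bsub>T\<^esub> braid_lift G S w = braid_lift G S ?w' \<otimes>\<^bsub>T\<^esub> braid_lift G S z"
    using c zz wx prod by (simp add: braid_lift_eq T_mult_untwisted)
  moreover have "len (y \<otimes> inv u) = len x"
  proof -
    have "len y = len (y \<otimes> inv u) + len u" using u(1) y(1) u(3) by (simp add: suffix_def additive_def m_assoc)
    moreover have "len zz = len u + len x" using u(2) ux by (simp add: additive_def)
    ultimately show ?thesis using y(2) by simp
  qed
  ultimately show ?thesis
    using c wx w by (intro bexI[of _ ?w']) (simp_all add: coxeter_length_eq W_carrier)
qed

section \<open>Inversion sets of twisted braids\<close>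

abbreviation binv :: "('g \<Rightarrow> 'g) \<times> 'g list set \<Rightarrow> ('g \<Rightarrow> real) set" where
  "binv \<equiv> braid_inversions G S"

lemma binv_cl: "xs \<in> lists S \<Longrightarrow> binv (\<delta>, cl xs) = word_inversions G S xs"
  unfolding braid_inversions_def
  using some_in_word_class[of xs S "braid_relations G S"] word_inversions_braid_eq by simp

lemma word_inversions_roots: "ss \<in> lists S \<Longrightarrow> word_inversions G S ss \<subseteq> R"
  by (induction ss rule: rev_induct)
    (auto simp: word_inversions_snoc act_simple[symmetric] dest!: subsetD)

lemma binv_roots: "b \<in> carrier T \<Longrightarrow> binv b \<subseteq> R"
  by (elim T_cases) (use word_inversions_roots binv_cl in simp)

lemma binv_lift:
  assumes "w \<in> carrier W"
  shows "binv (braid_lift G S w) = inversions G S w"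
proof -
  obtain ss where ss: "reduced ss" "word_prod G ss = snd w"
    using ex_reduced assms by (force simp: W_carrier)
  then have "binv (fst w, cl ss) = Inv (snd w)"
    using word_inversions_reduced[OF ss(1)] binv_cl[of ss] by (simp add: reduced_def)
  then show ?thesis using lift_word_prod[OF ss(1)] ss(2) inversions_eq[OF assms] by (simp add: braid_lift_eq)
qed

text \<open>The homomorphism from the twisted braid monoid to the twisted group. Equivalent words
  have the same product, so any word of the class may be chosen.\<close>

definition braid_image :: "('g \<Rightarrow> 'g) \<times> 'g list set \<Rightarrow> ('g \<Rightarrow> 'g) \<times> 'g" where
  "braid_image b = (fst b, word_prod G (SOME ss. ss \<in> snd b))"

lemma braid_image_cl: "xs \<in> lists S \<Longrightarrow> braid_image (\<delta>, cl xs) = (\<delta>, word_prod G xs)"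
  unfolding braid_image_def
  using some_in_word_class[of xs S "braid_relations G S"] word_prod_braid_eq by simp

lemma braid_image_mult:
  assumes "b \<in> carrier T" "c \<in> carrier T"
  shows "braid_image (b \<otimes>\<^bsub>T\<^esub> c) = braid_image b \<otimes>\<^bsub>W\<^esub> braid_image c"
proof -
  obtain d xs e ys where "d \<in> \<Omega>" "xs \<in> lists S" "b = (d, cl xs)" "e \<in> \<Omega>" "ys \<in> lists S" "c = (e, cl ys)"
    using T_cases[OF assms(1)] T_cases[OF assms(2)] by metis
  then show ?thesis
    by (simp add: T_mult_cl braid_image_cl W_mult word_prod_append twist_word_prod)
qed

lemma braid_image_one: "braid_image \<one>\<^bsub>T\<^esub> = \<one>\<^bsub>W\<^esub>"
  using braid_image_cl[of "[]"] by (simp add: T_one W_one BM_simps(2))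

lemma braid_image_lift:
  assumes "w \<in> carrier W"
  shows "braid_image (braid_lift G S w) = w"
proof -
  obtain ss where ss: "reduced ss" "word_prod G ss = snd w"
    using ex_reduced assms by (force simp: W_carrier)
  then have "braid_image (fst w, cl ss) = w" by (simp add: braid_image_cl reduced_def)
  then show ?thesis using lift_word_prod[OF ss(1)] ss(2) by (simp add: braid_lift_eq)
qed

lemma word_inversions_map_twist:
  "\<lbrakk>\<delta> \<in> \<Omega>; xs \<in> lists S\<rbrakk>
    \<Longrightarrow> word_inversions G S (map \<delta> xs) = twist_act S \<delta> ` word_inversions G S xs"
  by (induction xs rule: rev_induct)
    (simp_all add: word_inversions_snoc twist_act_simple image_image twist_act_reflect)

lemma twist_act_D_inv:
  assumes "\<delta> \<in> \<Omega>" "\<beta> \<in> R"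
  shows "twist_act S \<delta> (twist_act S (inv\<^bsub>D\<^esub> \<delta>) \<beta>) = \<beta>"
    and "twist_act S (inv\<^bsub>D\<^esub> \<delta>) (twist_act S \<delta> \<beta>) = \<beta>"
  using assms twist_act_mult[of \<delta> "inv\<^bsub>D\<^esub> \<delta>" \<beta>] twist_act_mult[of "inv\<^bsub>D\<^esub> \<delta>" \<delta> \<beta>]
  by (simp_all add: twist_act_one)

lemma binv_mult:
  assumes "b \<in> carrier T" "c \<in> carrier T"
  shows "binv (b \<otimes>\<^bsub>T\<^esub> c) = binv c \<union> {\<beta> \<in> R. ta (braid_image c) \<beta> \<in> binv b}"
proof -
  obtain d xs where b: "d \<in> \<Omega>" "xs \<in> lists S" "b = (d, cl xs)" using assms(1) by (rule T_cases)
  obtain e ys where c: "e \<in> \<Omega>" "ys \<in> lists S" "c = (e, cl ys)" using assms(2) by (rule T_cases)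
  let ?y = "word_prod G ys"
  have y: "?y \<in> carrier G" using c(2) by (rule word_prod_closed)
  have binv_b: "binv b = word_inversions G S xs" using b by (simp add: binv_cl)
  note WI = word_inversions_roots[OF b(2)]
  have rev: "word_act (rev ys) = act (inv ?y)" using act_word_prod[of "rev ys"] c(2) by (simp add: word_prod_rev)
  have "binv (b \<otimes>\<^bsub>T\<^esub> c)
      = binv c \<union> act (inv ?y) ` twist_act S (inv\<^bsub>D\<^esub> e) ` word_inversions G S xs"
    using b c by (simp add: T_mult_cl binv_cl word_inversions_append word_inversions_map_twist rev)
  also have "act (inv ?y) ` twist_act S (inv\<^bsub>D\<^esub> e) ` word_inversions G S xs
      = {\<beta> \<in> R. ta (braid_image c) \<beta> \<in> binv b}"
  proof (intro equalityI subsetI)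
    fix \<beta>
    assume "\<beta> \<in> act (inv ?y) ` twist_act S (inv\<^bsub>D\<^esub> e) ` word_inversions G S xs"
    then obtain \<gamma> where g: "\<gamma> \<in> word_inversions G S xs" "\<beta> = act (inv ?y) (twist_act S (inv\<^bsub>D\<^esub> e) \<gamma>)"
      by blast
    then have "\<gamma> \<in> R" using WI by blast
    then have "\<beta> \<in> R" "ta (braid_image c) \<beta> = \<gamma>"
      using g(2) c y by (simp_all add: twisted_act_def braid_image_cl twist_act_D_inv)
    then show "\<beta> \<in> {\<beta> \<in> R. ta (braid_image c) \<beta> \<in> binv b}" using g(1) binv_b by simp
  next
    fix \<beta>
    assume "\<beta> \<in> {\<beta> \<in> R. ta (braid_image c) \<beta> \<in> binv b}"
    then have "\<beta> \<in> R" "ta (braid_image c) \<beta> \<in> word_inversions G S xs" using binv_b by auto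
    moreover from this have "\<beta> = act (inv ?y) (twist_act S (inv\<^bsub>D\<^esub> e) (ta (braid_image c) \<beta>))"
      using c y by (simp add: twisted_act_def braid_image_cl twist_act_D_inv)
    ultimately show "\<beta> \<in> act (inv ?y) ` twist_act S (inv\<^bsub>D\<^esub> e) ` word_inversions G S xs" by blast
  qed
  finally show ?thesis .
qed

section \<open>Powers of a reduced braid\<close>

abbreviation pow_braid :: "('g \<Rightarrow> 'g) \<times> 'g \<Rightarrow> nat \<Rightarrow> ('g \<Rightarrow> 'g) \<times> 'g list set" where
  "pow_braid \<equiv> braid_power G S \<Omega>"

lemma pow_braid_closed [simp]: "w \<in> carrier W \<Longrightarrow> pow_braid w d \<in> carrier T"
  by (simp add: braid_power_def)

lemma pow_braid_Suc:
  assumes "w \<in> carrier W"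
  shows "pow_braid w (Suc d) = pow_braid w d \<otimes>\<^bsub>T\<^esub> braid_lift G S w"
    and "pow_braid w (Suc d) = braid_lift G S w \<otimes>\<^bsub>T\<^esub> pow_braid w d"
  using assms T.nat_pow_Suc2[OF braid_lift_closed[OF assms], of d] by (simp_all add: braid_power_def)

lemma stable_roots_subset: "stable_roots G S \<Omega> w \<subseteq> R"
  by (auto simp: stable_roots_def)

lemma generate_closed:
  assumes "w \<in> carrier W" "x \<in> generate W {w}"
  shows "x \<otimes>\<^bsub>W\<^esub> w \<in> generate W {w}" and "w \<otimes>\<^bsub>W\<^esub> x \<in> generate W {w}"
  using assms(2) generate.incl[of w "{w}" W] generate.eng by auto

lemma pow_braid_inversion:
  assumes w: "w \<in> carrier W"
  shows "\<beta> \<in> binv (pow_braid w d)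
    \<Longrightarrow> \<exists>x \<in> generate W {w} \<inter> carrier W. ta x \<beta> \<in> inversions G S w"
proof (induction d arbitrary: \<beta>)
  case 0
  then show ?case using binv_cl[of "[]"] by (simp add: braid_power_def T_one BM_simps(2))
next
  case (Suc d)
  let ?b = "braid_lift G S w"
  have "\<beta> \<in> binv ?b \<or> \<beta> \<in> R \<and> ta w \<beta> \<in> binv (pow_braid w d)"
    using Suc.prems binv_mult[of "pow_braid w d" ?b] w
    by (simp add: pow_braid_Suc(1) braid_image_lift)
  then show ?case
  proof
    assume "\<beta> \<in> binv ?b"
    then have \<beta>: "\<beta> \<in> inversions G S w" using binv_lift w by simp
    then have "\<beta> \<in> R" using pos_roots_subset by (auto simp: inversions_def)
    then have "ta \<one>\<^bsub>W\<^esub> \<beta> \<in> inversions G S w" using \<beta> by (simp add: ta_one)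
    then show ?thesis using generate.one[of W "{w}"] by (intro bexI[of _ "\<one>\<^bsub>W\<^esub>"]) (auto simp: W_carrier W_one)
  next
    assume *: "\<beta> \<in> R \<and> ta w \<beta> \<in> binv (pow_braid w d)"
    then obtain x where x: "x \<in> generate W {w}" "x \<in> carrier W" "ta x (ta w \<beta>) \<in> inversions G S w"
      using Suc.IH[of "ta w \<beta>"] by blast
    then have "ta (x \<otimes>\<^bsub>W\<^esub> w) \<beta> \<in> inversions G S w" using * w by (simp add: ta_mult)
    then show ?thesis
      using generate_closed(1)[OF w x(1)] W_mult_closed[OF x(2) w] by blast
  qed
qed

theorem pow_braid_inversions_unstable:
  assumes w: "w \<in> carrier W"
  shows "binv (pow_braid w d) \<subseteq> R - stable_roots G S \<Omega> w"
proof
  fix \<beta>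
  assume \<beta>: "\<beta> \<in> binv (pow_braid w d)"
  then have R: "\<beta> \<in> R" using binv_roots w by (meson pow_braid_closed subsetD)
  obtain x where x: "x \<in> generate W {w}" "x \<in> carrier W" "ta x \<beta> \<in> inversions G S w"
    using pow_braid_inversion[OF w \<beta>] by blast
  have "ta x \<beta> \<in> Rpos" "ta (w \<otimes>\<^bsub>W\<^esub> x) \<beta> \<in> Rneg"
    using x R w by (simp_all add: inversions_def ta_mult)
  then have "\<beta> \<notin> stable_roots G S \<Omega> w"
    using x(1) generate_closed(2)[OF w x(1)] pos_neg_disjoint by (auto simp: stable_roots_def)
  then show "\<beta> \<in> R - stable_roots G S \<Omega> w" using R by simp
qed

lemma card_pos_symmetric:
  assumes "A \<subseteq> R" "\<And>\<beta>. \<beta> \<in> A \<Longrightarrow> (\<lambda>r. - \<beta> r) \<in> A"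
  shows "card A = 2 * card (Rpos \<inter> A)"
proof -
  let ?n = "\<lambda>\<beta>. (\<lambda>r. - \<beta> r) :: 'g \<Rightarrow> real"
  have fin: "finite A" using assms(1) finite_roots by (rule finite_subset)
  have inj: "inj_on ?n (Rpos \<inter> A)" by (rule inj_onI) (metis (no_types) ext minus_equation_iff)
  have "Rneg \<inter> A = ?n ` (Rpos \<inter> A)"
  proof (intro equalityI subsetI)
    fix \<beta>
    assume "\<beta> \<in> Rneg \<inter> A"
    then have "?n \<beta> \<in> Rpos \<inter> A" "\<beta> = ?n (?n \<beta>)" using assms(2) by (auto simp: uminus_pos_iff)
    then show "\<beta> \<in> ?n ` (Rpos \<inter> A)" by (intro image_eqI[of _ ?n "?n \<beta>"])
  qed (use assms(2) in \<open>auto simp: uminus_neg_iff\<close>)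
  then have "card (Rneg \<inter> A) = card (Rpos \<inter> A)" using card_image[OF inj] by simp
  moreover have "A = (Rpos \<inter> A) \<union> (Rneg \<inter> A)" "(Rpos \<inter> A) \<inter> (Rneg \<inter> A) = {}"
    using assms(1) roots_pos_or_neg pos_neg_disjoint by auto
  then have "card A = card (Rpos \<inter> A) + card (Rneg \<inter> A)"
    using card_Un_disjoint[of "Rpos \<inter> A" "Rneg \<inter> A"] fin by simp
  ultimately show ?thesis by simp
qed

lemma stable_roots_uminus:
  assumes "\<beta> \<in> stable_roots G S \<Omega> w" "w \<in> carrier W"
  shows "(\<lambda>r. - \<beta> r) \<in> stable_roots G S \<Omega> w"
proof -
  have "ta x (\<lambda>r. - \<beta> r) = (\<lambda>r. - ta x \<beta> r)" for x
    using word_act_linear[of _ "-1" \<beta> 0 \<beta>]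
      twist_act_linear[of "fst x" "-1" "act (snd x) \<beta>" 0 "act (snd x) \<beta>"]
    by (simp add: twisted_act_def coxeter_act_def)
  then show ?thesis
    using assms by (auto simp: stable_roots_def uminus_in_roots uminus_pos_iff uminus_neg_iff)
qed

section \<open>Inversions of the factors\<close>

abbreviation DGelt where "DGelt \<equiv> DG_elt G S \<Omega>"
abbreviation DGeltup where "DGeltup \<equiv> DG_elt_upto G S \<Omega>"
abbreviation DGup where "DGup \<equiv> DG_upto G S \<Omega>"
abbreviation DGrest where "DGrest i b \<equiv> (DG_rest G S \<Omega> ^^ i) b"

lemma DGrest_closed [simp]: "b \<in> carrier T \<Longrightarrow> DGrest i b \<in> carrier T"
  by (induction i) (simp_all add: DG_rest_props)

lemma DGelt_Suc: "DGelt (Suc i) b = DG_head G S \<Omega> (DGrest i b)"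
  by (simp add: DG_elt_def)

lemma DGelt_untwisted: "b \<in> carrier T \<Longrightarrow> DGelt i b \<in> untwisted G"
  by (simp add: DG_elt_def DG_head_untwisted)

lemma DGelt_W [simp]: "b \<in> carrier T \<Longrightarrow> DGelt i b \<in> carrier W"
  using DGelt_untwisted untwisted_in_W by blast

lemma DGup_closed [simp]: "b \<in> carrier T \<Longrightarrow> DGup i b \<in> carrier T"
  by (induction i) (simp_all add: DG_def)

lemma DGrest_mult_DGup:
  assumes "b \<in> carrier T"
  shows "DGrest i b \<otimes>\<^bsub>T\<^esub> DGup i b = b"
proof (induction i)
  case (Suc i)
  have "DGrest (Suc i) b \<otimes>\<^bsub>T\<^esub> DGup (Suc i) b
      = (DG_rest G S \<Omega> (DGrest i b) \<otimes>\<^bsub>T\<^esub> braid_lift G S (DG_head G S \<Omega> (DGrest i b))) \<otimes>\<^bsub>T\<^esub> DGup i b"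
    using assms DG_rest_props(1)[OF DGrest_closed[OF assms]]
    by (simp add: DG_def DGelt_Suc T.m_assoc DG_head_untwisted untwisted_in_W)
  also have "\<dots> = b" using DG_rest_props(2)[OF DGrest_closed[OF assms]] Suc by simp
  finally show ?case .
qed (use assms in simp)

lemma DGeltup_image: "b \<in> carrier T \<Longrightarrow> DGeltup i b = braid_image (DGup i b)"
  by (induction i) (simp_all add: braid_image_one braid_image_mult DG_def braid_image_lift)

lemma DGeltup_closed: "b \<in> carrier T \<Longrightarrow> DGeltup i b \<in> untwisted G"
proof (induction i)
  case 0
  then show ?case by (simp add: W_one untwisted_eq)
next
  case (Suc i)
  then show ?case using DGelt_untwisted[OF Suc.prems, of "Suc i"] by (auto simp: untwisted_eq W_mult)
qed

lemma factor_inversion: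
  assumes b: "b \<in> carrier T" and g: "\<gamma> \<in> R" "ta (DGeltup i b) \<gamma> \<in> binv (DG G S \<Omega> (Suc i) b)"
  shows "\<gamma> \<in> binv b"
proof -
  have "\<gamma> \<in> binv (DGup (Suc i) b)"
    using g b binv_mult[of "DG G S \<Omega> (Suc i) b" "DGup i b"]
    by (simp add: DG_def DGeltup_image)
  then have "\<gamma> \<in> binv (DGrest (Suc i) b \<otimes>\<^bsub>T\<^esub> DGup (Suc i) b)"
    using binv_mult[OF DGrest_closed[OF b] DGup_closed[OF b], of "Suc i" "Suc i"] by blast
  then show ?thesis unfolding DGrest_mult_DGup[OF b] .
qed

lemma binv_DG:
  "b \<in> carrier T \<Longrightarrow> binv (DG G S \<Omega> i b) = inversions G S (DGelt i b)"
  by (simp add: DG_def binv_lift)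

theorem factor_inversions_unstable:
  assumes w: "w \<in> carrier W"
  shows "binv (DG G S \<Omega> (Suc i) (pow_braid w d))
    \<subseteq> Rpos - ta (DGeltup i (pow_braid w d)) ` stable_roots G S \<Omega> w"
proof
  fix \<beta>
  let ?b = "pow_braid w d"
  assume \<beta>: "\<beta> \<in> binv (DG G S \<Omega> (Suc i) ?b)"
  have b: "?b \<in> carrier T" using w by simp
  have "\<beta> \<in> Rpos" using \<beta> binv_DG[OF b] by (auto simp: inversions_def)
  moreover have "\<beta> \<notin> ta (DGeltup i ?b) ` stable_roots G S \<Omega> w"
  proof
    assume "\<beta> \<in> ta (DGeltup i ?b) ` stable_roots G S \<Omega> w"
    then obtain \<gamma> where "\<gamma> \<in> stable_roots G S \<Omega> w" "\<beta> = ta (DGeltup i ?b) \<gamma>" by blast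
    then show False
      using factor_inversion[OF b, of \<gamma> i] \<beta> pow_braid_inversions_unstable[OF w, of d]
        stable_roots_subset by blast
  qed
  ultimately show "\<beta> \<in> Rpos - ta (DGeltup i ?b) ` stable_roots G S \<Omega> w" by simp
qed

text \<open>The stable roots and their translate by the earlier factors have the same size and are
  both closed under negation, so they contain equally many positive roots.\<close>

theorem factor_length_le:
  assumes w: "w \<in> carrier W"
  shows "coxeter_length G S (DGelt (Suc i) (pow_braid w d)) \<le> card (Rpos - stable_roots G S \<Omega> w)"
proof -
  let ?b = "pow_braid w d" and ?st = "stable_roots G S \<Omega> w"
  have b: "?b \<in> carrier T" using w by simp
  let ?x = "DGeltup i ?b"
  have x: "?x \<in> carrier W" "fst ?x = \<one>\<^bsub>D\<^esub>" "snd ?x \<in> carrier G"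
    using DGeltup_closed[OF b, of i] by (auto simp: untwisted_eq W_carrier)
  have act_x: "ta ?x \<beta> = act (snd ?x) \<beta>" if "\<beta> \<in> R" for \<beta>
    using x that by (simp add: twisted_act_def twist_act_one)
  have "inj_on (ta ?x) ?st"
  proof (rule inj_onI)
    fix \<beta> \<gamma>
    assume "\<beta> \<in> ?st" "\<gamma> \<in> ?st" "ta ?x \<beta> = ta ?x \<gamma>"
    then have "act (snd ?x) \<beta> = act (snd ?x) \<gamma>" using act_x stable_roots_subset by (metis subsetD)
    then show "\<beta> = \<gamma>" using act_inv(2)[OF x(3)] by metis
  qed
  then have "card (ta ?x ` ?st) = card ?st" by (rule card_image)
  moreover have "card ?st = 2 * card (Rpos \<inter> ?st)"
    by (rule card_pos_symmetric) (use stable_roots_subset stable_roots_uminus[OF _ w] in auto)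
  moreover have "card (ta ?x ` ?st) = 2 * card (Rpos \<inter> ta ?x ` ?st)"
  proof (rule card_pos_symmetric)
    show "ta ?x ` ?st \<subseteq> R" using stable_roots_subset[of w] ta_roots[OF x(1)] by blast
    fix \<beta>
    assume "\<beta> \<in> ta ?x ` ?st"
    then obtain \<gamma> where "\<gamma> \<in> ?st" "\<beta> = ta ?x \<gamma>" by blast
    then show "(\<lambda>r. - \<beta> r) \<in> ta ?x ` ?st"
      using ta_uminus[OF x(1), of \<gamma>] stable_roots_uminus[OF _ w, of \<gamma>] by (metis image_eqI)
  qed
  ultimately have eq: "card (Rpos \<inter> ta ?x ` ?st) = card (Rpos \<inter> ?st)" by simp
  have "coxeter_length G S (DGelt (Suc i) ?b) = card (binv (DG G S \<Omega> (Suc i) ?b))"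
    by (simp add: coxeter_length_def binv_DG[OF b])
  also have "\<dots> \<le> card (Rpos - ta ?x ` ?st)"
    by (rule card_mono) (use factor_inversions_unstable[OF w] in auto)
  also have "\<dots> = card (Rpos - ?st)"
    using eq by (simp add: card_Diff_subset_Int)
  finally show ?thesis .
qed

lemma suffix_Inv:
  assumes "suffix u v"
  shows "Inv u \<subseteq> Inv v"
proof -
  have v: "v \<in> carrier G" and u: "u \<in> carrier G" using assms suffix_closed by blast+
  let ?x = "v \<otimes> inv u"
  obtain xs us where xs: "reduced xs" "word_prod G xs = ?x" and us: "reduced us" "word_prod G us = u"
    using ex_reduced u v by (meson inv_closed m_closed)
  then have "word_prod G (xs @ us) = v" using u v by (simp add: reduced_def word_prod_append m_assoc)
  moreover from this have "reduced (xs @ us)"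
    using xs us assms u v by (auto simp: reduced_def suffix_def additive_def m_assoc)
  ultimately show ?thesis
    using word_inversions_reduced us word_inversions_append[of xs us] by (metis Un_upper1)
qed

section \<open>Stabilization\<close>

text \<open>The twist of \<open>u\<close> stands on the left of \<open>b\<^sub>u\<close> and can be absorbed into \<open>Y\<close>.\<close>

lemma divisor_twisted_lift:
  assumes "Y \<in> carrier T" "u \<in> carrier W"
  shows "suffix (snd u) (snd (DG_head G S \<Omega> (Y \<otimes>\<^bsub>T\<^esub> braid_lift G S u)))"
proof -
  obtain d x where u: "u = (d, x)" "d \<in> \<Omega>" "x \<in> carrier G" using assms(2) by (auto simp: W_carrier)
  let ?d = "(d, \<one>\<^bsub>BM\<^esub>)"
  have d: "?d \<in> carrier T" using u by (simp add: T_carrier)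
  have "braid_lift G S u = ?d \<otimes>\<^bsub>T\<^esub> (\<one>\<^bsub>D\<^esub>, lift x)" using u by (simp add: braid_lift_eq T_mult_untwisted)
  moreover have "(\<one>\<^bsub>D\<^esub>, lift x) \<in> carrier T" using u by (simp add: T_carrier)
  ultimately have "Y \<otimes>\<^bsub>T\<^esub> braid_lift G S u = (Y \<otimes>\<^bsub>T\<^esub> ?d) \<otimes>\<^bsub>T\<^esub> (\<one>\<^bsub>D\<^esub>, lift x)"
    using assms(1) d by (simp add: T.m_assoc)
  then show ?thesis
    using divisor_suffix_DG_head[OF T.m_closed[OF assms(1) d] u(3)] u(1) by simp
qed

text \<open>Both descriptions of the sequence are needed. Right multiplication by \<open>b\<^sub>u\<close> shows that
  each head determines the next one, so a repetition persists. Left multiplication by \<open>a\<close>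
  shows that the heads increase in the weak order, so each step without a repetition adds to
  the length. The rests after the stable head inherit both descriptions, with the same \<open>a\<close>.\<close>

lemma heads_of_powers_stabilize:
  assumes Y: "Y \<in> carrier T" and u: "u \<in> carrier W" and a: "a \<in> carrier T"
    and c: "\<And>j. c j = Y \<otimes>\<^bsub>T\<^esub> (braid_lift G S u [^]\<^bsub>T\<^esub> (j::nat))"
    and left: "\<And>j. c (Suc j) = a \<otimes>\<^bsub>T\<^esub> c j"
    and bound: "\<And>j. coxeter_length G S (DG_head G S \<Omega> (c j)) \<le> N"
    and K: "K = N - coxeter_length G S u + 1"
  shows "\<exists>Y' u'. Y' \<in> carrier T \<and> u' \<in> carrier W \<and> coxeter_length G S u' = coxeter_length G S u
    \<and> (\<forall>j. DG_head G S \<Omega> (c (K + j)) = DG_head G S \<Omega> (c K))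
    \<and> (\<forall>j. DG_rest G S \<Omega> (c (K + j)) = Y' \<otimes>\<^bsub>T\<^esub> (braid_lift G S u' [^]\<^bsub>T\<^esub> j))
    \<and> (\<forall>j. DG_rest G S \<Omega> (c (K + Suc j)) = a \<otimes>\<^bsub>T\<^esub> DG_rest G S \<Omega> (c (K + j)))"
proof -
  let ?L = "braid_lift G S" and ?h = "\<lambda>j. DG_head G S \<Omega> (c j)"
  have Lu: "?L u \<in> carrier T" using u by simp
  have cT: "c j \<in> carrier T" for j using Y Lu by (simp add: c)
  have h: "?h j \<in> untwisted G" for j using DG_head_untwisted[OF cT] .
  have hL: "?L (?h j) \<in> carrier T" for j using untwisted_in_W[OF h] by simp
  have right: "c (Suc j) = c j \<otimes>\<^bsub>T\<^esub> ?L u" for j using Y Lu by (simp add: c T.m_assoc)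
  have len_h: "coxeter_length G S (?h j) = len (snd (?h j))" for j
    using coxeter_length_eq[OF untwisted_in_W[OF h]] .
  have hs: "?h j = (\<one>\<^bsub>D\<^esub>, snd (?h j))" "snd (?h j) \<in> carrier G" for j
    using h[of j] by (auto simp: untwisted_eq)
  have grow: "suffix (snd (?h j)) (snd (?h (Suc j)))" for j
  proof (rule divisor_suffix_DG_head)
    show "a \<otimes>\<^bsub>T\<^esub> DG_rest G S \<Omega> (c j) \<in> carrier T" using a DG_rest_props(1)[OF cT] by simp
    have "c (Suc j) = a \<otimes>\<^bsub>T\<^esub> (DG_rest G S \<Omega> (c j) \<otimes>\<^bsub>T\<^esub> ?L (?h j))"
      using left DG_rest_props(2)[OF cT] by simp
    also have "\<dots> = (a \<otimes>\<^bsub>T\<^esub> DG_rest G S \<Omega> (c j)) \<otimes>\<^bsub>T\<^esub> ?L (?h j)"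
      using a DG_rest_props(1)[OF cT] hL by (simp add: T.m_assoc)
    finally show "c (Suc j) = (a \<otimes>\<^bsub>T\<^esub> DG_rest G S \<Omega> (c j)) \<otimes>\<^bsub>T\<^esub> (\<one>\<^bsub>D\<^esub>, lift (snd (?h j)))"
      using hs(1)[of j] by (metis braid_lift_eq fst_conv)
  qed (rule hs(2))
  have stop: "?h (Suc (Suc j)) = ?h (Suc j)" if "?h (Suc j) = ?h j" for j
    using DG_head_mult_cong[OF cT cT Lu that] unfolding right[symmetric] .
  have len_u: "coxeter_length G S u = len (snd u)" using coxeter_length_eq[OF u] .
  have start: "len (snd u) \<le> len (snd (?h (Suc j)))" for j
    using suffix_len_le[OF divisor_twisted_lift[OF cT u, of j]] by (simp only: right)
  (* Each step either adds at least one to the length or is a repetition. *)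
  have progress: "len (snd u) + j \<le> len (snd (?h (Suc j))) \<or> ?h (Suc (Suc j)) = ?h (Suc j)" for j
  proof (induction j)
    case 0
    then show ?case using start by simp
  next
    case (Suc j)
    then show ?case
    proof
      assume *: "len (snd u) + j \<le> len (snd (?h (Suc j)))"
      show ?thesis
      proof (cases "len (snd (?h (Suc (Suc j)))) \<le> len (snd (?h (Suc j)))")
        case True
        then have "?h (Suc (Suc j)) = ?h (Suc j)"
          using suffix_len_eq[OF grow[of "Suc j"]] hs(1) by metis
        then show ?thesis using stop by blast
      next
        case False
        then show ?thesis using * by simp
      qed
    qed (use stop in blast)
  qed
  define k where "k = N - len (snd u)"
  have Kk: "K = Suc k" by (simp add: K k_def len_u)
  have "len (snd u) \<le> N" using start[of 0] bound[of 1] len_h[of 1] by simp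
  then have "N \<le> len (snd (?h K)) \<or> ?h (Suc K) = ?h K"
    using progress[of k] unfolding Kk k_def by simp
  then have stable: "?h (Suc K) = ?h K"
  proof
    assume "N \<le> len (snd (?h K))"
    then have "len (snd (?h (Suc K))) \<le> len (snd (?h K))"
      using bound[of "Suc K"] len_h[of "Suc K"] by simp
    then have "snd (?h K) = snd (?h (Suc K))" by (rule suffix_len_eq[OF grow])
    then show ?thesis by (subst (1 2) hs(1)) simp
  qed
  have const: "?h (K + j) = ?h K" for j
  proof (induction j)
    case (Suc j)
    have "?h (K + Suc j) = ?h (Suc K)"
      using DG_head_mult_cong[OF cT cT Lu, of "K + j" K] Suc
      by (simp only: right add_Suc_right)
    then show ?case by (simp only: stable)
  qed simp
  define z where "z = ?h K"
  have z: "z \<in> untwisted G" "?L z \<in> carrier T" using h hL by (simp_all add: z_def)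
  have "DG_head G S \<Omega> (?L z) = ?h K" using DG_head_braid_lift[OF z(1)] by (simp add: z_def)
  then have "DG_head G S \<Omega> (?L z \<otimes>\<^bsub>T\<^esub> ?L u) = z"
    using DG_head_mult_cong[OF z(2) cT Lu, of K] const[of 1] by (simp add: z_def right)
  then obtain u' where u': "u' \<in> carrier W" "?L z \<otimes>\<^bsub>T\<^esub> ?L u = ?L u' \<otimes>\<^bsub>T\<^esub> ?L z"
    "coxeter_length G S u' = coxeter_length G S u"
    using slide_through_head[OF z(1) u] by blast
  have Lu': "?L u' \<in> carrier T" using u' by simp
  have slide: "?L z \<otimes>\<^bsub>T\<^esub> (?L u [^]\<^bsub>T\<^esub> j) = (?L u' [^]\<^bsub>T\<^esub> j) \<otimes>\<^bsub>T\<^esub> ?L z" for j :: nat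
  proof (induction j)
    case (Suc j)
    have "?L z \<otimes>\<^bsub>T\<^esub> (?L u [^]\<^bsub>T\<^esub> Suc j) = (?L z \<otimes>\<^bsub>T\<^esub> (?L u [^]\<^bsub>T\<^esub> j)) \<otimes>\<^bsub>T\<^esub> ?L u"
      using z Lu by (simp add: T.m_assoc)
    also have "\<dots> = (?L u' [^]\<^bsub>T\<^esub> j) \<otimes>\<^bsub>T\<^esub> (?L z \<otimes>\<^bsub>T\<^esub> ?L u)"
      unfolding Suc using z Lu Lu' by (simp add: T.m_assoc)
    also have "\<dots> = (?L u' [^]\<^bsub>T\<^esub> Suc j) \<otimes>\<^bsub>T\<^esub> ?L z"
      unfolding u'(2) using z Lu' by (simp add: T.m_assoc)
    finally show ?case .
  qed (use z in simp)
  define Y' where "Y' = DG_rest G S \<Omega> (c K)"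
  have Y': "Y' \<in> carrier T" "Y' \<otimes>\<^bsub>T\<^esub> ?L z = c K"
    using DG_rest_props[OF cT[of K]] by (simp_all add: Y'_def z_def)
  have rest: "DG_rest G S \<Omega> (c (K + j)) = Y' \<otimes>\<^bsub>T\<^esub> (?L u' [^]\<^bsub>T\<^esub> j)" for j
  proof (rule DG_rest_unique[OF cT])
    have "(Y' \<otimes>\<^bsub>T\<^esub> (?L u' [^]\<^bsub>T\<^esub> j)) \<otimes>\<^bsub>T\<^esub> ?L z = Y' \<otimes>\<^bsub>T\<^esub> (?L z \<otimes>\<^bsub>T\<^esub> (?L u [^]\<^bsub>T\<^esub> j))"
      unfolding slide using Y'(1) Lu' z by (simp add: T.m_assoc)
    also have "\<dots> = (Y' \<otimes>\<^bsub>T\<^esub> ?L z) \<otimes>\<^bsub>T\<^esub> (?L u [^]\<^bsub>T\<^esub> j)"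
      using Y'(1) Lu z by (simp add: T.m_assoc)
    also have "\<dots> = c (K + j)"
      unfolding Y'(2) using Y Lu by (simp add: c T.m_assoc T.nat_pow_mult)
    finally show "(Y' \<otimes>\<^bsub>T\<^esub> (?L u' [^]\<^bsub>T\<^esub> j)) \<otimes>\<^bsub>T\<^esub> ?L (?h (K + j)) = c (K + j)"
      by (simp only: const z_def)
  qed (use Y' Lu' in simp)
  have "DG_rest G S \<Omega> (c (K + Suc j)) = a \<otimes>\<^bsub>T\<^esub> DG_rest G S \<Omega> (c (K + j))" for j
  proof (rule DG_rest_unique[OF cT])
    note r = DG_rest_props[OF cT[of "K + j"]]
    have same: "?h (K + Suc j) = ?h (K + j)" by (simp only: const)
    have next_c: "c (K + Suc j) = a \<otimes>\<^bsub>T\<^esub> c (K + j)" using left[of "K + j"] by simp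
    have "(a \<otimes>\<^bsub>T\<^esub> DG_rest G S \<Omega> (c (K + j))) \<otimes>\<^bsub>T\<^esub> ?L (?h (K + j)) = a \<otimes>\<^bsub>T\<^esub> c (K + j)"
      using a r hL by (simp add: T.m_assoc)
    then show "(a \<otimes>\<^bsub>T\<^esub> DG_rest G S \<Omega> (c (K + j))) \<otimes>\<^bsub>T\<^esub> ?L (?h (K + Suc j)) = c (K + Suc j)"
      unfolding same by (simp only: next_c)
  qed (use a DG_rest_props(1)[OF cT] in simp)
  then show ?thesis using Y'(1) u'(1,3) const rest by blast
qed

text \<open>After \<open>i K\<close> powers the first \<open>i\<close> factors no longer change, and removing them leaves a
  sequence of the same shape as the powers themselves, so the argument for one head applies
  again. The first term of such a sequence need not be divisible by \<open>b\<^sub>u\<close>, so its heads have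
  the lower bound on their length only from the second term on; this is the \<open>+ 1\<close> in \<open>K\<close>.\<close>

theorem factors_stabilize:
  assumes w: "w \<in> carrier W"
    and K: "K = card (Rpos - stable_roots G S \<Omega> w) - coxeter_length G S w + 1"
  shows "(\<exists>Y u. Y \<in> carrier T \<and> u \<in> carrier W \<and> coxeter_length G S u = coxeter_length G S w
      \<and> (\<forall>j. DGrest i (pow_braid w (i * K + j)) = Y \<otimes>\<^bsub>T\<^esub> (braid_lift G S u [^]\<^bsub>T\<^esub> j)))
    \<and> (\<forall>j. DGrest i (pow_braid w (i * K + Suc j))
          = braid_lift G S w \<otimes>\<^bsub>T\<^esub> DGrest i (pow_braid w (i * K + j)))
    \<and> (\<forall>j. \<forall>k<i. DGelt (Suc k) (pow_braid w (i * K + j)) = DGelt (Suc k) (pow_braid w (i * K)))"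
proof (induction i)
  case 0
  have "DGrest 0 (pow_braid w (0 * K + j)) = \<one>\<^bsub>T\<^esub> \<otimes>\<^bsub>T\<^esub> (braid_lift G S w [^]\<^bsub>T\<^esub> j)" for j
    using w by (simp add: braid_power_def)
  moreover have "DGrest 0 (pow_braid w (0 * K + Suc j))
      = braid_lift G S w \<otimes>\<^bsub>T\<^esub> DGrest 0 (pow_braid w (0 * K + j))" for j
    using pow_braid_Suc(2)[OF w] by simp
  ultimately show ?case using w T.one_closed by blast
next
  case (Suc i)
  define c where "c j = DGrest i (pow_braid w (i * K + j))" for j
  obtain Y u where Yu: "Y \<in> carrier T" "u \<in> carrier W" "coxeter_length G S u = coxeter_length G S w"
    and cY: "\<And>j. c j = Y \<otimes>\<^bsub>T\<^esub> (braid_lift G S u [^]\<^bsub>T\<^esub> j)"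
    using Suc unfolding c_def by blast
  have left: "c (Suc j) = braid_lift G S w \<otimes>\<^bsub>T\<^esub> c j" for j using Suc by (simp add: c_def)
  have head_c: "DG_head G S \<Omega> (c j) = DGelt (Suc i) (pow_braid w (i * K + j))" for j
    by (simp add: DGelt_Suc c_def)
  have bound: "coxeter_length G S (DG_head G S \<Omega> (c j)) \<le> card (Rpos - stable_roots G S \<Omega> w)" for j
    unfolding head_c by (rule factor_length_le[OF w])
  have cK: "DG_rest G S \<Omega> (c (K + j)) = DGrest (Suc i) (pow_braid w (Suc i * K + j))" for j
    by (simp add: c_def add.assoc add.left_commute)
  have hK: "DG_head G S \<Omega> (c (K + j)) = DGelt (Suc i) (pow_braid w (Suc i * K + j))" for j
    by (simp add: head_c add.assoc add.left_commute)
  obtain Y' u' where Yu': "Y' \<in> carrier T" "u' \<in> carrier W" "coxeter_length G S u' = coxeter_length G S u"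
    and head: "\<And>j. DG_head G S \<Omega> (c (K + j)) = DG_head G S \<Omega> (c K)"
    and rest: "\<And>j. DG_rest G S \<Omega> (c (K + j)) = Y' \<otimes>\<^bsub>T\<^esub> (braid_lift G S u' [^]\<^bsub>T\<^esub> j)"
    and rest_left: "\<And>j. DG_rest G S \<Omega> (c (K + Suc j)) = braid_lift G S w \<otimes>\<^bsub>T\<^esub> DG_rest G S \<Omega> (c (K + j))"
    using heads_of_powers_stabilize[OF Yu(1,2) braid_lift_closed[OF w] cY left bound, of K] K Yu(3) by auto
  have old: "DGelt (Suc k) (pow_braid w (Suc i * K + j)) = DGelt (Suc k) (pow_braid w (Suc i * K))"
    if "k < i" for j k
  proof -
    have *: "DGelt (Suc k) (pow_braid w (i * K + l)) = DGelt (Suc k) (pow_braid w (i * K))" for l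
      using Suc that by blast
    have "Suc i * K + j = i * K + (K + j)" "Suc i * K = i * K + K" by simp_all
    then show ?thesis using * by metis
  qed
  have new: "DGelt (Suc i) (pow_braid w (Suc i * K + j)) = DGelt (Suc i) (pow_braid w (Suc i * K))" for j
    using head[of j] hK[of j] hK[of 0] by simp
  show ?case
  proof (intro conjI allI impI)
    show "\<exists>Y u. Y \<in> carrier T \<and> u \<in> carrier W \<and> coxeter_length G S u = coxeter_length G S w
      \<and> (\<forall>j. DGrest (Suc i) (pow_braid w (Suc i * K + j)) = Y \<otimes>\<^bsub>T\<^esub> (braid_lift G S u [^]\<^bsub>T\<^esub> j))"
      using Yu' Yu(3) rest unfolding cK by metis
    show "DGrest (Suc i) (pow_braid w (Suc i * K + Suc j))
          = braid_lift G S w \<otimes>\<^bsub>T\<^esub> DGrest (Suc i) (pow_braid w (Suc i * K + j))" for j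
      using rest_left[of j] unfolding cK .
    show "DGelt (Suc k) (pow_braid w (Suc i * K + j)) = DGelt (Suc k) (pow_braid w (Suc i * K))"
      if "k < Suc i" for j k
      using that old new less_Suc_eq by metis
  qed
qed

lemma DGup_cong: "(\<And>k. k < i \<Longrightarrow> DGelt (Suc k) b = DGelt (Suc k) b') \<Longrightarrow> DGup i b = DGup i b'"
  by (induction i) (simp_all add: DG_def)

end

theorem proposition4:
  fixes G :: "('g, 'm) monoid_scheme"
    and S :: "'g set"
    and \<Omega> :: "('g \<Rightarrow> 'g) set"
    and w :: "('g \<Rightarrow> 'g) \<times> 'g"
  assumes "twisted_finite_coxeter_group G S \<Omega>"
    and "w \<in> carrier (twisted_group G \<Omega>)"
  shows
    "(\<forall>d::nat. d \<ge> 1 \<longrightarrow>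
        braid_inversions G S (braid_power G S \<Omega> w d) \<subseteq> roots G S - stable_roots G S \<Omega> w) \<and>
     (\<forall>i::nat. i \<ge> 1 \<longrightarrow>
        (\<forall>d::nat. d \<ge> 1 \<longrightarrow>
           braid_inversions G S (DG G S \<Omega> i (braid_power G S \<Omega> w d))
             \<subseteq> pos_roots G S -
                twisted_act G S (DG_elt_upto G S \<Omega> (i - 1) (braid_power G S \<Omega> w d))
                  ` stable_roots G S \<Omega> w \<and>
           inversions G S w \<subseteq> braid_inversions G S (DG G S \<Omega> 1 (braid_power G S \<Omega> w d)) \<and>
           braid_inversions G S (DG G S \<Omega> 1 (braid_power G S \<Omega> w d))
             \<subseteq> pos_roots G S - stable_roots G S \<Omega> w \<and>
           coxeter_length G S (DG_elt G S \<Omega> i (braid_power G S \<Omega> w d))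
             \<le> card (pos_roots G S - stable_roots G S \<Omega> w)) \<and>
        (let d = i * (card (pos_roots G S - stable_roots G S \<Omega> w) - coxeter_length G S w + 1)
         in \<forall>d'\<ge>d.
              DG_upto G S \<Omega> i (braid_power G S \<Omega> w d') = DG_upto G S \<Omega> i (braid_power G S \<Omega> w d)))"
proof -
  interpret twisted_finite_coxeter_group G S \<Omega> by fact
  note w = assms(2)
  have first: "inversions G S w \<subseteq> binv (DG G S \<Omega> 1 (pow_braid w d))" if "d \<ge> 1" for d
  proof -
    obtain d0 where d: "d = Suc d0" using \<open>d \<ge> 1\<close> by (cases d) auto
    have "suffix (snd w) (snd (DGelt 1 (pow_braid w d)))"
      unfolding d pow_braid_Suc(1)[OF w] DG_elt_def
      using divisor_twisted_lift[OF pow_braid_closed[OF w] w] by simp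
    then have "Inv (snd w) \<subseteq> Inv (snd (DGelt 1 (pow_braid w d)))" by (rule suffix_Inv)
    then show ?thesis using w by (simp add: binv_DG inversions_eq)
  qed
  have unstable: "binv (DG G S \<Omega> 1 (pow_braid w d)) \<subseteq> Rpos - stable_roots G S \<Omega> w" for d
  proof -
    have "ta (DGeltup 0 (pow_braid w d)) ` stable_roots G S \<Omega> w = stable_roots G S \<Omega> w"
    proof -
      have "ta (DGeltup 0 (pow_braid w d)) \<beta> = \<beta>" if "\<beta> \<in> stable_roots G S \<Omega> w" for \<beta>
        using ta_one subsetD[OF stable_roots_subset that] by simp
      then show ?thesis by simp
    qed
    then show ?thesis using factor_inversions_unstable[OF w, of 0 d] by simp
  qed
  have stab: "DGup i (pow_braid w d') = DGup i (pow_braid w d)"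
    if "d = i * (card (Rpos - stable_roots G S \<Omega> w) - coxeter_length G S w + 1)" "d' \<ge> d" for i d d'
  proof (rule DGup_cong)
    fix k
    assume "k < i"
    obtain j where "d' = d + j" using \<open>d' \<ge> d\<close> le_iff_add by blast
    then show "DGelt (Suc k) (pow_braid w d') = DGelt (Suc k) (pow_braid w d)"
      using factors_stabilize[OF w HOL.refl, of i] \<open>k < i\<close> that(1) by blast
  qed
  have factor: "binv (DG G S \<Omega> i (pow_braid w d))
      \<subseteq> Rpos - ta (DGeltup (i - 1) (pow_braid w d)) ` stable_roots G S \<Omega> w"
    and length: "coxeter_length G S (DGelt i (pow_braid w d)) \<le> card (Rpos - stable_roots G S \<Omega> w)"
    if "i \<ge> 1" for i d
    using factor_inversions_unstable[OF w, of "i - 1" d] factor_length_le[OF w, of "i - 1" d] that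
    by simp_all
  show ?thesis
    unfolding Let_def
    using pow_braid_inversions_unstable[OF w] first unstable factor length stab by blast
qed

end
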